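(* Let $\varphi$ and $\psi$ be linear fractional self-maps of the unit disk $D$, at least one of which is not an automorphism of $D$. Then the commutator $[C_\psi^{\ast}, C_\varphi]$ is non-trivially compact on the Dirichlet space $\mathcal{D}(D)$ if and only if one of the following holds: (i) $\varphi$ and $\psi$ are both parabolic with the same boundary fixed point; (ii) $\varphi$ and $\psi$ are both hyperbolic, with the fixed points of $\varphi$ being $\zeta$ and $a$ and the fixed points of $\psi$ being $\zeta$ and $1/\overline{a}$, for some $\zeta\in\partial D$.
   Context: A linear fractional self-map of $D$ is $\varphi(z)=\frac{az+b}{cz+d}$ with $ad-bc\neq0$ mapping $D$ into $D$. The Dirichlet space $\mathcal{D}(D)$ consists of holomorphic $f=\sum_{n\ge0}c_nz^n$ on $D$ with $\|f\|^2=|c_0|^2+\sum_{n\ge1}n|c_n|^2<\infty$. $C_\varphi f=f\circ\varphi$, $C_\psi^\ast$ is the adjoint in $\mathcal{D}(D)$, $[C_\psi^\ast,C_\varphi]=C_\psi^\ast C_\varphi-C_\varphi C_\psi^\ast$; it is non-trivially compact if it is compact and nonzero and neither $C_\psi^\ast C_\varphi$ nor $C_\varphi C_\psi^\ast$ is compact. A linear fractional self-map of $D$ with a fixed point on $\partial D$ is called parabolic if that boundary point is its only fixed point (in the extended complex plane), and hyperbolic if it has an additional fixed point. *)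

theory Defs
  imports "HOL-Analysis.Analysis"
begin

type_synonym coeffs = "complex \<times> complex \<times> complex \<times> complex"

definition lft :: "coeffs \<Rightarrow> complex \<Rightarrow> complex" where
  "lft q z = (case q of (a,b,c,d) \<Rightarrow> (a*z+b)/(c*z+d))"

definition is_lfsm :: "coeffs \<Rightarrow> bool" where
  "is_lfsm q = (case q of (a,b,c,d) \<Rightarrow> a*d - b*c \<noteq> 0 \<and>
      (\<forall>z\<in>ball 0 1. c*z+d \<noteq> 0 \<and> lft q z \<in> ball 0 1))"

definition is_disk_aut :: "coeffs \<Rightarrow> bool" where
  "is_disk_aut q = (lft q ` ball 0 1 = ball 0 1)"

text \<open>Fixed points in the extended plane; None represents \<infinity>.
  A finite z is fixed iff c z^2 + (d - a) z - b = 0; \<infinity> is fixed iff c = 0.\<close>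
definition fixset :: "coeffs \<Rightarrow> complex option set" where
  "fixset q = (case q of (a,b,c,d) \<Rightarrow>
      {Some z | z. c*z^2 + (d-a)*z - b = 0} \<union> (if c = 0 then {None} else {}))"

definition parabolic_at :: "coeffs \<Rightarrow> complex \<Rightarrow> bool" where
  "parabolic_at q \<zeta> = (cmod \<zeta> = 1 \<and> fixset q = {Some \<zeta>})"

definition hyperbolic_at :: "coeffs \<Rightarrow> complex \<Rightarrow> bool" where
  "hyperbolic_at q \<zeta> = (cmod \<zeta> = 1 \<and> (\<exists>w. w \<noteq> Some \<zeta> \<and> fixset q = {Some \<zeta>, w}))"

definition circ_refl :: "complex option \<Rightarrow> complex option" where
  "circ_refl w = (case w of None \<Rightarrow> Some 0
      | Some z \<Rightarrow> (if z = 0 then None else Some (1 / cnj z)))"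

definition tcoeff :: "(complex \<Rightarrow> complex) \<Rightarrow> nat \<Rightarrow> complex" where
  "tcoeff f n = (deriv ^^ n) f 0 / fact n"

definition dir_space :: "(complex \<Rightarrow> complex) set" where
  "dir_space = {f. f holomorphic_on ball 0 1 \<and>
      summable (\<lambda>n. of_nat n * (cmod (tcoeff f n))^2)}"

definition dinner :: "(complex \<Rightarrow> complex) \<Rightarrow> (complex \<Rightarrow> complex) \<Rightarrow> complex" where
  "dinner f g = tcoeff f 0 * cnj (tcoeff g 0) +
      (\<Sum>n. of_nat n * tcoeff f n * cnj (tcoeff g n))"

definition dnorm :: "(complex \<Rightarrow> complex) \<Rightarrow> real" where
  "dnorm f = sqrt ((cmod (tcoeff f 0))^2 + (\<Sum>n. of_nat n * (cmod (tcoeff f n))^2))"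

type_synonym op = "(complex \<Rightarrow> complex) \<Rightarrow> (complex \<Rightarrow> complex)"

definition comp_op :: "(complex \<Rightarrow> complex) \<Rightarrow> op" where
  "comp_op \<phi> f = f \<circ> \<phi>"

definition is_dir_adjoint :: "op \<Rightarrow> op \<Rightarrow> bool" where
  "is_dir_adjoint T S = ((\<forall>f\<in>dir_space. S f \<in> dir_space) \<and>
      (\<forall>f\<in>dir_space. \<forall>g\<in>dir_space. dinner (S f) g = dinner f (T g)))"

text \<open>The adjoint in the Dirichlet space (unique on the space up to values off the disk).\<close>
definition dir_adjoint :: "op \<Rightarrow> op" where
  "dir_adjoint T = (SOME S. is_dir_adjoint T S)"

definition dir_compact :: "op \<Rightarrow> bool" where
  "dir_compact T = (\<forall>f :: nat \<Rightarrow> complex \<Rightarrow> complex.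
      (\<forall>n. f n \<in> dir_space) \<and> (\<exists>B. \<forall>n. dnorm (f n) \<le> B) \<longrightarrow>
      (\<exists>r g. strict_mono r \<and> g \<in> dir_space \<and>
         (\<lambda>n. dnorm (\<lambda>z. T (f (r n)) z - g z)) \<longlonglongrightarrow> 0))"

definition dir_nonzero :: "op \<Rightarrow> bool" where
  "dir_nonzero T = (\<exists>f\<in>dir_space. dnorm (T f) \<noteq> 0)"

definition commutator :: "op \<Rightarrow> op \<Rightarrow> op" where
  "commutator A B f = (\<lambda>z. A (B f) z - B (A f) z)"

definition nontriv_compact_comm :: "op \<Rightarrow> op \<Rightarrow> bool" where
  "nontriv_compact_comm A B = (dir_compact (commutator A B) \<and> dir_nonzero (commutator A B)
      \<and> \<not> dir_compact (A \<circ> B) \<and> \<not> dir_compact (B \<circ> A))"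

end

theory Submission
  imports Defs "HOL-Complex_Analysis.Complex_Analysis"
begin

text \<open>
  Let \<open>\<sigma>\<close> be the Krein adjoint of \<open>\<psi>\<close>. On Taylor coefficients, \<open>n [z\<^sup>n] \<psi>\<^sup>m = m cnj ([z\<^sup>m] \<sigma>\<^sup>n)\<close>,
  so the adjoint of \<open>C\<^sub>\<psi>\<close> is \<open>C\<^sub>\<sigma>\<close> up to an operator of rank two, and the commutator is
  \<open>f \<mapsto> f \<circ> (\<phi> \<circ> \<sigma>) - f \<circ> (\<sigma> \<circ> \<phi>)\<close> up to finite rank. An operator \<open>f \<mapsto> f \<circ> \<alpha>\<close> is compact when
  the image of \<open>\<alpha>\<close> stays away from the circle. If it does not, testing on reproducing kernels of the
  derivative along horocycles at a contact point shows that neither \<open>f \<mapsto> f \<circ> \<alpha>\<close> nor, for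
  \<open>\<beta> \<noteq> \<alpha>\<close>, \<open>f \<mapsto> f \<circ> \<alpha> - f \<circ> \<beta>\<close> is compact. Hence \<open>\<phi>\<close> and \<open>\<sigma>\<close> commute and their composition reaches
  the circle. Since one of them has a single point of contact, they share a boundary fixed point;
  their matrices then commute, which means that \<open>\<phi>\<close> and \<open>\<sigma>\<close> have the same fixed points. Those of \<open>\<sigma>\<close>
  are the reflections of those of \<open>\<psi>\<close>.
\<close>

section \<open>Taylor coefficients on the unit disk\<close>

text \<open>The norm is given by coefficients, so the usual proof that composition is bounded, by a
  change of variables, would first need the norm as an area integral of |f'|^2; boundedness is drawn
  from a symmetry instead. The rank two part comes from the constants: \<open>\<sigma>\<close> gives
  the exact adjoint only for the semi-inner product that ignores the value at 0. This part cannot be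
  discarded, because once \<open>\<phi>\<close> and \<open>\<sigma>\<close> commute it is all that
  is left of the commutator and decides whether the commutator vanishes. Equal maps have coefficient
  matrices that agree only up to a factor \<open>k\<close>; determinants still allow
  \<open>k = -1\<close>, and matrices that anticommute need not share fixed points, so
  \<open>k = 1\<close> has to be extracted from the behaviour on the circle. Excluding a pair of
  automorphisms is what puts a common fixed point on the circle: two non-trivial rotations about the
  same interior point other than 0 also have a non-trivially compact commutator.\<close>

lemma tcoeff_cong:
  assumes "\<And>z. z \<in> ball 0 1 \<Longrightarrow> f z = g z"
  shows "tcoeff f n = tcoeff g n"
proof -
  have "eventually (\<lambda>z::complex. z \<in> ball 0 1) (nhds 0)"
    by (intro eventually_nhds_in_open) auto
  then have "eventually (\<lambda>z. f z = g z) (nhds 0)"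
    by eventually_elim (use assms in auto)
  then show ?thesis
    unfolding tcoeff_def by (simp add: higher_deriv_cong_ev)
qed

lemma tcoeff_sums:
  assumes "f holomorphic_on ball 0 1" "cmod z < 1"
  shows "(\<lambda>n. tcoeff f n * z ^ n) sums f z"
  using holomorphic_power_series[OF assms(1), of z] assms(2) by (simp add: tcoeff_def)

lemma holomorphic_of_power_series:
  assumes "\<And>z::complex. cmod z < 1 \<Longrightarrow> (\<lambda>n. c n * z ^ n) sums f z"
  shows "f holomorphic_on ball 0 1"
  using power_series_holomorphic[of 0 1 c f] assms by simp

lemma tcoeff_of_power_series:
  assumes "\<And>z::complex. cmod z < 1 \<Longrightarrow> (\<lambda>n. c n * z ^ n) sums f z"
  shows "tcoeff f n = c n"
proof -
  have 1: "conv_radius c \<ge> 1"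
  proof (rule conv_radius_geI_ex)
    fix r :: real assume "0 < r" "ereal r < 1"
    then show "\<exists>z. norm z = r \<and> summable (\<lambda>n. c n * z ^ n)"
      using assms[of "of_real r"] by (intro exI[of _ "of_real r"]) (auto simp: sums_iff)
  qed
  have "f has_fps_expansion Abs_fps c"
    unfolding has_fps_expansion_def
  proof
    show "fps_conv_radius (Abs_fps c) > 0"
      using 1 by (auto simp: fps_conv_radius_def intro: less_le_trans[of _ "1::ereal"])
    have "eventually (\<lambda>z::complex. z \<in> ball 0 1) (nhds 0)"
      by (intro eventually_nhds_in_open) auto
    then show "eventually (\<lambda>z. eval_fps (Abs_fps c) z = f z) (nhds 0)"
      by eventually_elim (use assms in \<open>auto simp: eval_fps_def sums_iff\<close>)
  qed
  from fps_nth_fps_expansion[OF this, of n] show ?thesis by (simp add: tcoeff_def)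
qed

lemma tcoeff_0 [simp]: "tcoeff f 0 = f 0"
  by (simp add: tcoeff_def)

lemma tcoeff_add:
  assumes "f holomorphic_on ball 0 1" "g holomorphic_on ball 0 1"
  shows "tcoeff (\<lambda>z. f z + g z) n = tcoeff f n + tcoeff g n"
  by (rule tcoeff_of_power_series)
     (use sums_add[OF tcoeff_sums[OF assms(1)] tcoeff_sums[OF assms(2)]] in \<open>auto simp: ring_distribs\<close>)

lemma tcoeff_diff:
  assumes "f holomorphic_on ball 0 1" "g holomorphic_on ball 0 1"
  shows "tcoeff (\<lambda>z. f z - g z) n = tcoeff f n - tcoeff g n"
  by (rule tcoeff_of_power_series)
     (use sums_diff[OF tcoeff_sums[OF assms(1)] tcoeff_sums[OF assms(2)]] in \<open>auto simp: ring_distribs\<close>)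

lemma tcoeff_cmult:
  assumes "f holomorphic_on ball 0 1"
  shows "tcoeff (\<lambda>z. c * f z) n = c * tcoeff f n"
  by (rule tcoeff_of_power_series)
     (use sums_mult[OF tcoeff_sums[OF assms(1)], of _ c] in \<open>auto simp: mult_ac\<close>)

lemma tcoeff_finite_sum:
  assumes "finite A" "\<And>k. k \<in> A \<Longrightarrow> f k holomorphic_on ball 0 1"
  shows "tcoeff (\<lambda>z. \<Sum>k\<in>A. f k z) n = (\<Sum>k\<in>A. tcoeff (f k) n)"
  using assms
proof (induction A rule: finite_induct)
  case empty
  then show ?case by (intro tcoeff_of_power_series) simp
next
  case (insert k A)
  then show ?case
    by (simp add: tcoeff_add holomorphic_on_sum)
qed

lemma tcoeff_poly:
  "tcoeff (\<lambda>z. \<Sum>k<N. c k * z ^ k) n = (if n < N then c n else 0)"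
proof (rule tcoeff_of_power_series)
  fix z :: complex
  have "(\<lambda>n. (if n \<in> {..<N} then c n * z ^ n else 0)) sums (\<Sum>k\<in>{..<N}. c k * z ^ k)"
    by (rule sums_If_finite_set) simp
  moreover have "(\<lambda>n. (if n \<in> {..<N} then c n * z ^ n else 0)) = (\<lambda>n. (if n < N then c n else 0) * z ^ n)"
    by auto
  ultimately show "(\<lambda>n. (if n < N then c n else 0) * z ^ n) sums (\<Sum>k<N. c k * z ^ k)" by simp
qed

lemma tcoeff_power: "tcoeff (\<lambda>z. z ^ m) n = (if n = m then 1 else 0)"
proof (rule tcoeff_of_power_series)
  fix z :: complex
  have "(\<lambda>n. (if n = m then z ^ n else 0)) sums z ^ m"
    by (rule sums_single)
  moreover have "(\<lambda>n. (if n = m then z ^ n else 0)) = (\<lambda>n. (if n = m then 1 else 0) * z ^ n)"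
    by auto
  ultimately show "(\<lambda>n. (if n = m then 1 else 0) * z ^ n) sums z ^ m" by simp
qed

lemma tcoeff_const: "tcoeff (\<lambda>z. c) n = (if n = 0 then c else 0)"
  using tcoeff_cmult[of "\<lambda>z. z ^ 0" c n] tcoeff_power[of 0 n] by simp

lemma tcoeff_eqD:
  assumes "f holomorphic_on ball 0 1" "g holomorphic_on ball 0 1"
    and "\<And>n. tcoeff f n = tcoeff g n" "cmod z < 1"
  shows "f z = g z"
  using tcoeff_sums[OF assms(1,4)] tcoeff_sums[OF assms(2,4)] assms(3) by (simp add: sums_iff)

lemma deriv_sums:
  assumes f: "f holomorphic_on ball 0 1" and z: "cmod z < 1"
  shows "(\<lambda>n. of_nat n * tcoeff f n * z ^ (n - 1)) sums deriv f z"
proof -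
  obtain r where r: "cmod z < r" "r < 1" using z dense by blast
  have "summable (\<lambda>n. tcoeff f n * complex_of_real r ^ n)"
    using tcoeff_sums[OF f, of "complex_of_real r"] r norm_ge_zero[of z] by (auto simp: sums_iff)
  from power_series_and_derivative_0[of "tcoeff f" r] this
  obtain g g' where g: "\<And>z. cmod z < r \<Longrightarrow> (\<lambda>n. tcoeff f n * z^n) sums g z"
     "\<And>z. cmod z < r \<Longrightarrow> (\<lambda>n. of_nat n * tcoeff f n * z^(n-1)) sums g' z"
     "\<And>z. cmod z < r \<Longrightarrow> (g has_field_derivative g' z) (at z)"
    by auto
  have eq: "g w = f w" if "w \<in> ball 0 r" for w
    using g(1)[of w] tcoeff_sums[OF f, of w] that r by (auto simp: sums_iff)
  have "(f has_field_derivative g' z) (at z)"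
    by (rule has_field_derivative_transform_within_open[OF g(3)[OF r(1)], of "ball 0 r"])
       (use r eq in auto)
  then have "deriv f z = g' z" by (rule DERIV_imp_deriv)
  with g(2)[OF r(1)] show ?thesis by simp
qed

lemma tcoeff_deriv:
  assumes f: "f holomorphic_on ball 0 1"
  shows "tcoeff (deriv f) n = of_nat (Suc n) * tcoeff f (Suc n)"
proof (rule tcoeff_of_power_series)
  fix z :: complex assume "cmod z < 1"
  from deriv_sums[OF f this]
  show "(\<lambda>n. of_nat (Suc n) * tcoeff f (Suc n) * z ^ n) sums deriv f z"
    using sums_Suc_iff[of "\<lambda>n. of_nat n * tcoeff f n * z ^ (n - 1)" "deriv f z"] by simp
qed

lemma tcoeff_uniform_limit:
  assumes "0 < r" "uniform_limit (ball 0 r) f g sequentially"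
    and "\<And>n. f n holomorphic_on ball 0 r"
  shows "(\<lambda>n. tcoeff (f n) m) \<longlonglongrightarrow> tcoeff g m"
  unfolding tcoeff_def
  by (intro tendsto_divide tendsto_const higher_deriv_complex_uniform_limit[OF assms(2)])
     (use assms in auto)

lemma cball_image_subset:
  fixes s :: "complex \<Rightarrow> complex"
  assumes s: "s holomorphic_on ball 0 1" "\<And>z. cmod z < 1 \<Longrightarrow> cmod (s z) < 1"
    and r: "0 \<le> r" "r < 1"
  obtains \<rho> where "0 \<le> \<rho>" "\<rho> < 1" "\<And>z. cmod z \<le> r \<Longrightarrow> cmod (s z) \<le> \<rho>"
proof -
  have ne: "cball (0::complex) r \<noteq> {}" using r by auto
  have "continuous_on (cball 0 r) (\<lambda>z. cmod (s z))"
    by (intro continuous_on_norm holomorphic_on_imp_continuous_on holomorphic_on_subset[OF s(1)])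
       (use r in auto)
  then obtain x where x: "x \<in> cball 0 r" "\<And>z. z \<in> cball 0 r \<Longrightarrow> cmod (s z) \<le> cmod (s x)"
    using continuous_attains_sup[OF compact_cball ne] by blast
  then show ?thesis using that[of "cmod (s x)"] s(2)[of x] r by auto
qed

text \<open>Taylor coefficients are local at 0, so uniform convergence near 0 is enough:
  \<open>s\<close> maps the disk of radius 1/2 into a compact subdisk, on which the Taylor series of
  \<open>h\<close> converges uniformly.\<close>

lemma tcoeff_compose_sums:
  assumes h: "h holomorphic_on ball 0 1" and s: "s holomorphic_on ball 0 1"
    and sD: "\<And>z. cmod z < 1 \<Longrightarrow> cmod (s z) < 1"
  shows "(\<lambda>k. tcoeff h k * tcoeff (\<lambda>z. s z ^ k) m) sums tcoeff (\<lambda>z. h (s z)) m"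
proof -
  obtain \<rho> where \<rho>: "0 \<le> \<rho>" "\<rho> < 1" "\<And>z. cmod z \<le> 1/2 \<Longrightarrow> cmod (s z) \<le> \<rho>"
    using cball_image_subset[OF s sD, of "1/2"] by auto
  obtain \<rho>' where \<rho>': "\<rho> < \<rho>'" "\<rho>' < 1" using \<rho> dense by blast
  have "conv_radius (tcoeff h) \<ge> norm (complex_of_real \<rho>')"
    by (rule conv_radius_geI)
       (use tcoeff_sums[OF h, of "complex_of_real \<rho>'"] \<rho> \<rho>' in \<open>auto simp: sums_iff\<close>)
  then have "ereal \<rho> < conv_radius (tcoeff h)"
    using \<rho> \<rho>' by (auto intro: less_le_trans[of _ "ereal \<rho>'"])
  from powser_uniform_limit[OF this, of 0]
  have ul: "uniform_limit (cball 0 \<rho>) (\<lambda>n x. \<Sum>i<n. tcoeff h i * x ^ i) (\<lambda>x. \<Sum>i. tcoeff h i * x ^ i) sequentially"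
    by simp
  have ul2: "uniform_limit (cball 0 \<rho>) (\<lambda>n x. \<Sum>i<n. tcoeff h i * x ^ i) h sequentially"
    by (rule iffD1[OF uniform_limit_cong' ul])
       (use tcoeff_sums[OF h] \<rho> in \<open>auto simp: sums_iff\<close>)
  have "uniform_limit (ball 0 (1/2)) (\<lambda>n z. \<Sum>i<n. tcoeff h i * s z ^ i) (\<lambda>z. h (s z)) sequentially"
    by (rule uniform_limit_compose'[OF ul2]) (use \<rho>(3) in auto)
  then have "(\<lambda>n. tcoeff (\<lambda>z. \<Sum>i<n. tcoeff h i * s z ^ i) m) \<longlonglongrightarrow> tcoeff (\<lambda>z. h (s z)) m"
    by (rule tcoeff_uniform_limit[rotated])
       (auto intro!: holomorphic_intros holomorphic_on_subset[OF s])
  moreover have "tcoeff (\<lambda>z. \<Sum>i<n. tcoeff h i * s z ^ i) m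
      = (\<Sum>i<n. tcoeff h i * tcoeff (\<lambda>z. s z ^ i) m)" for n
    by (simp add: tcoeff_finite_sum tcoeff_cmult holomorphic_intros s)
  ultimately show ?thesis by (simp add: sums_def)
qed

section \<open>The Dirichlet space\<close>

text \<open>The squared norm and the inner product without the contribution of the value at 0.
  Constants are null for \<open>dsem\<close>, and composition with the Krein adjoint is an exact
  adjoint only for \<open>dform\<close>.\<close>

definition dsem :: "(complex \<Rightarrow> complex) \<Rightarrow> real" where
  "dsem f = (\<Sum>n. of_nat n * (cmod (tcoeff f n))^2)"

definition dform :: "(complex \<Rightarrow> complex) \<Rightarrow> (complex \<Rightarrow> complex) \<Rightarrow> complex" where
  "dform f g = (\<Sum>n. of_nat n * tcoeff f n * cnj (tcoeff g n))"

lemma Cauchy_Schwarz_suminf: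
  fixes a b :: "nat \<Rightarrow> real"
  assumes nn: "\<And>n. 0 \<le> a n" "\<And>n. 0 \<le> b n"
    and a: "summable (\<lambda>n. (a n)^2)" and b: "summable (\<lambda>n. (b n)^2)"
  shows "summable (\<lambda>n. a n * b n)"
    and "(\<Sum>n. a n * b n) \<le> sqrt (\<Sum>n. (a n)^2) * sqrt (\<Sum>n. (b n)^2)"
proof -
  have *: "(\<Sum>n<N. a n * b n) \<le> sqrt (\<Sum>n. (a n)^2) * sqrt (\<Sum>n. (b n)^2)" for N
  proof -
    have "(\<Sum>n<N. a n * b n) = (\<Sum>n<N. \<bar>a n\<bar> * \<bar>b n\<bar>)" using nn by simp
    also have "\<dots> \<le> L2_set a {..<N} * L2_set b {..<N}" by (rule L2_set_mult_ineq)
    also have "\<dots> \<le> sqrt (\<Sum>n. (a n)^2) * sqrt (\<Sum>n. (b n)^2)"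
      unfolding L2_set_def
      by (intro mult_mono real_sqrt_le_mono sum_le_suminf a b real_sqrt_ge_zero sum_nonneg suminf_nonneg) auto
    finally show ?thesis .
  qed
  show s: "summable (\<lambda>n. a n * b n)"
    by (rule summableI_nonneg_bounded[OF _ *]) (use nn in auto)
  show "(\<Sum>n. a n * b n) \<le> sqrt (\<Sum>n. (a n)^2) * sqrt (\<Sum>n. (b n)^2)"
    by (rule suminf_le_const[OF s *])
qed

lemma dir_space_holo: "f \<in> dir_space \<Longrightarrow> f holomorphic_on ball 0 1"
  by (simp add: dir_space_def)

lemma dir_space_summable: "f \<in> dir_space \<Longrightarrow> summable (\<lambda>n. of_nat n * (cmod (tcoeff f n))^2)"
  by (simp add: dir_space_def)

lemma dsem_nonneg: "f \<in> dir_space \<Longrightarrow> 0 \<le> dsem f"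
  unfolding dsem_def by (intro suminf_nonneg dir_space_summable) auto

lemma dnorm_sq: "f \<in> dir_space \<Longrightarrow> (dnorm f)^2 = (cmod (f 0))^2 + dsem f"
  using dsem_nonneg[of f] by (simp add: dnorm_def dsem_def)

lemma dnorm_nonneg: "f \<in> dir_space \<Longrightarrow> 0 \<le> dnorm f"
  using dsem_nonneg[of f] by (simp add: dnorm_def dsem_def)

lemma dnorm_cong:
  assumes "\<And>z. z \<in> ball 0 1 \<Longrightarrow> f z = g z"
  shows "dnorm f = dnorm g"
  using tcoeff_cong[OF assms] unfolding dnorm_def by presburger

lemma sqrt_dsem_le_dnorm: "f \<in> dir_space \<Longrightarrow> sqrt (dsem f) \<le> dnorm f"
  unfolding dnorm_def dsem_def by simp

lemma norm_0_le_dnorm: "f \<in> dir_space \<Longrightarrow> cmod (f 0) \<le> dnorm f"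
  using dsem_nonneg[of f] unfolding dnorm_def dsem_def tcoeff_0 by (intro real_le_rsqrt) simp

lemma dform_bound:
  assumes f: "f \<in> dir_space" and g: "g \<in> dir_space"
  shows "summable (\<lambda>n. of_nat n * tcoeff f n * cnj (tcoeff g n))"
    and "cmod (dform f g) \<le> sqrt (dsem f) * sqrt (dsem g)"
proof -
  let ?a = "\<lambda>n. sqrt (real n) * cmod (tcoeff f n)" and ?b = "\<lambda>n. sqrt (real n) * cmod (tcoeff g n)"
  have sa: "summable (\<lambda>n. (?a n)^2)" and sb: "summable (\<lambda>n. (?b n)^2)"
    using dir_space_summable[OF f] dir_space_summable[OF g] by (simp_all add: power_mult_distrib)
  have eq: "?a n * ?b n = norm (of_nat n * tcoeff f n * cnj (tcoeff g n))" for n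
    by (simp add: norm_mult)
  have s: "summable (\<lambda>n. norm (of_nat n * tcoeff f n * cnj (tcoeff g n)))"
    using Cauchy_Schwarz_suminf(1)[OF _ _ sa sb] unfolding eq by simp
  then show "summable (\<lambda>n. of_nat n * tcoeff f n * cnj (tcoeff g n))"
    by (rule summable_norm_cancel)
  have "cmod (dform f g) \<le> (\<Sum>n. norm (of_nat n * tcoeff f n * cnj (tcoeff g n)))"
    unfolding dform_def by (rule summable_norm[OF s])
  also have "\<dots> \<le> sqrt (\<Sum>n. (?a n)^2) * sqrt (\<Sum>n. (?b n)^2)"
    using Cauchy_Schwarz_suminf(2)[OF _ _ sa sb] unfolding eq by simp
  finally show "cmod (dform f g) \<le> sqrt (dsem f) * sqrt (dsem g)"
    by (simp add: dsem_def power_mult_distrib)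
qed

lemma dform_self: "f \<in> dir_space \<Longrightarrow> dform f f = of_real (dsem f)"
proof -
  assume f: "f \<in> dir_space"
  have eq: "(\<lambda>n. of_nat n * tcoeff f n * cnj (tcoeff f n)) = (\<lambda>n. of_real (of_nat n * (cmod (tcoeff f n))^2))"
    by (simp only: mult.assoc complex_norm_square [symmetric]) simp
  show ?thesis unfolding dform_def dsem_def eq by (rule suminf_of_real[OF dir_space_summable[OF f], symmetric])
qed

lemma dinner_eq: "dinner f g = f 0 * cnj (g 0) + dform f g"
  by (simp add: dinner_def dform_def)

lemma dform_cnj: "f \<in> dir_space \<Longrightarrow> g \<in> dir_space \<Longrightarrow> dform g f = cnj (dform f g)"
  unfolding dform_def
  using sums_cnj[of "\<lambda>n. of_nat n * tcoeff f n * cnj (tcoeff g n)"] dform_bound(1)[of f g]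
  by (auto simp: sums_iff mult_ac)

lemma dir_space_add_aux:
  assumes f: "f \<in> dir_space" and g: "g \<in> dir_space"
  shows "(\<lambda>z. f z + g z) \<in> dir_space \<and> dsem (\<lambda>z. f z + g z) \<le> 2 * dsem f + 2 * dsem g"
proof -
  have t: "tcoeff (\<lambda>z. f z + g z) n = tcoeff f n + tcoeff g n" for n
    using tcoeff_add[OF dir_space_holo[OF f] dir_space_holo[OF g]] .
  have ineq: "of_nat n * (cmod (tcoeff f n + tcoeff g n))^2 \<le>
      2 * (of_nat n * (cmod (tcoeff f n))^2) + 2 * (of_nat n * (cmod (tcoeff g n))^2)" for n
  proof -
    have "(cmod (tcoeff f n + tcoeff g n))^2 \<le> (cmod (tcoeff f n) + cmod (tcoeff g n))^2"
      by (intro power_mono norm_triangle_ineq) auto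
    also have "\<dots> \<le> 2 * (cmod (tcoeff f n))^2 + 2 * (cmod (tcoeff g n))^2"
      using sum_squares_bound[of "cmod (tcoeff f n)" "cmod (tcoeff g n)"]
      by (simp add: power2_sum)
    finally have "real n * (cmod (tcoeff f n + tcoeff g n))^2 \<le> real n * (2 * (cmod (tcoeff f n))^2 + 2 * (cmod (tcoeff g n))^2)"
      by (rule mult_left_mono) simp
    then show ?thesis by (simp add: algebra_simps)
  qed
  have s: "summable (\<lambda>n. 2 * (real n * (cmod (tcoeff f n))^2) + 2 * (real n * (cmod (tcoeff g n))^2))"
    by (intro summable_add summable_mult dir_space_summable f g)
  have s2: "summable (\<lambda>n. of_nat n * (cmod (tcoeff f n + tcoeff g n))^2)"
    by (rule summable_comparison_test'[OF s, of 0]) (use ineq in simp)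
  have "dsem (\<lambda>z. f z + g z) \<le> (\<Sum>n. 2 * (real n * (cmod (tcoeff f n))^2) + 2 * (real n * (cmod (tcoeff g n))^2))"
    unfolding dsem_def t by (rule suminf_le[OF ineq s2 s])
  also have "\<dots> = 2 * dsem f + 2 * dsem g" unfolding dsem_def
    by (subst suminf_add [symmetric])
       (auto intro!: summable_mult dir_space_summable f g simp: suminf_mult dir_space_summable f g)
  finally show ?thesis
    using s2 dir_space_holo[OF f] dir_space_holo[OF g] by (simp add: dir_space_def t holomorphic_intros)
qed

lemma dir_space_add: "f \<in> dir_space \<Longrightarrow> g \<in> dir_space \<Longrightarrow> (\<lambda>z. f z + g z) \<in> dir_space"
  using dir_space_add_aux by blast

lemma dsem_add_le: "f \<in> dir_space \<Longrightarrow> g \<in> dir_space \<Longrightarrow> dsem (\<lambda>z. f z + g z) \<le> 2 * dsem f + 2 * dsem g"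
  using dir_space_add_aux by blast

lemma dir_space_cmult_aux:
  assumes f: "f \<in> dir_space"
  shows "(\<lambda>z. c * f z) \<in> dir_space \<and> dsem (\<lambda>z. c * f z) = (cmod c)^2 * dsem f"
proof -
  have t: "tcoeff (\<lambda>z. c * f z) n = c * tcoeff f n" for n
    using tcoeff_cmult[OF dir_space_holo[OF f]] .
  have eq: "of_nat n * (cmod (c * tcoeff f n))^2 = (cmod c)^2 * (of_nat n * (cmod (tcoeff f n))^2)" for n
    by (simp add: norm_mult power_mult_distrib)
  show ?thesis
    using summable_mult[OF dir_space_summable[OF f], of "(cmod c)^2"] dir_space_holo[OF f]
      suminf_mult[OF dir_space_summable[OF f], of "(cmod c)^2"]
    unfolding dir_space_def dsem_def mem_Collect_eq t eq by (intro conjI holomorphic_intros)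
qed

lemma dir_space_cmult: "f \<in> dir_space \<Longrightarrow> (\<lambda>z. c * f z) \<in> dir_space"
  using dir_space_cmult_aux by blast

lemma dsem_cmult: "f \<in> dir_space \<Longrightarrow> dsem (\<lambda>z. c * f z) = (cmod c)^2 * dsem f"
  using dir_space_cmult_aux by blast

lemma dir_space_diff: "f \<in> dir_space \<Longrightarrow> g \<in> dir_space \<Longrightarrow> (\<lambda>z. f z - g z) \<in> dir_space"
  using dir_space_add[of f "\<lambda>z. (-1) * g z"] dir_space_cmult[of g "-1"] by simp

lemma dir_space_poly: "(\<lambda>z. \<Sum>k<N. c k * z ^ k) \<in> dir_space"
proof -
  have "summable (\<lambda>n. real n * (cmod (if n < N then c n else 0))^2)"
    by (rule summable_finite[of "{..<N}"]) auto
  then show ?thesis by (auto simp: dir_space_def tcoeff_poly intro!: holomorphic_intros)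
qed

lemma dir_space_power: "(\<lambda>z. z ^ k) \<in> dir_space"
proof -
  have "summable (\<lambda>n. real n * (cmod (if n = k then 1 else 0))^2)"
    by (rule summable_finite[of "{k}"]) auto
  then show ?thesis by (auto simp: dir_space_def tcoeff_power intro!: holomorphic_intros)
qed

lemma dir_space_const: "(\<lambda>z. c) \<in> dir_space"
  using dir_space_cmult[OF dir_space_power[of 0], of c] by simp

lemma dform_poly: "dform f (\<lambda>z. \<Sum>k<N. c k * z ^ k) = (\<Sum>n<N. of_nat n * tcoeff f n * cnj (c n))"
proof -
  have "dform f (\<lambda>z. \<Sum>k<N. c k * z ^ k) = (\<Sum>n. if n \<in> {..<N} then of_nat n * tcoeff f n * cnj (c n) else 0)"
    unfolding dform_def tcoeff_poly by (rule arg_cong[of _ _ suminf]) auto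
  also have "\<dots> = (\<Sum>n<N. of_nat n * tcoeff f n * cnj (c n))"
    by (rule sums_unique [symmetric]) (rule sums_If_finite_set, simp)
  finally show ?thesis .
qed

lemma dsem_poly: "dsem (\<lambda>z. \<Sum>k<N. c k * z ^ k) = (\<Sum>n<N. of_nat n * (cmod (c n))^2)"
proof -
  have "dsem (\<lambda>z. \<Sum>k<N. c k * z ^ k) = (\<Sum>n. if n \<in> {..<N} then of_nat n * (cmod (c n))^2 else 0)"
    unfolding dsem_def tcoeff_poly by (rule arg_cong[of _ _ suminf]) auto
  also have "\<dots> = (\<Sum>n<N. of_nat n * (cmod (c n))^2)"
    by (rule sums_unique [symmetric]) (rule sums_If_finite_set, simp)
  finally show ?thesis .
qed

lemma dform_diff_left:
  "f \<in> dir_space \<Longrightarrow> g \<in> dir_space \<Longrightarrow> h \<in> dir_space \<Longrightarrow> dform (\<lambda>z. f z - g z) h = dform f h - dform g h"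
  unfolding dform_def using suminf_diff[OF dform_bound(1)[of f h] dform_bound(1)[of g h]]
  by (simp add: tcoeff_diff dir_space_holo ring_distribs)

lemma dform_add_left:
  "f \<in> dir_space \<Longrightarrow> g \<in> dir_space \<Longrightarrow> h \<in> dir_space \<Longrightarrow> dform (\<lambda>z. f z + g z) h = dform f h + dform g h"
  unfolding dform_def using suminf_add[OF dform_bound(1)[of f h] dform_bound(1)[of g h]]
  by (simp add: tcoeff_add dir_space_holo ring_distribs)

lemma dform_diff_right:
  "f \<in> dir_space \<Longrightarrow> g \<in> dir_space \<Longrightarrow> h \<in> dir_space \<Longrightarrow> dform h (\<lambda>z. f z - g z) = dform h f - dform h g"
  unfolding dform_def using suminf_diff[OF dform_bound(1)[of h f] dform_bound(1)[of h g]]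
  by (simp add: tcoeff_diff dir_space_holo ring_distribs)

lemma dform_cmult_left: "f \<in> dir_space \<Longrightarrow> h \<in> dir_space \<Longrightarrow> dform (\<lambda>z. c * f z) h = c * dform f h"
  unfolding dform_def using suminf_mult[OF dform_bound(1)[of f h], of c]
  by (simp add: tcoeff_cmult dir_space_holo mult_ac)

lemma dform_const_left: "dform (\<lambda>z. c) h = 0"
proof -
  have "(\<lambda>n. of_nat n * (if n = 0 then c else 0) * cnj (tcoeff h n)) = (\<lambda>n. 0)" by auto
  then show ?thesis unfolding dform_def tcoeff_const by simp
qed

section \<open>Pointwise bounds for derivatives and values\<close>

lemma geometric_weighted:
  assumes "0 \<le> x" "x < (1::real)"
  shows "(\<lambda>n. of_nat n * x ^ (n - 1)) sums (1 / (1 - x)^2)"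
proof -
  have "(\<lambda>n. of_nat (Suc n) * x ^ n) sums (1 / (1 - x)^2)"
    using geometric_deriv_sums[of x] assms by simp
  then show ?thesis
    using sums_Suc_iff[of "\<lambda>n. of_nat n * x ^ (n - 1)" "1 / (1 - x)^2"] by simp
qed

text \<open>Cauchy-Schwarz against the function representing \<open>f \<mapsto> deriv f z\<close> in
  \<open>dform\<close>; by \<open>geometric_weighted\<close> its seminorm is 1 / (1 - |z|^2). It
  later bounds the norms of images of test functions from below.\<close>

lemma deriv_bound:
  assumes f: "f \<in> dir_space" and z: "cmod z < 1"
  shows "(1 - (cmod z)^2) * cmod (deriv f z) \<le> sqrt (dsem f)"
proof -
  let ?a = "\<lambda>n. sqrt (real n) * cmod (tcoeff f n)" and ?b = "\<lambda>n. sqrt (real n) * cmod z ^ (n - 1)"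
  have x: "0 \<le> (cmod z)^2" "(cmod z)^2 < 1" using z by (auto simp: abs_square_less_1)
  have bs: "(?b n)^2 = real n * ((cmod z)^2) ^ (n - 1)" for n
  proof -
    have "(cmod z ^ (n - 1))^2 = ((cmod z)^2) ^ (n - 1)"
      by (metis power_mult mult.commute)
    then show ?thesis by (simp add: power_mult_distrib)
  qed
  have sa: "summable (\<lambda>n. (?a n)^2)"
    using dir_space_summable[OF f] by (simp_all add: power_mult_distrib)
  have sb: "summable (\<lambda>n. (?b n)^2)" "(\<Sum>n. (?b n)^2) = 1 / (1 - (cmod z)^2)^2"
    using geometric_weighted[OF x] unfolding bs by (auto simp: sums_iff)
  have eq: "?a n * ?b n = norm (of_nat n * tcoeff f n * z ^ (n - 1))" for n
    by (simp add: norm_mult norm_power)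
  have s: "summable (\<lambda>n. norm (of_nat n * tcoeff f n * z ^ (n - 1)))"
    using Cauchy_Schwarz_suminf(1)[OF _ _ sa sb(1)] unfolding eq by simp
  have "cmod (deriv f z) = cmod (\<Sum>n. of_nat n * tcoeff f n * z ^ (n - 1))"
    using deriv_sums[OF dir_space_holo[OF f] z] by (simp add: sums_iff)
  also have "\<dots> \<le> (\<Sum>n. norm (of_nat n * tcoeff f n * z ^ (n - 1)))"
    by (rule summable_norm[OF s])
  also have "\<dots> \<le> sqrt (\<Sum>n. (?a n)^2) * sqrt (\<Sum>n. (?b n)^2)"
    using Cauchy_Schwarz_suminf(2)[OF _ _ sa sb(1)] unfolding eq by simp
  also have "\<dots> = sqrt (dsem f) * (1 / (1 - (cmod z)^2))"
  proof -
    have "sqrt (\<Sum>n. (?b n)^2) = 1 / (1 - (cmod z)^2)"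
      unfolding sb(2) using x by (intro real_sqrt_unique) (auto simp: power_divide)
    then show ?thesis by (simp add: dsem_def power_mult_distrib)
  qed
  finally have "cmod (deriv f z) \<le> sqrt (dsem f) / (1 - (cmod z)^2)" by simp
  then show ?thesis using x by (simp add: pos_le_divide_eq mult.commute)
qed

text \<open>Mean value estimate on the closed disk through \<open>z\<close>. The constant is far
  from sharp, but only boundedness on compact sets is used.\<close>

lemma value_bound:
  assumes f: "f \<in> dir_space" and z: "cmod z < 1"
  shows "cmod (f z) \<le> (1 + 1 / (1 - (cmod z)^2)) * dnorm f"
proof -
  have d: "cmod (deriv f w) \<le> 1 / (1 - (cmod z)^2) * dnorm f" if "w \<in> cball 0 (cmod z)" for w :: complex
  proof -
    have w: "(cmod w)^2 \<le> (cmod z)^2" "(cmod z)^2 < 1" using that z by (auto intro: power_mono simp: abs_square_less_1)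
    have "(1 - (cmod z)^2) * cmod (deriv f w) \<le> (1 - (cmod w)^2) * cmod (deriv f w)"
      using w by (intro mult_right_mono) auto
    also have "\<dots> \<le> sqrt (dsem f)" by (rule deriv_bound[OF f]) (use that z in auto)
    also have "\<dots> \<le> dnorm f" by (rule sqrt_dsem_le_dnorm[OF f])
    finally have "(1 - (cmod z)^2) * cmod (deriv f w) \<le> dnorm f" .
    then have "cmod (deriv f w) \<le> dnorm f / (1 - (cmod z)^2)"
      using w(2) by (simp add: pos_le_divide_eq mult.commute)
    then show ?thesis by simp
  qed
  have der: "(f has_field_derivative deriv f w) (at w within cball 0 (cmod z))"
    if "w \<in> cball 0 (cmod z)" for w :: complex
    using z that by (intro holomorphic_derivI[OF dir_space_holo[OF f]]) auto
  have "cmod (f z - f 0) \<le> 1 / (1 - (cmod z)^2) * dnorm f * cmod (z - 0)"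
    by (rule field_differentiable_bound[OF convex_cball der d]) auto
  also have "\<dots> \<le> 1 / (1 - (cmod z)^2) * dnorm f"
    using z dnorm_nonneg[OF f] by (intro mult_left_le mult_nonneg_nonneg) (auto simp: abs_square_le_1)
  finally have "cmod (f z) \<le> cmod (f 0) + 1 / (1 - (cmod z)^2) * dnorm f"
    using norm_triangle_sub[of "f z" "f 0"] by linarith
  with norm_0_le_dnorm[OF f] show ?thesis by (simp add: algebra_simps)
qed

section \<open>Linear fractional maps and the Krein adjoint\<close>

text \<open>The coefficients of the Krein adjoint \<open>w \<mapsto> 1 / cnj (\<psi>\<^sup>-\<^sup>1 (1 / cnj w))\<close> of \<open>\<psi>\<close>.\<close>

fun kadj :: "coeffs \<Rightarrow> coeffs" where
  "kadj (a, b, c, d) = (cnj a, - cnj c, - cnj b, cnj d)"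

fun mcomp :: "coeffs \<Rightarrow> coeffs \<Rightarrow> coeffs" where
  "mcomp (a, b, c, d) (a', b', c', d') = (a*a' + b*c', a*b' + b*d', c*a' + d*c', c*b' + d*d')"

fun cdet :: "coeffs \<Rightarrow> complex" where
  "cdet (a, b, c, d) = a*d - b*c"

fun numer :: "coeffs \<Rightarrow> complex \<Rightarrow> complex" where
  "numer (a, b, c, d) z = a*z + b"

fun denom :: "coeffs \<Rightarrow> complex \<Rightarrow> complex" where
  "denom (a, b, c, d) z = c*z + d"

lemma lft_eq: "lft q z = numer q z / denom q z"
  by (cases q) (simp add: lft_def)

lemma cdet_mcomp: "cdet (mcomp p q) = cdet p * cdet q"
  by (cases p; cases q) (simp add: algebra_simps)

lemma kadj_mcomp: "kadj (mcomp p q) = mcomp (kadj q) (kadj p)"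
  by (cases p; cases q) (simp add: algebra_simps)

lemma kadj_kadj [simp]: "kadj (kadj q) = q"
  by (cases q) simp

lemma cdet_kadj: "cdet (kadj q) = cnj (cdet q)"
  by (cases q) simp

lemma denom_numer_not_both_0: "cdet q \<noteq> 0 \<Longrightarrow> \<not> (denom q z = 0 \<and> numer q z = 0)"
proof (cases q)
  fix a b c d assume q: "q = (a, b, c, d)" and nz: "cdet q \<noteq> 0"
  have "a * (c*z + d) - c * (a*z + b) = a*d - b*c" by (simp add: algebra_simps)
  then show ?thesis using nz q by auto
qed

text \<open>The strict inequality contains both that the denominator has no zero in the disk and
  that the values lie in it. Free of quotients, it passes to the closed disk by continuity.\<close>

lemma is_lfsm_iff:
  "is_lfsm q \<longleftrightarrow> cdet q \<noteq> 0 \<and> (\<forall>z. cmod z < 1 \<longrightarrow> cmod (numer q z) < cmod (denom q z))"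
proof -
  have "(cmod (numer q z) < cmod (denom q z)) \<longleftrightarrow> denom q z \<noteq> 0 \<and> cmod (numer q z / denom q z) < 1" for z
    by (auto simp: norm_divide divide_less_eq)
  then show ?thesis
    by (cases q) (auto simp: is_lfsm_def lft_def)
qed

lemma lfsm_det: "is_lfsm q \<Longrightarrow> cdet q \<noteq> 0"
  by (simp add: is_lfsm_iff)

lemma lfsm_less: "is_lfsm q \<Longrightarrow> cmod z < 1 \<Longrightarrow> cmod (numer q z) < cmod (denom q z)"
  by (simp add: is_lfsm_iff)

lemma continuous_numer [continuous_intros]: "continuous_on A f \<Longrightarrow> continuous_on A (\<lambda>z. numer q (f z))"
  by (cases q) (auto intro!: continuous_intros)

lemma continuous_denom [continuous_intros]: "continuous_on A f \<Longrightarrow> continuous_on A (\<lambda>z. denom q (f z))"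
  by (cases q) (auto intro!: continuous_intros)

lemma lfsm_le:
  assumes q: "is_lfsm q" and z: "cmod z \<le> 1"
  shows "cmod (numer q z) \<le> cmod (denom q z)"
proof -
  have "z \<in> closure (ball 0 1)" using z by simp
  moreover have "closure (ball 0 1) \<subseteq> {z. cmod (numer q z) \<le> cmod (denom q z)}"
  proof (rule closure_minimal)
    show "ball 0 1 \<subseteq> {z. cmod (numer q z) \<le> cmod (denom q z)}"
      using lfsm_less[OF q] by (auto intro: less_imp_le)
    show "closed {z. cmod (numer q z) \<le> cmod (denom q z)}"
      by (intro closed_Collect_le continuous_on_norm continuous_numer continuous_denom continuous_on_id)
  qed
  ultimately show ?thesis by auto
qed

lemma lfsm_denom_nz: "is_lfsm q \<Longrightarrow> cmod z \<le> 1 \<Longrightarrow> denom q z \<noteq> 0"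
  using lfsm_le[of q z] denom_numer_not_both_0[of q z] lfsm_det[of q] by auto

lemma lfsm_lft_less: "is_lfsm q \<Longrightarrow> cmod z < 1 \<Longrightarrow> cmod (lft q z) < 1"
  using lfsm_less[of q z] lfsm_denom_nz[of q z] by (simp add: lft_eq norm_divide divide_less_eq)

lemma lfsm_lft_le: "is_lfsm q \<Longrightarrow> cmod z \<le> 1 \<Longrightarrow> cmod (lft q z) \<le> 1"
  using lfsm_le[of q z] lfsm_denom_nz[of q z] by (simp add: lft_eq norm_divide divide_le_eq)

text \<open>With the indefinite form \<open>x2 * cnj y2 - x1 * cnj y1\<close> on pairs, both sides
  pair (z, 1) and (w, 1) after a matrix is applied to one of them; \<open>kadj q\<close> is the
  adjoint matrix for this form.\<close>

lemma kadj_form: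
  "denom (kadj q) w - cnj z * numer (kadj q) w = cnj (denom q z - cnj w * numer q z)"
  by (cases q) (simp add: algebra_simps)

text \<open>If the image of \<open>w\<close> were outside the open disk, its reflection
  \<open>z\<close> in the circle would be a point of the closed disk with
  \<open>denom q z = cnj w * numer q z\<close>, where \<open>q\<close> has a pole or a value of
  modulus larger than 1.\<close>

lemma lfsm_kadj:
  assumes q: "is_lfsm q"
  shows "is_lfsm (kadj q)"
  unfolding is_lfsm_iff
proof (intro conjI allI impI)
  show "cdet (kadj q) \<noteq> 0" using lfsm_det[OF q] by (simp add: cdet_kadj)
next
  fix w :: complex assume w: "cmod w < 1"
  show "cmod (numer (kadj q) w) < cmod (denom (kadj q) w)"
  proof (rule ccontr)
    assume "\<not> cmod (numer (kadj q) w) < cmod (denom (kadj q) w)"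
    then have le: "cmod (denom (kadj q) w) \<le> cmod (numer (kadj q) w)" by simp
    have nz: "numer (kadj q) w \<noteq> 0"
      using le denom_numer_not_both_0[of "kadj q" w] lfsm_det[OF q] by (auto simp: cdet_kadj)
    define z where "z = cnj (denom (kadj q) w / numer (kadj q) w)"
    have z: "cmod z \<le> 1" using le nz by (simp add: z_def norm_divide divide_le_eq)
    have "denom (kadj q) w - cnj z * numer (kadj q) w = 0" using nz by (simp add: z_def)
    then have eq: "denom q z = cnj w * numer q z" unfolding kadj_form complex_cnj_zero_iff by simp
    then have "cmod (denom q z) = cmod w * cmod (numer q z)" by (simp add: norm_mult)
    also have "\<dots> \<le> cmod w * cmod (denom q z)" using lfsm_le[OF q z] by (intro mult_left_mono) auto
    also have "\<dots> < cmod (denom q z)" using w lfsm_denom_nz[OF q z] by simp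
    finally show False by simp
  qed
qed

lemma numer_mcomp: "denom q z \<noteq> 0 \<Longrightarrow> numer (mcomp p q) z = denom q z * numer p (lft q z)"
  by (cases p; cases q) (simp add: lft_eq field_simps)

lemma denom_mcomp: "denom q z \<noteq> 0 \<Longrightarrow> denom (mcomp p q) z = denom q z * denom p (lft q z)"
  by (cases p; cases q) (simp add: lft_eq field_simps)

lemma lfsm_mcomp:
  assumes "is_lfsm p" "is_lfsm q"
  shows "is_lfsm (mcomp p q)"
  unfolding is_lfsm_iff
  using assms lfsm_less[OF assms(1) lfsm_lft_less[OF assms(2)]]
  by (auto simp: cdet_mcomp lfsm_det numer_mcomp denom_mcomp lfsm_denom_nz norm_mult)

lemma lft_mcomp: "is_lfsm q \<Longrightarrow> cmod z \<le> 1 \<Longrightarrow> lft (mcomp p q) z = lft p (lft q z)"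
  by (simp add: lft_eq[of "mcomp p q"] numer_mcomp denom_mcomp lfsm_denom_nz lft_eq[of p])

lemma lft_has_deriv:
  assumes "denom q z \<noteq> 0"
  shows "(lft q has_field_derivative cdet q / (denom q z)^2) (at z)"
proof (cases q)
  fix a b c d assume q: "q = (a, b, c, d)"
  have "((\<lambda>z. (a*z+b)/(c*z+d)) has_field_derivative (a * (c*z+d) - (a*z+b) * c) / ((c*z+d) * (c*z+d))) (at z)"
    using assms q by (auto intro!: derivative_eq_intros)
  moreover have "a * (c*z+d) - (a*z+b) * c = a*d - b*c" by (simp add: algebra_simps)
  moreover have "lft q = (\<lambda>z. (a*z+b)/(c*z+d))" by (auto simp: q lft_def)
  ultimately show ?thesis using q by (simp add: power2_eq_square)
qed

lemma lft_holo: "is_lfsm q \<Longrightarrow> lft q holomorphic_on ball 0 1"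
proof (rule holomorphic_onI)
  fix z :: complex assume q: "is_lfsm q" and z: "z \<in> ball 0 1"
  have "denom q z \<noteq> 0" using lfsm_denom_nz[OF q, of z] z by simp
  from lft_has_deriv[OF this] show "lft q field_differentiable at z within ball 0 1"
    unfolding field_differentiable_def using has_field_derivative_at_within by blast
qed

lemma lfsm_ball_image: "is_lfsm q \<Longrightarrow> lft q ` ball 0 1 \<subseteq> ball 0 1"
  using lfsm_lft_less[of q] by auto

lemma comp_lft_holo: "f holomorphic_on ball 0 1 \<Longrightarrow> is_lfsm q \<Longrightarrow> (\<lambda>z. f (lft q z)) holomorphic_on ball 0 1"
  using holomorphic_on_compose_gen[OF lft_holo _ lfsm_ball_image, of q f] by (simp add: o_def)

lemma norm_mult_less_1:
  fixes z w :: complex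
  assumes "cmod z < 1" "cmod w \<le> 1" shows "cmod (z * w) < 1"
proof -
  have "cmod z * cmod w \<le> cmod z * 1" using assms by (intro mult_left_mono) auto
  then show ?thesis using assms by (simp add: norm_mult)
qed

lemma one_minus_nz:
  fixes z w :: complex
  assumes "cmod z < 1" "cmod w \<le> 1" shows "1 - cnj w * z \<noteq> 0"
  using norm_mult_less_1[of z "cnj w"] assms by (auto simp: mult.commute)

section \<open>Kernels of the derivative and the adjoint relation for coefficients\<close>

lemma kernel_sums:
  assumes "cmod z < 1" "cmod w \<le> 1"
  shows "(\<lambda>n. (if n = 0 then 0 else cnj w ^ (n - 1)) * z ^ n) sums (z / (1 - cnj w * z))"
proof -
  have "(\<lambda>n. (cnj w * z) ^ n) sums (1 / (1 - cnj w * z))"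
    by (rule geometric_sums) (use norm_mult_less_1[of z "cnj w"] assms in \<open>auto simp: mult.commute\<close>)
  from sums_mult[OF this, of z]
  have "(\<lambda>n. cnj w ^ n * z ^ Suc n) sums (z / (1 - cnj w * z))"
    by (simp add: power_mult_distrib mult_ac)
  then show ?thesis
    using sums_Suc_iff[of "\<lambda>n. (if n = 0 then 0 else cnj w ^ (n - 1)) * z ^ n"] by simp
qed

lemma kernel_holo: "cmod w \<le> 1 \<Longrightarrow> (\<lambda>z. z / (1 - cnj w * z)) holomorphic_on ball 0 1"
  by (rule holomorphic_of_power_series[OF kernel_sums])

lemma tcoeff_kernel: "cmod w \<le> 1 \<Longrightarrow> tcoeff (\<lambda>z. z / (1 - cnj w * z)) n = (if n = 0 then 0 else cnj w ^ (n - 1))"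
  by (rule tcoeff_of_power_series[OF kernel_sums])

text \<open>The function \<open>h w\<close> represents \<open>f \<mapsto> deriv f w\<close>, so by
  the chain rule the adjoint of composition with \<open>q\<close> must send it to the conjugate of
  q'(w) times \<open>h (lft q w)\<close>. Composition with \<open>kadj q\<close> does this up to a
  constant; \<open>cdet q / (denom q w)^2\<close> is q'(w).\<close>

lemma kernel_compose:
  assumes q: "is_lfsm q" and z: "cmod z < 1" and w: "cmod w < 1"
  defines "h \<equiv> \<lambda>v z. z / (1 - cnj v * z)"
  shows "h w (lft (kadj q) z) =
    h w (lft (kadj q) 0) + cnj (cdet q / (denom q w)^2) * h (lft q w) z"
proof -
  obtain a b c d where qe: "q = (a, b, c, d)" by (cases q)
  let ?N = "numer (kadj q)" and ?D = "denom (kadj q)"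
  have D: "?D z \<noteq> 0" "?D 0 \<noteq> 0" "denom q w \<noteq> 0"
    using lfsm_denom_nz[OF lfsm_kadj[OF q]] lfsm_denom_nz[OF q, of w] z w by auto
  have h1: "h w (lft (kadj q) x) = ?N x / (?D x - cnj w * ?N x)" if "?D x \<noteq> 0" for x
  proof -
    have "1 - cnj w * (?N x / ?D x) = (?D x - cnj w * ?N x) / ?D x" using that by (simp add: field_simps)
    then show ?thesis using that by (simp add: h_def lft_eq)
  qed
  have f: "?D x - cnj w * ?N x = cnj (denom q w) - x * cnj (numer q w)" for x
    using kadj_form[of q x w] by (simp add: mult.commute)
  have nz: "cnj (denom q w) - x * cnj (numer q w) \<noteq> 0" if "cmod x < 1" for x
  proof
    assume "cnj (denom q w) - x * cnj (numer q w) = 0"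
    then have "cmod (denom q w) = cmod x * cmod (numer q w)"
      by (metis complex_mod_cnj eq_iff_diff_eq_0 norm_mult)
    moreover have "cmod x * cmod (numer q w) \<le> 1 * cmod (numer q w)" using that by (intro mult_right_mono) auto
    ultimately show False using lfsm_less[OF q w] by simp
  qed
  have h2: "h (lft q w) z = z * cnj (denom q w) / (cnj (denom q w) - z * cnj (numer q w))"
  proof -
    have "1 - cnj (lft q w) * z = (cnj (denom q w) - z * cnj (numer q w)) / cnj (denom q w)"
      using D(3) by (simp add: lft_eq field_simps)
    then show ?thesis using D(3) by (simp add: h_def)
  qed
  let ?E = "cnj (denom q w)" and ?F = "cnj (numer q w)"
  have e: "?N z * ?E = ?N 0 * (?E - z * ?F) + cnj (cdet q) * z"
    by (simp add: qe algebra_simps)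
  have E: "?E \<noteq> 0" using D by simp
  have "?N z / (?E - z * ?F) = ?N 0 / ?E + cnj (cdet q) / ?E^2 * (z * ?E / (?E - z * ?F))"
    using nz[OF z] E e by (simp add: divide_simps power2_eq_square)
  then show ?thesis
    unfolding h1[OF D(1)] h1[OF D(2)] h2 f by simp
qed

text \<open>Obtained by expanding \<open>kernel_compose\<close> in powers of \<open>w\<close> and comparing the coefficients of \<open>z ^ m\<close>.\<close>

lemma matrix_adjoint:
  assumes q: "is_lfsm q"
  shows "of_nat n * tcoeff (\<lambda>z. lft q z ^ m) n = of_nat m * cnj (tcoeff (\<lambda>z. lft (kadj q) z ^ n) m)"
proof (cases "m = 0")
  case True
  then show ?thesis by (auto simp: tcoeff_const)
next
  case m: False
  note kq = lfsm_kadj[OF q]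
  have *: "(\<lambda>k. of_nat m * cnj (tcoeff (\<lambda>z. lft (kadj q) z ^ Suc k) m) * w ^ k) sums deriv (\<lambda>z. lft q z ^ m) w"
    if w: "cmod w < 1" for w
  proof -
    let ?h = "\<lambda>v z. z / (1 - cnj v * z)"
    let ?c = "cnj (cdet q / (denom q w)^2)"
    have L: "cmod (lft q w) < 1" by (rule lfsm_lft_less[OF q w])
    have "(\<lambda>k. tcoeff (?h w) k * tcoeff (\<lambda>z. lft (kadj q) z ^ k) m) sums tcoeff (\<lambda>z. ?h w (lft (kadj q) z)) m"
      using tcoeff_compose_sums[OF kernel_holo[OF less_imp_le[OF w]] lft_holo[OF kq] lfsm_lft_less[OF kq]] .
    also have "tcoeff (\<lambda>z. ?h w (lft (kadj q) z)) m = tcoeff (\<lambda>z. ?h w (lft (kadj q) 0) + ?c * ?h (lft q w) z) m"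
      by (intro tcoeff_cong kernel_compose[OF q _ w]) simp
    also have "\<dots> = ?c * cnj (lft q w) ^ (m - 1)"
    proof -
      note K = kernel_holo[OF less_imp_le[OF L]]
      have "tcoeff (\<lambda>z. C + e * ?h (lft q w) z) m = e * cnj (lft q w) ^ (m - 1)" for C e
        unfolding tcoeff_add[OF holomorphic_on_const holomorphic_on_mult[OF holomorphic_on_const K]]
          tcoeff_cmult[OF K] tcoeff_const tcoeff_kernel[OF less_imp_le[OF L]] using m by simp
      then show ?thesis .
    qed
    finally have "(\<lambda>k. tcoeff (?h w) k * tcoeff (\<lambda>z. lft (kadj q) z ^ k) m) sums (?c * cnj (lft q w) ^ (m - 1))" .
    \<comment> \<open>The kernel has no coefficient of order 0; dropping it shifts the index, which
      matches the index shift of the derivative.\<close>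
    then have "(\<lambda>k. cnj w ^ k * tcoeff (\<lambda>z. lft (kadj q) z ^ Suc k) m) sums (?c * cnj (lft q w) ^ (m - 1))"
      using w sums_Suc_iff[of "\<lambda>k. tcoeff (?h w) k * tcoeff (\<lambda>z. lft (kadj q) z ^ k) m"]
      by (simp add: tcoeff_kernel)
    then have "(\<lambda>k. cnj (cnj w ^ k * tcoeff (\<lambda>z. lft (kadj q) z ^ Suc k) m)) sums cnj (?c * cnj (lft q w) ^ (m - 1))"
      by (simp only: sums_cnj)
    then have "(\<lambda>k. w ^ k * cnj (tcoeff (\<lambda>z. lft (kadj q) z ^ Suc k) m)) sums (cdet q / (denom q w)^2 * lft q w ^ (m - 1))"
      by simp
    from sums_mult[OF this, of "of_nat m"]
    have "(\<lambda>k. of_nat m * cnj (tcoeff (\<lambda>z. lft (kadj q) z ^ Suc k) m) * w ^ k) sums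
        (of_nat m * (cdet q / (denom q w)^2 * lft q w ^ (m - 1)))"
      by (simp add: mult_ac)
    moreover have "((\<lambda>z. lft q z ^ m) has_field_derivative of_nat m * (cdet q / (denom q w)^2 * lft q w ^ (m - 1))) (at w)"
      using DERIV_power[OF lft_has_deriv[OF lfsm_denom_nz[OF q, of w]], of m] w
      by (simp add: mult_ac)
    ultimately show ?thesis by (simp add: DERIV_imp_deriv)
  qed
  have holo: "(\<lambda>z. lft q z ^ m) holomorphic_on ball 0 1" by (intro holomorphic_intros lft_holo q)
  show ?thesis
  proof (cases n)
    case 0
    then show ?thesis using m by (simp add: tcoeff_const)
  next
    case (Suc k)
    show ?thesis
      using tcoeff_of_power_series[OF *, of k] unfolding tcoeff_deriv[OF holo] Suc by simp
  qed
qed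

text \<open>A polynomial in the second argument makes one of the two summations finite, so their
  order may be exchanged for every holomorphic \<open>f\<close>, before composition is known to be
  bounded.\<close>

lemma dform_poly_adjoint:
  fixes c :: "nat \<Rightarrow> complex" and N :: nat
  assumes q: "is_lfsm q" and f: "f holomorphic_on ball 0 1"
  defines "G \<equiv> \<lambda>z. \<Sum>k<N. c k * z ^ k"
  shows "dform (\<lambda>z. f (lft q z)) G = dform f (\<lambda>z. G (lft (kadj q) z))"
proof -
  note kq = lfsm_kadj[OF q]
  have t: "tcoeff (\<lambda>z. G (lft (kadj q) z)) m = (\<Sum>n<N. c n * tcoeff (\<lambda>z. lft (kadj q) z ^ n) m)" for m
    unfolding G_def
    by (simp add: tcoeff_finite_sum tcoeff_cmult holomorphic_intros lft_holo[OF kq])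
  have 1: "(\<lambda>m. of_nat m * tcoeff f m * cnj (tcoeff (\<lambda>z. lft (kadj q) z ^ n) m)) sums
      (of_nat n * tcoeff (\<lambda>z. f (lft q z)) n)" for n
  proof -
    have "(\<lambda>m. tcoeff f m * tcoeff (\<lambda>z. lft q z ^ m) n) sums tcoeff (\<lambda>z. f (lft q z)) n"
      by (rule tcoeff_compose_sums[OF f lft_holo[OF q] lfsm_lft_less[OF q]])
    from sums_mult[OF this, of "of_nat n"] 
    have "(\<lambda>m. tcoeff f m * (of_nat n * tcoeff (\<lambda>z. lft q z ^ m) n)) sums (of_nat n * tcoeff (\<lambda>z. f (lft q z)) n)"
      by (simp add: mult_ac)
    then show ?thesis unfolding matrix_adjoint[OF q] by (simp add: mult_ac)
  qed
  have "(\<lambda>m. \<Sum>n<N. cnj (c n) * (of_nat m * tcoeff f m * cnj (tcoeff (\<lambda>z. lft (kadj q) z ^ n) m))) sums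
      (\<Sum>n<N. cnj (c n) * (of_nat n * tcoeff (\<lambda>z. f (lft q z)) n))"
    by (intro sums_sum sums_mult 1)
  also have "(\<lambda>m. \<Sum>n<N. cnj (c n) * (of_nat m * tcoeff f m * cnj (tcoeff (\<lambda>z. lft (kadj q) z ^ n) m))) =
      (\<lambda>m. of_nat m * tcoeff f m * cnj (tcoeff (\<lambda>z. G (lft (kadj q) z)) m))"
    unfolding t by (simp add: sum_distrib_left mult_ac)
  finally have "dform f (\<lambda>z. G (lft (kadj q) z)) = (\<Sum>n<N. cnj (c n) * (of_nat n * tcoeff (\<lambda>z. f (lft q z)) n))"
    unfolding dform_def by (rule sums_unique [symmetric])
  also have "\<dots> = dform (\<lambda>z. f (lft q z)) G"
    unfolding G_def dform_poly by (simp add: mult_ac)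
  finally show ?thesis by simp
qed

section \<open>Boundedness of composition operators\<close>

text \<open>Bounds on two derivatives are needed: the Cauchy estimates for the first one
  alone give \<open>n\<^sup>2 |c\<^sub>n|\<^sup>2 \<le> M\<^sup>2\<close>, which does not make \<open>n |c\<^sub>n|\<^sup>2\<close> summable.\<close>

definition C2_bound :: "real \<Rightarrow> (complex \<Rightarrow> complex) \<Rightarrow> bool" where
  "C2_bound M h \<longleftrightarrow> h holomorphic_on ball 0 1 \<and>
     (\<forall>z. cmod z < 1 \<longrightarrow> cmod (deriv h z) \<le> M \<and> cmod (deriv (deriv h) z) \<le> M)"

lemma deriv_eq_on_ball:
  assumes "\<And>z. cmod z < 1 \<Longrightarrow> f z = g z" "cmod z < 1"
  shows "deriv f z = deriv g z"
proof (rule deriv_cong_ev[OF _ refl])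
  have "eventually (\<lambda>w. w \<in> ball 0 1) (nhds z)"
    using assms(2) by (intro eventually_nhds_in_open) auto
  then show "eventually (\<lambda>w. f w = g w) (nhds z)"
    by eventually_elim (use assms(1) in auto)
qed

lemma C2_bound_cong:
  assumes "C2_bound M f" "\<And>z. cmod z < 1 \<Longrightarrow> f z = g z"
  shows "C2_bound M g"
proof -
  have 1: "cmod z < 1 \<Longrightarrow> deriv f z = deriv g z" for z
    using deriv_eq_on_ball[of f g z] assms(2) by blast
  have 2: "cmod z < 1 \<Longrightarrow> deriv (deriv f) z = deriv (deriv g) z" for z
    using deriv_eq_on_ball[of "deriv f" "deriv g" z] 1 by blast
  show ?thesis
    using assms 1 2 unfolding C2_bound_def
    by (auto intro: holomorphic_transform)
qed

text \<open>Cauchy's inequality on circles of radius r < 1 with r tending to 1, as \<open>f\<close>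
  is not assumed to extend to the unit circle.\<close>

lemma tcoeff_bound:
  assumes f: "f holomorphic_on ball 0 1" and M: "\<And>z. cmod z < 1 \<Longrightarrow> cmod (f z) \<le> M"
  shows "cmod (tcoeff f n) \<le> M"
proof -
  have "cmod (tcoeff f n) * r ^ n \<le> M" if r: "0 < r" "r < 1" for r
  proof -
    have "cmod ((deriv ^^ n) f 0) \<le> fact n * M / r ^ n"
    proof (rule Cauchy_inequality)
      show "f holomorphic_on ball 0 r" by (rule holomorphic_on_subset[OF f]) (use r in auto)
      show "continuous_on (cball 0 r) f"
        by (intro holomorphic_on_imp_continuous_on holomorphic_on_subset[OF f]) (use r in auto)
    qed (use r M in auto)
    then show ?thesis using r by (simp add: tcoeff_def norm_divide field_simps)
  qed
  then have ev: "eventually (\<lambda>r. cmod (tcoeff f n) * r ^ n \<le> M) (at_left 1)"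
    by (auto simp: eventually_at_left_field intro!: exI[of _ 0])
  have "((\<lambda>r. cmod (tcoeff f n) * r ^ n) \<longlongrightarrow> cmod (tcoeff f n) * 1 ^ n) (at_left (1::real))"
    by (intro tendsto_intros)
  from tendsto_upperbound[OF this ev] show ?thesis by simp
qed

text \<open>The coefficient bound 2 M / n^2 makes n |c_n|^2 at most 4 M^2 / n^3. The term for n = 0
  is 0 by the convention for division by zero.\<close>

definition C2_const :: real where
  "C2_const = (\<Sum>n. 4 / real n ^ 3)"

lemma C2_bound_dsem:
  assumes "C2_bound M h"
  shows "h \<in> dir_space" and "dsem h \<le> C2_const * M^2"
proof -
  have h: "h holomorphic_on ball 0 1"
    and b: "\<And>z. cmod z < 1 \<Longrightarrow> cmod (deriv h z) \<le> M" "\<And>z. cmod z < 1 \<Longrightarrow> cmod (deriv (deriv h) z) \<le> M"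
    using assms by (auto simp: C2_bound_def)
  have h': "deriv h holomorphic_on ball 0 1" "deriv (deriv h) holomorphic_on ball 0 1"
    by (auto intro!: holomorphic_intros h)
  have M: "M \<ge> 0" using order_trans[OF norm_ge_zero b(1)[of 0]] by simp
  have c: "cmod (tcoeff h n) \<le> 2 * M / real n ^ 2" if "n \<noteq> 0" for n
  proof (cases "n = 1")
    case True
    then show ?thesis using tcoeff_bound[OF h'(1) b(1), of 0] tcoeff_deriv[OF h, of 0] M by simp
  next
    case False
    then obtain k where n: "n = Suc (Suc k)" using \<open>n \<noteq> 0\<close> by (metis One_nat_def not0_implies_Suc)
    have "real (Suc k) * real n * cmod (tcoeff h n) \<le> M"
      using tcoeff_bound[OF h'(2) b(2), of k] tcoeff_deriv[OF h'(1), of k] tcoeff_deriv[OF h, of "Suc k"]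
      by (simp add: n norm_mult mult_ac flip: of_nat_Suc)
    \<comment> \<open>The second derivative yields the factor n (n - 1), which is at least n^2 / 2
      because n is at least 2.\<close>
    moreover have "real n ^ 2 * cmod (tcoeff h n) \<le> 2 * (real (Suc k) * real n) * cmod (tcoeff h n)"
      by (intro mult_right_mono) (auto simp: n power2_eq_square algebra_simps)
    ultimately have "real n ^ 2 * cmod (tcoeff h n) \<le> 2 * M" by linarith
    then show ?thesis using n by (simp add: pos_le_divide_eq mult.commute)
  qed
  have t: "real n * (cmod (tcoeff h n))^2 \<le> M^2 * (4 / real n ^ 3)" for n
  proof (cases "n = 0")
    case False
    have "real n * (cmod (tcoeff h n))^2 \<le> real n * (2 * M / real n ^ 2)^2"
      by (intro mult_left_mono power_mono c False) auto
    also have "\<dots> = M^2 * (4 / real n ^ 3)"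
      using False by (simp add: field_simps power2_eq_square power3_eq_cube)
    finally show ?thesis .
  qed simp
  have s: "summable (\<lambda>n. 4 / real n ^ 3)"
    using summable_mult[OF inverse_power_summable[of 3, where 'a = real], of 4] by (simp add: field_simps)
  have s2: "summable (\<lambda>n. real n * (cmod (tcoeff h n))^2)"
    by (rule summable_comparison_test'[OF summable_mult[OF s, of "M^2"], of 0]) (use t in simp)
  then show "h \<in> dir_space" by (simp add: dir_space_def h)
  have "dsem h \<le> (\<Sum>n. M^2 * (4 / real n ^ 3))"
    unfolding dsem_def by (rule suminf_le[OF t s2 summable_mult[OF s]])
  then show "dsem h \<le> C2_const * M^2"
    by (simp only: suminf_mult[OF s] C2_const_def mult.commute)
qed

lemma C2_const_nonneg: "0 \<le> C2_const"
proof -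
  have "summable (\<lambda>n. 4 / real n ^ 3)"
    using summable_mult[OF inverse_power_summable[of 3, where 'a = real], of 4] by (simp add: field_simps)
  then show ?thesis unfolding C2_const_def by (rule suminf_nonneg) simp
qed

lemma lfsm_denom_lower_bound:
  assumes "is_lfsm q"
  obtains \<delta> where "0 < \<delta>" "\<And>z. cmod z \<le> 1 \<Longrightarrow> \<delta> \<le> cmod (denom q z)"
proof -
  have "continuous_on (cball 0 1) (\<lambda>z. cmod (denom q z))" by (intro continuous_intros)
  then obtain x where "x \<in> cball 0 1" "\<And>z. z \<in> cball 0 1 \<Longrightarrow> cmod (denom q x) \<le> cmod (denom q z)"
    using continuous_attains_inf[of "cball 0 1" "\<lambda>z. cmod (denom q z)"] by auto
  then show ?thesis using that[of "cmod (denom q x)"] lfsm_denom_nz[OF assms, of x] by auto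
qed

text \<open>\<open>L\<close> depends on \<open>q\<close> alone, so the estimate can be iterated. The
  derivatives of \<open>h\<close> are bounded only on the image of \<open>q\<close>: if that image
  stays away from the circle, this admits functions \<open>h\<close> that are unbounded near the
  circle.\<close>

lemma C2_bound_lft:
  assumes q: "is_lfsm q"
  obtains L where "1 \<le> L"
    "\<And>M h. h holomorphic_on ball 0 1 \<Longrightarrow>
       (\<And>z. cmod z < 1 \<Longrightarrow> cmod (deriv h (lft q z)) \<le> M \<and> cmod (deriv (deriv h) (lft q z)) \<le> M) \<Longrightarrow>
       C2_bound (L * M) (\<lambda>z. h (lft q z))"
proof -
  obtain a b c d where qe: "q = (a, b, c, d)" by (cases q)
  obtain \<delta> where \<delta>: "0 < \<delta>" "\<And>z. cmod z \<le> 1 \<Longrightarrow> \<delta> \<le> cmod (denom q z)"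
    using lfsm_denom_lower_bound[OF q] by blast
  define L1 where "L1 = cmod (cdet q) / \<delta>^2"
  define L2 where "L2 = cmod (2 * c * cdet q) / \<delta>^3"
  let ?e1 = "\<lambda>z. cdet q / (denom q z)^2" and ?e2 = "\<lambda>z. - 2 * c * cdet q / (denom q z)^3"
  have e1: "cmod (?e1 z) \<le> L1" if "cmod z < 1" for z
    unfolding L1_def norm_divide norm_power using \<delta> that by (intro divide_left_mono power_mono mult_pos_pos) (auto simp: lfsm_denom_nz[OF q])
  have e2: "cmod (?e2 z) \<le> L2" if "cmod z < 1" for z
    unfolding L2_def norm_divide norm_power using \<delta> that
    by (auto simp: norm_mult lfsm_denom_nz[OF q] intro!: divide_left_mono power_mono mult_pos_pos)
  have L: "0 \<le> L1" "0 \<le> L2" using \<delta> by (auto simp: L1_def L2_def)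
  show ?thesis
  \<comment> \<open>With bounds \<open>L1\<close> for q' and \<open>L2\<close> for q'', the chain
    rule costs \<open>L1\<close> in the first derivative and \<open>L1^2 + L2\<close> in the
    second.\<close>
  proof (rule that[of "1 + L1 + L1^2 + L2"])
    show "1 \<le> 1 + L1 + L1^2 + L2" using L by simp
  next
    fix M h assume h: "h holomorphic_on ball 0 1"
      and b: "\<And>z. cmod z < 1 \<Longrightarrow> cmod (deriv h (lft q z)) \<le> M \<and> cmod (deriv (deriv h) (lft q z)) \<le> M"
    have M: "M \<ge> 0" using order_trans[OF norm_ge_zero, of "deriv h (lft q 0)" M] b[of 0] by simp
    have h': "deriv h holomorphic_on ball 0 1" by (auto intro!: holomorphic_intros h)
    have chain: "((\<lambda>z. g (lft q z)) has_field_derivative deriv g (lft q z) * ?e1 z) (at z)"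
      if "cmod z < 1" "g holomorphic_on ball 0 1" for g z
    proof -
      have g: "(g has_field_derivative deriv g (lft q z)) (at (lft q z))"
        by (rule holomorphic_derivI[OF that(2)]) (use lfsm_lft_less[OF q that(1)] in auto)
      from DERIV_chain2[OF g lft_has_deriv[OF lfsm_denom_nz[OF q]]] that(1) show ?thesis by simp
    qed
    have d1: "deriv (\<lambda>z. h (lft q z)) z = deriv h (lft q z) * ?e1 z" if "cmod z < 1" for z
      by (rule DERIV_imp_deriv[OF chain[OF that h]])
    have de: "(?e1 has_field_derivative ?e2 z) (at z)" if "cmod z < 1" for z
    proof -
      have nz: "denom q z \<noteq> 0" using lfsm_denom_nz[OF q, of z] that by simp
      have dd: "(denom q has_field_derivative c) (at z)"
      proof -
        have "denom q = (\<lambda>z. c * z + d)" by (auto simp: qe)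
        then show ?thesis by (auto intro!: derivative_eq_intros)
      qed
      have "(?e1 has_field_derivative (0 * (denom q z)^2 - cdet q * (of_nat 2 * (c * denom q z ^ (2 - Suc 0)))) /
          ((denom q z)^2 * (denom q z)^2)) (at z)"
        by (rule DERIV_divide[OF DERIV_const DERIV_power[OF dd]]) (use nz in simp)
      also have "(0 * (denom q z)^2 - cdet q * (of_nat 2 * (c * denom q z ^ (2 - Suc 0)))) /
          ((denom q z)^2 * (denom q z)^2) = ?e2 z"
        using nz by (simp add: power2_eq_square power3_eq_cube mult_ac)
      finally show ?thesis .
    qed
    have d2: "deriv (deriv (\<lambda>z. h (lft q z))) z = deriv (deriv h) (lft q z) * (?e1 z)^2 + deriv h (lft q z) * ?e2 z"
      if z: "cmod z < 1" for z
    proof -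
      have "deriv (deriv (\<lambda>z. h (lft q z))) z = deriv (\<lambda>z. deriv h (lft q z) * ?e1 z) z"
        by (rule deriv_eq_on_ball[OF d1 z])
      also have "\<dots> = deriv (deriv h) (lft q z) * (?e1 z)^2 + deriv h (lft q z) * ?e2 z"
        using DERIV_mult[OF chain[OF z h'] de[OF z]]
        by (intro DERIV_imp_deriv) (simp add: power2_eq_square algebra_simps)
      finally show ?thesis .
    qed
    show "C2_bound ((1 + L1 + L1^2 + L2) * M) (\<lambda>z. h (lft q z))"
      unfolding C2_bound_def
    proof (intro conjI allI impI)
      show "(\<lambda>z. h (lft q z)) holomorphic_on ball 0 1" by (rule comp_lft_holo[OF h q])
    next
      fix z :: complex assume z: "cmod z < 1"
      have "cmod (deriv (\<lambda>z. h (lft q z)) z) = cmod (deriv h (lft q z)) * cmod (?e1 z)"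
        unfolding d1[OF z] by (rule norm_mult)
      also have "\<dots> \<le> M * L1" using b[OF z] e1[OF z] M by (intro mult_mono) auto
      also have "\<dots> \<le> (1 + L1 + L1^2 + L2) * M" using L M by (simp add: algebra_simps)
      finally show "cmod (deriv (\<lambda>z. h (lft q z)) z) \<le> (1 + L1 + L1^2 + L2) * M" .
      have "cmod (deriv (deriv (\<lambda>z. h (lft q z))) z) \<le>
          cmod (deriv (deriv h) (lft q z)) * (cmod (?e1 z))^2 + cmod (deriv h (lft q z)) * cmod (?e2 z)"
        unfolding d2[OF z] by (rule order_trans[OF norm_triangle_ineq]) (simp only: norm_mult norm_power order_refl)
      also have "\<dots> \<le> M * L1^2 + M * L2"
        using b[OF z] e1[OF z] e2[OF z] M L by (intro add_mono mult_mono power_mono) auto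
      also have "\<dots> \<le> (1 + L1 + L1^2 + L2) * M" using L M by (simp add: algebra_simps)
      finally show "cmod (deriv (deriv (\<lambda>z. h (lft q z))) z) \<le> (1 + L1 + L1^2 + L2) * M" .
    qed
  qed
qed

lemma C2_bound_poly: "\<exists>M. C2_bound M (\<lambda>z. \<Sum>k<N. c k * z ^ k)"
proof -
  let ?p = "\<lambda>z::complex. \<Sum>k<N. c k * z ^ k"
  have p: "?p holomorphic_on UNIV" "deriv ?p holomorphic_on UNIV" "deriv (deriv ?p) holomorphic_on UNIV"
    by (auto intro!: holomorphic_intros)
  have "bounded (deriv ?p ` cball 0 1)" "bounded (deriv (deriv ?p) ` cball 0 1)"
    by (intro compact_imp_bounded compact_continuous_image compact_cball holomorphic_on_imp_continuous_on
        holomorphic_on_subset[OF p(2)] holomorphic_on_subset[OF p(3)] subset_UNIV)+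
  then obtain A B where "\<forall>z\<in>cball 0 1. cmod (deriv ?p z) \<le> A"
    "\<forall>z\<in>cball 0 1. cmod (deriv (deriv ?p) z) \<le> B"
    unfolding bounded_iff by blast
  then have "C2_bound (max A B) ?p"
    unfolding C2_bound_def using holomorphic_on_subset[OF p(1)] by (auto simp: le_max_iff_disj)
  then show ?thesis by blast
qed

text \<open>If \<open>x / L\<close> exceeded 1, its powers would outgrow every constant
  \<open>C\<close>, also along the exponents 2 ^ k.\<close>

lemma power_tower_bound:
  fixes x L C :: real
  assumes x: "0 \<le> x" and L: "0 < L" and b: "\<And>k. x ^ (2 ^ k) \<le> C * L ^ (2 ^ k)"
  shows "x \<le> L"
proof (rule ccontr)
  assume "\<not> x \<le> L"
  then have y: "1 < x / L" using L by simp
  obtain n where n: "C < (x / L) ^ n" using real_arch_pow[OF y] by blast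
  have "(x / L) ^ n \<le> (x / L) ^ (2 ^ n)"
    using y less_exp[of n] by (intro power_increasing) auto
  also have "\<dots> \<le> C" using b[of n] L by (simp add: power_divide divide_le_eq)
  finally show False using n by simp
qed

primrec iter_sq :: "coeffs \<Rightarrow> nat \<Rightarrow> coeffs" where
  "iter_sq X 0 = X"
| "iter_sq X (Suc k) = mcomp (iter_sq X k) (iter_sq X k)"

text \<open>For \<open>X = \<psi> \<circ> \<sigma>\<close> composition with \<open>X\<close> is symmetric, so the seminorms \<open>a k\<close> of \<open>f \<circ> X ^ (2 ^ k)\<close>
  satisfy \<open>a k ^ 2 \<le> a (k + 1) * a\<close>, where \<open>a\<close> is the seminorm of \<open>f\<close>. As they grow at most
  like \<open>M * L ^ (2 ^ k)\<close>, the ratio \<open>a 0 / a\<close> cannot exceed \<open>L\<close>.\<close>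

lemma poly_comp_bounded:
  assumes q: "is_lfsm q"
  obtains L where "0 < L" "\<And>N c. (\<lambda>z. \<Sum>k<N. c k * lft q z ^ k) \<in> dir_space"
    "\<And>N c. dsem (\<lambda>z. \<Sum>k<N. c k * lft q z ^ k) \<le> L * dsem (\<lambda>z. \<Sum>k<N. c k * z ^ k)"
proof -
  \<comment> \<open>For the seminorm, composition with \<open>X\<close> is the adjoint of
    composition with \<open>q\<close> applied after composition with \<open>q\<close>; hence
    \<open>kadj X = X\<close>.\<close>
  define X where "X = mcomp q (kadj q)"
  let ?Y = "iter_sq X"
  have X: "is_lfsm X" unfolding X_def by (intro lfsm_mcomp q lfsm_kadj)
  have kX: "kadj X = X" by (simp add: X_def kadj_mcomp)
  have Y: "is_lfsm (?Y k)" "kadj (?Y k) = ?Y k" for k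
    by (induction k) (auto simp: X kX lfsm_mcomp kadj_mcomp)
  have Yc: "lft (?Y (Suc k)) z = lft (?Y k) (lft (?Y k) z)" if "cmod z < 1" for z k
    using lft_mcomp[OF Y(1), of z] that by simp
  obtain L where L: "1 \<le> L" "\<And>M h. h holomorphic_on ball 0 1 \<Longrightarrow>
       (\<And>z. cmod z < 1 \<Longrightarrow> cmod (deriv h (lft X z)) \<le> M \<and> cmod (deriv (deriv h) (lft X z)) \<le> M) \<Longrightarrow>
       C2_bound (L * M) (\<lambda>z. h (lft X z))"
    using C2_bound_lft[OF X] by blast
  have grow: "C2_bound (L ^ (2 ^ k) * M) (\<lambda>z. h (lft (?Y k) z))" if "C2_bound M h" for k M h
    using that
  proof (induction k arbitrary: M h)
    case 0
    then show ?case using L(2)[of h M] lfsm_lft_less[OF X] by (auto simp: C2_bound_def)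
  next
    case (Suc k)
    from Suc.IH[OF Suc.IH[OF Suc.prems]]
    have "C2_bound (L ^ (2 ^ k) * (L ^ (2 ^ k) * M)) (\<lambda>z. h (lft (?Y k) (lft (?Y k) z)))" .
    then show ?case
      by (subst C2_bound_cong) (auto simp: power_add mult_2 mult.assoc Yc simp del: iter_sq.simps)
  qed
  have cq: "(\<lambda>z. \<Sum>k<N. c k * lft q z ^ k) \<in> dir_space" for N c
  proof -
    obtain L' where L': "1 \<le> L'" "\<And>M h. h holomorphic_on ball 0 1 \<Longrightarrow>
       (\<And>z. cmod z < 1 \<Longrightarrow> cmod (deriv h (lft q z)) \<le> M \<and> cmod (deriv (deriv h) (lft q z)) \<le> M) \<Longrightarrow>
       C2_bound (L' * M) (\<lambda>z. h (lft q z))"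
      using C2_bound_lft[OF q] by blast
    obtain M where "C2_bound M (\<lambda>z. \<Sum>k<N. c k * z ^ k)" using C2_bound_poly by blast
    with L'(2)[of "\<lambda>z. \<Sum>k<N. c k * z ^ k" M] lfsm_lft_less[OF q] show ?thesis
      using C2_bound_dsem(1) by (auto simp: C2_bound_def)
  qed
  show ?thesis
  proof (rule that[of L])
    fix N :: nat and c :: "nat \<Rightarrow> complex"
    let ?p = "\<lambda>z::complex. \<Sum>k<N. c k * z ^ k"
    obtain M where M: "C2_bound M ?p" using C2_bound_poly by blast
    define s where "s = sqrt (dsem ?p)"
    define a where "a k = sqrt (dsem (\<lambda>z. ?p (lft (?Y k) z)))" for k
    have pD: "?p \<in> dir_space" by (rule dir_space_poly)
    have s0: "0 \<le> s" using dsem_nonneg[OF pD] by (simp add: s_def)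
    have YD: "(\<lambda>z. ?p (lft (?Y k) z)) \<in> dir_space" for k
      by (rule C2_bound_dsem(1)[OF grow[OF M]])
    have a0: "0 \<le> a k" for k using dsem_nonneg[OF YD] by (simp add: a_def)
    have step: "(a k)^2 \<le> a (Suc k) * s" for k
    proof -
      have "complex_of_real ((a k)^2) = dform (\<lambda>z. ?p (lft (?Y k) z)) (\<lambda>z. ?p (lft (?Y k) z))"
        unfolding a_def using dsem_nonneg[OF YD] by (simp add: dform_self[OF YD])
      also have "\<dots> = dform (\<lambda>z. ?p (lft (?Y k) (lft (?Y k) z))) ?p"
        using dform_poly_adjoint[OF Y(1) dir_space_holo[OF YD[of k]], where c=c and N=N] Y(2) by simp
      also have "\<dots> = dform (\<lambda>z. ?p (lft (?Y (Suc k)) z)) ?p"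
      proof -
        have "tcoeff (\<lambda>z. ?p (lft (?Y k) (lft (?Y k) z))) n = tcoeff (\<lambda>z. ?p (lft (?Y (Suc k)) z)) n" for n
          by (rule tcoeff_cong) (simp add: Yc del: iter_sq.simps)
        then show ?thesis unfolding dform_def by simp
      qed
      finally have "(a k)^2 \<le> cmod (dform (\<lambda>z. ?p (lft (?Y (Suc k)) z)) ?p)"
        by (metis norm_of_real abs_ge_self)
      also have "\<dots> \<le> a (Suc k) * s"
        unfolding a_def s_def by (rule dform_bound(2)[OF YD pD])
      finally show ?thesis .
    qed
    have main: "a 0 \<le> L * s"
    \<comment> \<open>A seminorm 0 cannot serve as a divisor; in this case Cauchy-Schwarz already
      gives \<open>a 0 = 0\<close>.\<close>
    proof (cases "s = 0")
      case True
      then show ?thesis using step[of 0] by simp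
    next
      case False
      then have s: "0 < s" using s0 by simp
      have tower: "(a 0 / s) ^ (2 ^ k) \<le> a k / s" for k
      proof (induction k)
        case (Suc k)
        have "(a 0 / s) ^ (2 ^ Suc k) = ((a 0 / s) ^ (2 ^ k))^2"
          by (simp add: mult.commute flip: power_mult)
        also have "\<dots> \<le> (a k / s)^2" using a0 s by (intro power_mono Suc.IH) auto
        also have "\<dots> \<le> a (Suc k) / s" using step[of k] s by (simp add: field_simps power2_eq_square)
        finally show ?case .
      qed simp
      have M0: "0 \<le> M" using M order_trans[OF norm_ge_zero, of "deriv ?p 0" M] by (simp add: C2_bound_def)
      have ab: "a k \<le> sqrt C2_const * M * L ^ (2 ^ k)" for k
      proof -
        have "a k \<le> sqrt (C2_const * (L ^ (2 ^ k) * M)^2)"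
          unfolding a_def by (intro real_sqrt_le_mono C2_bound_dsem(2) grow M)
        also have "\<dots> = sqrt C2_const * (L ^ (2 ^ k) * M)"
          using M0 L(1) by (simp add: real_sqrt_mult)
        finally show ?thesis by (simp add: mult_ac)
      qed
      have "a 0 / s \<le> L"
      proof (rule power_tower_bound[of _ _ "sqrt C2_const * M / s"])
        fix k
        have "a k / s \<le> sqrt C2_const * M * L ^ (2 ^ k) / s" using ab[of k] s by (intro divide_right_mono) auto
        with tower[of k] show "(a 0 / s) ^ (2 ^ k) \<le> sqrt C2_const * M / s * L ^ (2 ^ k)" by simp
      qed (use a0 s L in auto)
      then show ?thesis using s by (simp add: field_simps)
    qed
    \<comment> \<open>The squared seminorm of \<open>?p\<close> composed with \<open>q\<close> is
      the pairing of \<open>?p\<close> composed with \<open>X\<close> against \<open>?p\<close>, so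
      the bound for \<open>X\<close> carries over.\<close>
    have "complex_of_real (dsem (\<lambda>z. ?p (lft q z))) = dform (\<lambda>z. ?p (lft q z)) (\<lambda>z. ?p (lft q z))"
      by (rule dform_self[OF cq, symmetric])
    also have "\<dots> = dform (\<lambda>z. ?p (lft q (lft (kadj q) z))) ?p"
      using dform_poly_adjoint[OF lfsm_kadj[OF q] dir_space_holo[OF cq[of c N]], where c=c and N=N] by simp
    also have "\<dots> = dform (\<lambda>z. ?p (lft (?Y 0) z)) ?p"
    proof -
      have "tcoeff (\<lambda>z. ?p (lft q (lft (kadj q) z))) n = tcoeff (\<lambda>z. ?p (lft (?Y 0) z)) n" for n
        by (rule tcoeff_cong) (simp add: X_def lft_mcomp[OF lfsm_kadj[OF q]])
      then show ?thesis unfolding dform_def by simp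
    qed
    finally have "dsem (\<lambda>z. ?p (lft q z)) \<le> cmod (dform (\<lambda>z. ?p (lft (?Y 0) z)) ?p)"
      by (metis norm_of_real abs_ge_self)
    also have "\<dots> \<le> a 0 * s" unfolding a_def s_def by (rule dform_bound(2)[OF YD pD])
    also have "\<dots> \<le> L * s * s" using main s0 by (intro mult_right_mono) auto
    also have "\<dots> = L * dsem ?p" unfolding s_def using dsem_nonneg[OF pD] by simp
    finally show "dsem (\<lambda>z. \<Sum>k<N. c k * lft q z ^ k) \<le> L * dsem ?p" .
  qed (use L(1) cq in auto)
qed

text \<open>A Fatou argument: for each fixed order the coefficients of the composed Taylor
  polynomials converge, so every finite partial sum of the seminorm inherits the uniform bound known
  for polynomials.\<close>

lemma comp_lft_bounded:
  assumes q: "is_lfsm q"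
  obtains L where "0 < L" "\<And>f. f \<in> dir_space \<Longrightarrow> (\<lambda>z. f (lft q z)) \<in> dir_space"
    "\<And>f. f \<in> dir_space \<Longrightarrow> dsem (\<lambda>z. f (lft q z)) \<le> L * dsem f"
proof -
  obtain L where L: "0 < L" "\<And>N c. (\<lambda>z. \<Sum>k<N. c k * lft q z ^ k) \<in> dir_space"
    "\<And>N c. dsem (\<lambda>z. \<Sum>k<N. c k * lft q z ^ k) \<le> L * dsem (\<lambda>z. \<Sum>k<N. c k * z ^ k)"
    using poly_comp_bounded[OF q] by blast
  have fin: "(\<Sum>n<K. real n * (cmod (tcoeff (\<lambda>z. f (lft q z)) n))^2) \<le> L * dsem f"
    if f: "f \<in> dir_space" for f K
  proof -
    let ?P = "\<lambda>N z. \<Sum>k<N. tcoeff f k * lft q z ^ k"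
    have lim: "(\<lambda>N. tcoeff (?P N) n) \<longlonglongrightarrow> tcoeff (\<lambda>z. f (lft q z)) n" for n
    proof -
      have "tcoeff (?P N) n = (\<Sum>k<N. tcoeff f k * tcoeff (\<lambda>z. lft q z ^ k) n)" for N
        by (simp add: tcoeff_finite_sum tcoeff_cmult holomorphic_intros lft_holo[OF q])
      moreover have "(\<lambda>k. tcoeff f k * tcoeff (\<lambda>z. lft q z ^ k) n) sums tcoeff (\<lambda>z. f (lft q z)) n"
        by (rule tcoeff_compose_sums[OF dir_space_holo[OF f] lft_holo[OF q]]) (rule lfsm_lft_less[OF q])
      ultimately show ?thesis by (simp add: sums_def)
    qed
    have le: "(\<Sum>n<K. real n * (cmod (tcoeff (?P N) n))^2) \<le> L * dsem f" for N
    proof -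
      have "(\<Sum>n<K. real n * (cmod (tcoeff (?P N) n))^2) \<le> dsem (?P N)"
        unfolding dsem_def by (intro sum_le_suminf dir_space_summable L(2)) auto
      also have "\<dots> \<le> L * dsem (\<lambda>z. \<Sum>k<N. tcoeff f k * z ^ k)" by (rule L(3))
      also have "dsem (\<lambda>z. \<Sum>k<N. tcoeff f k * z ^ k) \<le> dsem f"
        unfolding dsem_poly unfolding dsem_def by (intro sum_le_suminf dir_space_summable f) auto
      finally show ?thesis using L(1) by simp
    qed
    have "(\<lambda>N. \<Sum>n<K. real n * (cmod (tcoeff (?P N) n))^2) \<longlonglongrightarrow>
        (\<Sum>n<K. real n * (cmod (tcoeff (\<lambda>z. f (lft q z)) n))^2)"
      by (intro tendsto_intros lim)
    then show ?thesis by (rule LIMSEQ_le_const2) (use le in blast)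
  qed
  have s: "summable (\<lambda>n. real n * (cmod (tcoeff (\<lambda>z. f (lft q z)) n))^2)" if "f \<in> dir_space" for f
    by (rule summableI_nonneg_bounded[OF _ fin[OF that]]) auto
  show ?thesis
  proof (rule that[OF L(1)])
    fix f assume f: "f \<in> dir_space"
    show "(\<lambda>z. f (lft q z)) \<in> dir_space"
      using s[OF f] comp_lft_holo[OF dir_space_holo[OF f] q] by (simp add: dir_space_def)
    show "dsem (\<lambda>z. f (lft q z)) \<le> L * dsem f"
      unfolding dsem_def[of "\<lambda>z. f (lft q z)"] by (rule suminf_le_const[OF s[OF f] fin[OF f]])
  qed
qed

lemma dir_space_comp: "f \<in> dir_space \<Longrightarrow> is_lfsm q \<Longrightarrow> (\<lambda>z. f (lft q z)) \<in> dir_space"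
  using comp_lft_bounded[of q] by metis

text \<open>The Taylor polynomials of \<open>g\<close> converge to \<open>g\<close> in the seminorm,
  and both sides are continuous in \<open>g\<close> because composition is bounded; this extends the
  relation from polynomials.\<close>

lemma dform_adjoint:
  assumes q: "is_lfsm q" and f: "f \<in> dir_space" and g: "g \<in> dir_space"
  shows "dform (\<lambda>z. f (lft q z)) g = dform f (\<lambda>z. g (lft (kadj q) z))"
proof -
  note kq = lfsm_kadj[OF q]
  obtain L where L: "0 < L" "\<And>f. f \<in> dir_space \<Longrightarrow> dsem (\<lambda>z. f (lft (kadj q) z)) \<le> L * dsem f"
    using comp_lft_bounded[OF kq] by metis
  define P where "P N z = (\<Sum>k<N. tcoeff g k * z ^ k)" for N and z :: complex
  have P: "P N \<in> dir_space" for N unfolding P_def by (rule dir_space_poly)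
  define R where "R N z = g z - P N z" for N and z :: complex
  have R: "R N \<in> dir_space" for N unfolding R_def by (intro dir_space_diff g P)
  have dR: "(\<lambda>N. dsem (R N)) \<longlonglongrightarrow> 0"
  proof -
    let ?t = "\<lambda>n. real n * (cmod (tcoeff g n))^2"
    have eq: "dsem (R N) = dsem g - (\<Sum>n<N. ?t n)" for N
    proof -
      have "tcoeff (R N) n = tcoeff g n - tcoeff (P N) n" for n
        unfolding R_def by (rule tcoeff_diff[OF dir_space_holo[OF g] dir_space_holo[OF P]])
      moreover have "tcoeff (P N) n = (if n < N then tcoeff g n else 0)" for n
        unfolding P_def tcoeff_poly by simp
      ultimately have e: "real n * (cmod (tcoeff (R N) n))^2 = ?t n - (if n \<in> {..<N} then ?t n else 0)" for n
        by simp
      have "(\<lambda>n. ?t n - (if n \<in> {..<N} then ?t n else 0)) sums (dsem g - (\<Sum>n<N. ?t n))"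
        unfolding dsem_def by (intro sums_diff summable_sums dir_space_summable g sums_If_finite_set) simp
      then show ?thesis unfolding dsem_def[of "R N"] e by (simp add: sums_iff)
    qed
    have "(\<lambda>N. \<Sum>n<N. ?t n) \<longlonglongrightarrow> dsem g"
      unfolding dsem_def using summable_LIMSEQ[OF dir_space_summable[OF g]] by simp
    from tendsto_diff[OF tendsto_const[of "dsem g"] this] show ?thesis unfolding eq by simp
  qed
  define C where "C = sqrt (dsem (\<lambda>z. f (lft q z))) + sqrt (dsem f) * sqrt L"
  have bound: "cmod (dform (\<lambda>z. f (lft q z)) g - dform f (\<lambda>z. g (lft (kadj q) z))) \<le> C * sqrt (dsem (R N))" for N
  proof -
    have D: "(\<lambda>z. f (lft q z)) \<in> dir_space" "(\<lambda>z. g (lft (kadj q) z)) \<in> dir_space"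
      "(\<lambda>z. P N (lft (kadj q) z)) \<in> dir_space" "(\<lambda>z. R N (lft (kadj q) z)) \<in> dir_space"
      by (intro dir_space_comp f g P R q kq)+
    have 1: "dform (\<lambda>z. f (lft q z)) (P N) = dform f (\<lambda>z. P N (lft (kadj q) z))"
      unfolding P_def by (rule dform_poly_adjoint[OF q dir_space_holo[OF f]])
    have 2: "dform (\<lambda>z. f (lft q z)) (R N) = dform (\<lambda>z. f (lft q z)) g - dform (\<lambda>z. f (lft q z)) (P N)"
      unfolding R_def by (intro dform_diff_right g P D)
    have 3: "dform f (\<lambda>z. R N (lft (kadj q) z)) = dform f (\<lambda>z. g (lft (kadj q) z)) - dform f (\<lambda>z. P N (lft (kadj q) z))"
      unfolding R_def by (intro dform_diff_right f D)
    have "dform (\<lambda>z. f (lft q z)) g - dform f (\<lambda>z. g (lft (kadj q) z)) =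
        dform (\<lambda>z. f (lft q z)) (R N) - dform f (\<lambda>z. R N (lft (kadj q) z))"
      using 1 2 3 by simp
    then have "cmod (dform (\<lambda>z. f (lft q z)) g - dform f (\<lambda>z. g (lft (kadj q) z)))
        \<le> cmod (dform (\<lambda>z. f (lft q z)) (R N)) + cmod (dform f (\<lambda>z. R N (lft (kadj q) z)))"
      by (simp add: norm_triangle_ineq4)
    also have "cmod (dform (\<lambda>z. f (lft q z)) (R N)) \<le> sqrt (dsem (\<lambda>z. f (lft q z))) * sqrt (dsem (R N))"
      by (rule dform_bound(2)[OF D(1) R])
    also have "cmod (dform f (\<lambda>z. R N (lft (kadj q) z))) \<le> sqrt (dsem f) * sqrt (dsem (\<lambda>z. R N (lft (kadj q) z)))"
      by (rule dform_bound(2)[OF f D(4)])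
    finally have *: "cmod (dform (\<lambda>z. f (lft q z)) g - dform f (\<lambda>z. g (lft (kadj q) z)))
        \<le> sqrt (dsem (\<lambda>z. f (lft q z))) * sqrt (dsem (R N))
          + sqrt (dsem f) * sqrt (dsem (\<lambda>z. R N (lft (kadj q) z)))" by simp
    have "sqrt (dsem f) * sqrt (dsem (\<lambda>z. R N (lft (kadj q) z))) \<le> sqrt (dsem f) * sqrt (L * dsem (R N))"
      by (intro mult_left_mono real_sqrt_le_mono L(2) R real_sqrt_ge_zero dsem_nonneg f)
    with * show ?thesis by (simp add: C_def real_sqrt_mult algebra_simps)
  qed
  have "(\<lambda>N. C * sqrt (dsem (R N))) \<longlonglongrightarrow> C * sqrt 0"
    by (intro tendsto_intros dR)
  then have "(\<lambda>N. C * sqrt (dsem (R N))) \<longlonglongrightarrow> 0" by simp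
  then have "cmod (dform (\<lambda>z. f (lft q z)) g - dform f (\<lambda>z. g (lft (kadj q) z))) \<le> 0"
    by (rule LIMSEQ_le_const) (use bound in auto)
  then show ?thesis by simp
qed

section \<open>The adjoint, and finite-rank perturbations\<close>

text \<open>The reproducing kernel of the Dirichlet space: \<open>dinner f (dkernel w)\<close> is
  \<open>f w\<close>. For points of the disk \<open>1 - cnj w * z\<close> has positive real part, so
  the principal logarithm applies.\<close>

definition dkernel :: "complex \<Rightarrow> complex \<Rightarrow> complex" where
  "dkernel w z = 1 - ln (1 - cnj w * z)"

lemma dkernel_sums:
  assumes "cmod w < 1" "cmod z < 1"
  shows "(\<lambda>n. (if n = 0 then 1 else cnj w ^ n / of_nat n) * z ^ n) sums dkernel w z"
proof -
  have "cmod (- (cnj w * z)) < 1" using norm_mult_less_1[of z "cnj w"] assms by (simp add: mult.commute)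
  from Ln_series'[OF this] have "(\<lambda>n. - ((cnj w * z) ^ n) / of_nat n) sums ln (1 - cnj w * z)" by simp
  from sums_diff[OF sums_single[of 0 "\<lambda>_. 1"] this]
  have "(\<lambda>n. (if n = 0 then 1 else 0) + (cnj w * z) ^ n / of_nat n) sums dkernel w z"
    by (simp add: dkernel_def)
  moreover have "(\<lambda>n. (if n = 0 then 1 else 0) + (cnj w * z) ^ n / of_nat n) =
      (\<lambda>n. (if n = 0 then 1 else cnj w ^ n / of_nat n) * z ^ n)"
    by (auto simp: power_mult_distrib)
  ultimately show ?thesis by simp
qed

lemma tcoeff_dkernel: "cmod w < 1 \<Longrightarrow> tcoeff (dkernel w) n = (if n = 0 then 1 else cnj w ^ n / of_nat n)"
  by (rule tcoeff_of_power_series[OF dkernel_sums])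

lemma dkernel_0 [simp]: "dkernel w 0 = 1"
  by (simp add: dkernel_def)

lemma dir_space_dkernel:
  assumes w: "cmod w < 1"
  shows "dkernel w \<in> dir_space"
proof -
  have s: "summable (\<lambda>n. ((cmod w)^2) ^ n)" using w by (intro summable_geometric) (simp add: abs_square_less_1)
  have "summable (\<lambda>n. of_nat n * (cmod (tcoeff (dkernel w) n))^2)"
  proof (rule summable_comparison_test'[OF s, of 1])
    fix n :: nat assume n: "1 \<le> n"
    have "norm (real n * (cmod (tcoeff (dkernel w) n))^2) = (cmod w ^ n)^2 / real n"
      using n by (simp add: tcoeff_dkernel[OF w] norm_divide norm_power power_divide power2_eq_square)
    also have "\<dots> \<le> (cmod w ^ n)^2" using n by (simp add: divide_le_eq mult_le_cancel_left1)
    also have "\<dots> = ((cmod w)^2) ^ n" by (metis power_mult mult.commute)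
    finally show "norm (real n * (cmod (tcoeff (dkernel w) n))^2) \<le> ((cmod w)^2) ^ n" .
  qed
  then show ?thesis
    using holomorphic_of_power_series[OF dkernel_sums[OF w]] by (simp add: dir_space_def)
qed

lemma dform_dkernel:
  assumes f: "f holomorphic_on ball 0 1" and w: "cmod w < 1"
  shows "dform f (dkernel w) = f w - f 0"
proof -
  have "(\<lambda>n. tcoeff f n * w ^ n - (if n = 0 then tcoeff f n else 0)) sums (f w - tcoeff f 0)"
    by (intro sums_diff tcoeff_sums f w) (rule sums_single)
  moreover have "(\<lambda>n. tcoeff f n * w ^ n - (if n = 0 then tcoeff f n else 0)) =
      (\<lambda>n. of_nat n * tcoeff f n * cnj (tcoeff (dkernel w) n))"
    by (auto simp: tcoeff_dkernel[OF w])
  ultimately show ?thesis unfolding dform_def by (simp add: sums_iff)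
qed

text \<open>Read off from \<open>dinner f (g \<circ> lft q) = f 0 * cnj (g (lft q 0)) + dform f (g
  \<circ> lft q)\<close>. The kernel at \<open>lft q 0\<close> represents the first term;
  composition with \<open>kadj q\<close> represents the second, once its value at 0 is removed so
  that it adds nothing to the constant terms.\<close>

definition lft_adjoint :: "coeffs \<Rightarrow> op" where
  "lft_adjoint q f z = f (lft (kadj q) z) - f (lft (kadj q) 0) + f 0 * dkernel (lft q 0) z"

lemma lft_adjoint_dir_space:
  assumes "is_lfsm q" "f \<in> dir_space"
  shows "lft_adjoint q f \<in> dir_space"
proof -
  have w: "cmod (lft q 0) < 1" by (rule lfsm_lft_less[OF assms(1)]) simp
  show ?thesis
    unfolding lft_adjoint_def
    by (rule dir_space_add[OF dir_space_diff[OF dir_space_comp[OF assms(2) lfsm_kadj[OF assms(1)]] dir_space_const]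
        dir_space_cmult[OF dir_space_dkernel[OF w]]])
qed

lemma dinner_lft_adjoint:
  assumes q: "is_lfsm q" and f: "f \<in> dir_space" and g: "g \<in> dir_space"
  shows "dinner (lft_adjoint q f) g = dinner f (comp_op (lft q) g)"
proof -
  have w: "cmod (lft q 0) < 1" by (rule lfsm_lft_less[OF q]) simp
  note D = dir_space_comp[OF f lfsm_kadj[OF q]] dir_space_const dir_space_dkernel[OF w]
  have "dform (lft_adjoint q f) g = dform (\<lambda>z. f (lft (kadj q) z)) g + f 0 * dform (dkernel (lft q 0)) g"
    unfolding lft_adjoint_def dform_add_left[OF dir_space_diff[OF D(1,2)] dir_space_cmult[OF D(3)] g]
      dform_diff_left[OF D(1,2) g] dform_cmult_left[OF D(3) g] dform_const_left by simp
  also have "dform (\<lambda>z. f (lft (kadj q) z)) g = dform f (\<lambda>z. g (lft q z))"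
    using dform_adjoint[OF lfsm_kadj[OF q] f g] by simp
  also have "dform (dkernel (lft q 0)) g = cnj (g (lft q 0) - g 0)"
    using dform_cnj[OF g D(3)] dform_dkernel[OF dir_space_holo[OF g] w] by simp
  finally have "dform (lft_adjoint q f) g = dform f (\<lambda>z. g (lft q z)) + f 0 * cnj (g (lft q 0) - g 0)" .
  then show ?thesis
    unfolding dinner_eq comp_op_def o_def by (simp add: lft_adjoint_def algebra_simps)
qed

lemma dinner_power: "dinner f (\<lambda>z. z ^ n) = (if n = 0 then 1 else of_nat n) * tcoeff f n"
proof -
  have "(\<lambda>k. of_nat k * tcoeff f k * cnj (if k = n then 1 else 0)) = (\<lambda>k. if k = n then of_nat k * tcoeff f k else 0)"
    by auto
  then have "dform f (\<lambda>z. z ^ n) = of_nat n * tcoeff f n"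
    unfolding dform_def tcoeff_power using sums_single[of n "\<lambda>k. of_nat k * tcoeff f k"] by (simp add: sums_iff)
  then show ?thesis unfolding dinner_eq by (auto simp: power_0_left)
qed

text \<open>Pairing with monomials recovers all Taylor coefficients, so any two adjoints agree
  inside the disk. Outside it the chosen operator is undetermined, hence
  \<open>cmod z < 1\<close>.\<close>

lemma dir_adjoint_comp:
  assumes q: "is_lfsm q" and f: "f \<in> dir_space"
  defines "S \<equiv> dir_adjoint (comp_op (lft q))"
  shows "S f \<in> dir_space" and "cmod z < 1 \<Longrightarrow> S f z = lft_adjoint q f z"
proof -
  have "is_dir_adjoint (comp_op (lft q)) (lft_adjoint q)"
    unfolding is_dir_adjoint_def using lft_adjoint_dir_space[OF q] dinner_lft_adjoint[OF q] by blast
  then have S: "is_dir_adjoint (comp_op (lft q)) S"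
    unfolding S_def dir_adjoint_def by (rule someI[where P = "is_dir_adjoint (comp_op (lft q))"])
  then show SD: "S f \<in> dir_space" using f by (simp add: is_dir_adjoint_def)
  have "dinner (S f) (\<lambda>z. z ^ n) = dinner (lft_adjoint q f) (\<lambda>z. z ^ n)" for n
    using S dinner_lft_adjoint[OF q f dir_space_power[of n]] f dir_space_power[of n]
    by (simp add: is_dir_adjoint_def)
  note eq = this
  have "tcoeff (S f) n = tcoeff (lft_adjoint q f) n" for n
    using eq[of n] unfolding dinner_power by (auto split: if_splits)
  then show "cmod z < 1 \<Longrightarrow> S f z = lft_adjoint q f z"
    by (rule tcoeff_eqD[OF dir_space_holo[OF SD] dir_space_holo[OF lft_adjoint_dir_space[OF q f]]])
qed

section \<open>Convergence in norm and finite-rank operators\<close>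

lemma dnorm_add_le:
  assumes f: "f \<in> dir_space" and g: "g \<in> dir_space"
  shows "dnorm (\<lambda>z. f z + g z) \<le> 2 * (dnorm f + dnorm g)"
proof (rule power2_le_imp_le)
  have "(cmod (f 0 + g 0))^2 \<le> (cmod (f 0) + cmod (g 0))^2"
    by (intro power_mono norm_triangle_ineq) auto
  also have "\<dots> \<le> 2 * (cmod (f 0))^2 + 2 * (cmod (g 0))^2"
    using sum_squares_bound[of "cmod (f 0)" "cmod (g 0)"] by (simp add: power2_sum)
  finally have "(dnorm (\<lambda>z. f z + g z))^2 \<le> 2 * (dnorm f)^2 + 2 * (dnorm g)^2"
    unfolding dnorm_sq[OF f] dnorm_sq[OF g] dnorm_sq[OF dir_space_add[OF f g]]
    using dsem_add_le[OF f g] by simp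
  also have "\<dots> \<le> (2 * (dnorm f + dnorm g))^2"
    using dnorm_nonneg[OF f] dnorm_nonneg[OF g] by (simp add: power2_eq_square algebra_simps)
  finally show "(dnorm (\<lambda>z. f z + g z))^2 \<le> (2 * (dnorm f + dnorm g))^2" .
qed (use dnorm_nonneg[OF f] dnorm_nonneg[OF g] in simp)

lemma dnorm_cmult:
  assumes f: "f \<in> dir_space"
  shows "dnorm (\<lambda>z. c * f z) = cmod c * dnorm f"
proof -
  have "dnorm (\<lambda>z. c * f z) = sqrt ((cmod c)^2 * ((cmod (f 0))^2 + dsem f))"
    using dsem_cmult[OF f, of c]
    by (simp add: dnorm_def dsem_def norm_mult power_mult_distrib algebra_simps)
  then show ?thesis by (simp add: real_sqrt_mult dnorm_def dsem_def)
qed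

lemma dnorm_zero: "dnorm (\<lambda>z. 0) = 0"
  using dnorm_cmult[OF dir_space_const, of 0 0] by simp

lemma dnorm_add_tendsto_0:
  assumes "\<And>n. f n \<in> dir_space" "\<And>n. g n \<in> dir_space"
    and "(\<lambda>n. dnorm (f n)) \<longlonglongrightarrow> 0" "(\<lambda>n. dnorm (g n)) \<longlonglongrightarrow> 0"
  shows "(\<lambda>n. dnorm (\<lambda>z. f n z + g n z)) \<longlonglongrightarrow> 0"
proof (rule tendsto_sandwich[of "\<lambda>_. 0" _ _ "\<lambda>n. 2 * (dnorm (f n) + dnorm (g n))"])
  have "(\<lambda>n. 2 * (dnorm (f n) + dnorm (g n))) \<longlonglongrightarrow> 2 * (0 + 0)" by (intro tendsto_intros assms)
  then show "(\<lambda>n. 2 * (dnorm (f n) + dnorm (g n))) \<longlonglongrightarrow> 0" by simp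
  show "eventually (\<lambda>n. dnorm (\<lambda>z. f n z + g n z) \<le> 2 * (dnorm (f n) + dnorm (g n))) sequentially"
    using dnorm_add_le[OF assms(1,2)] by (rule always_eventually[OF allI])
  show "eventually (\<lambda>n. 0 \<le> dnorm (\<lambda>z. f n z + g n z)) sequentially"
    using dnorm_nonneg[OF dir_space_add[OF assms(1,2)]] by (rule always_eventually[OF allI])
qed simp

lemma dnorm_tendsto_0_imp_value:
  assumes "\<And>n. f n \<in> dir_space" "(\<lambda>n. dnorm (f n)) \<longlonglongrightarrow> 0" "cmod z < 1"
  shows "(\<lambda>n. f n z) \<longlonglongrightarrow> 0"
proof (rule Lim_null_comparison)
  show "eventually (\<lambda>n. norm (f n z) \<le> (1 + 1 / (1 - (cmod z)^2)) * dnorm (f n)) sequentially"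
    using value_bound[OF assms(1,3)] by (intro always_eventually) auto
  have "(\<lambda>n. (1 + 1 / (1 - (cmod z)^2)) * dnorm (f n)) \<longlonglongrightarrow> (1 + 1 / (1 - (cmod z)^2)) * 0"
    by (intro tendsto_intros assms)
  then show "(\<lambda>n. (1 + 1 / (1 - (cmod z)^2)) * dnorm (f n)) \<longlonglongrightarrow> 0" by simp
qed

text \<open>Each pair is an operator of rank at most one, built from evaluation at a point. The
  explicit form lets the operator act on locally uniform limits that need not belong to the
  space.\<close>

definition finite_rank :: "(complex \<times> (complex \<Rightarrow> complex)) list \<Rightarrow> op" where
  "finite_rank xs f z = (\<Sum>(u, G)\<leftarrow>xs. f u * G z)"

definition finite_rank_ok :: "(complex \<times> (complex \<Rightarrow> complex)) list \<Rightarrow> bool" where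
  "finite_rank_ok xs \<longleftrightarrow> (\<forall>(u, G)\<in>set xs. cmod u < 1 \<and> G \<in> dir_space)"

lemma finite_rank_Nil: "finite_rank [] f = (\<lambda>z. 0)"
  by (auto simp: finite_rank_def)

lemma finite_rank_Cons: "finite_rank ((u, G) # xs) f = (\<lambda>z. f u * G z + finite_rank xs f z)"
  by (auto simp: finite_rank_def)

lemma finite_rank_dir_space: "finite_rank_ok xs \<Longrightarrow> finite_rank xs f \<in> dir_space"
proof (induction xs)
  case Nil
  then show ?case using dir_space_const[of 0] by (simp add: finite_rank_Nil)
next
  case (Cons x xs)
  then show ?case
    by (cases x) (auto simp: finite_rank_Cons finite_rank_ok_def intro!: dir_space_add dir_space_cmult)
qed

lemma finite_rank_diff: "finite_rank xs (\<lambda>z. f z - g z) z = finite_rank xs f z - finite_rank xs g z"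
  by (induction xs) (auto simp: finite_rank_Nil finite_rank_Cons algebra_simps)

lemma finite_rank_tendsto_0:
  assumes "finite_rank_ok xs" "\<And>u. cmod u < 1 \<Longrightarrow> (\<lambda>n. f n u) \<longlonglongrightarrow> 0"
  shows "(\<lambda>n. dnorm (finite_rank xs (f n))) \<longlonglongrightarrow> 0"
  using assms(1)
proof (induction xs)
  case Nil
  then show ?case by (simp add: finite_rank_Nil dnorm_zero)
next
  case (Cons x xs)
  obtain u G where x: "x = (u, G)" by (cases x)
  have u: "cmod u < 1" and G: "G \<in> dir_space" and ok: "finite_rank_ok xs"
    using Cons.prems x by (auto simp: finite_rank_ok_def)
  have "(\<lambda>n. cmod (f n u) * dnorm G) \<longlonglongrightarrow> 0 * dnorm G"
    by (intro tendsto_intros tendsto_norm_zero assms(2) u)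
  then have "(\<lambda>n. dnorm (\<lambda>z. f n u * G z)) \<longlonglongrightarrow> 0" by (simp add: dnorm_cmult[OF G])
  with Cons.IH[OF ok] show ?case
    unfolding x finite_rank_Cons
    by (intro dnorm_add_tendsto_0 dir_space_cmult finite_rank_dir_space G ok)
qed

text \<open>Convergence in norm forces pointwise convergence, so a norm limit of
  \<open>T (f (r n))\<close> can only be 0 on the disk. The finite-rank part tends to 0 in norm by
  itself, and what remains is \<open>H\<close>.\<close>

lemma compact_weakly_null:
  assumes T: "dir_compact T"
    and TH: "\<And>f z. f \<in> dir_space \<Longrightarrow> cmod z < 1 \<Longrightarrow> T f z = H f z + finite_rank xs f z"
    and H: "\<And>f. f \<in> dir_space \<Longrightarrow> H f \<in> dir_space"
    and xs: "finite_rank_ok xs"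
    and f: "\<And>n. f n \<in> dir_space" "\<And>n. dnorm (f n) \<le> B" "\<And>u. cmod u < 1 \<Longrightarrow> (\<lambda>n. f n u) \<longlonglongrightarrow> 0"
    and Hf: "\<And>z. cmod z < 1 \<Longrightarrow> (\<lambda>n. H (f n) z) \<longlonglongrightarrow> 0"
  obtains r where "strict_mono r" "(\<lambda>n. dnorm (H (f (r n)))) \<longlonglongrightarrow> 0"
proof -
  obtain r g where r: "strict_mono (r :: nat \<Rightarrow> nat)" and g: "g \<in> dir_space"
    and lim: "(\<lambda>n. dnorm (\<lambda>z. T (f (r n)) z - g z)) \<longlonglongrightarrow> 0"
    using T f(1,2) unfolding dir_compact_def by meson
  let ?E = "\<lambda>n z. H (f (r n)) z + finite_rank xs (f (r n)) z"
  have E: "?E n \<in> dir_space" for n by (intro dir_space_add H f finite_rank_dir_space xs)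
  have R: "(\<lambda>n. dnorm (finite_rank xs (f (r n)))) \<longlonglongrightarrow> 0"
    using LIMSEQ_subseq_LIMSEQ[OF finite_rank_tendsto_0[OF xs f(3)] r] by (simp add: o_def)
  have lim': "(\<lambda>n. dnorm (\<lambda>z. ?E n z - g z)) \<longlonglongrightarrow> 0"
  proof -
    have "dnorm (\<lambda>z. T (f (r n)) z - g z) = dnorm (\<lambda>z. ?E n z - g z)" for n
      by (rule dnorm_cong) (simp add: TH f)
    then show ?thesis using lim by simp
  qed
  have g0: "g z = 0" if z: "cmod z < 1" for z
  proof -
    have "(\<lambda>n. ?E n z - g z) \<longlonglongrightarrow> 0"
      by (rule dnorm_tendsto_0_imp_value[OF dir_space_diff[OF E g] lim' z])
    moreover have "(\<lambda>n. ?E n z - g z) \<longlonglongrightarrow> (0 + 0) - g z"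
      using LIMSEQ_subseq_LIMSEQ[OF Hf[OF z] r] dnorm_tendsto_0_imp_value[OF finite_rank_dir_space[OF xs] R z]
      by (intro tendsto_intros) (simp_all add: o_def)
    ultimately show ?thesis using LIMSEQ_unique by fastforce
  qed
  have Elim: "(\<lambda>n. dnorm (?E n)) \<longlonglongrightarrow> 0"
  proof -
    have "dnorm (?E n) = dnorm (\<lambda>z. ?E n z - g z)" for n
      by (rule dnorm_cong) (simp add: g0)
    then show ?thesis using lim' by simp
  qed
  have R': "(\<lambda>n. dnorm (\<lambda>z. (-1) * finite_rank xs (f (r n)) z)) \<longlonglongrightarrow> 0"
    using R by (simp add: dnorm_cmult[OF finite_rank_dir_space[OF xs], of "-1", simplified])
  have "(\<lambda>n. dnorm (\<lambda>z. ?E n z + (-1) * finite_rank xs (f (r n)) z)) \<longlonglongrightarrow> 0"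
    by (rule dnorm_add_tendsto_0[OF E dir_space_cmult[OF finite_rank_dir_space[OF xs]] Elim R'])
  then have "(\<lambda>n. dnorm (H (f (r n)))) \<longlonglongrightarrow> 0" by simp
  with r show ?thesis by (rule that)
qed

section \<open>Test functions and half-plane coordinates\<close>

text \<open>For \<open>denom q z\<close> nonzero this is
  \<open>denom q z * (1 - cnj w * lft q z)\<close>: the denominator of a kernel evaluated along
  \<open>q\<close>, made affine in \<open>z\<close> and in \<open>cnj w\<close>.\<close>

definition lform :: "coeffs \<Rightarrow> complex \<Rightarrow> complex \<Rightarrow> complex" where
  "lform q z w = denom q z - cnj w * numer q z"

lemma lform_nz:
  assumes q: "is_lfsm q" and "cmod z < 1" "cmod w \<le> 1"
  shows "lform q z w \<noteq> 0"
proof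
  assume "lform q z w = 0"
  then have "cmod (denom q z) = cmod w * cmod (numer q z)"
    by (simp add: lform_def norm_mult)
  also have "\<dots> \<le> 1 * cmod (numer q z)" using assms by (intro mult_right_mono) auto
  finally show False using lfsm_less[OF q] assms by fastforce
qed

text \<open>The representing function of \<open>f \<mapsto> deriv f w\<close>, scaled to norm 1.\<close>

definition peak :: "complex \<Rightarrow> complex \<Rightarrow> complex" where
  "peak w z = of_real (1 - (cmod w)^2) * (z / (1 - cnj w * z))"

lemma peak_dir_space:
  assumes w: "cmod w < 1"
  shows "peak w \<in> dir_space" "dnorm (peak w) = 1"
proof -
  let ?k = "\<lambda>z. z / (1 - cnj w * z)"
  have t: "tcoeff ?k n = (if n = 0 then 0 else cnj w ^ (n - 1))" for n
    by (rule tcoeff_kernel) (use w in simp)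
  have x: "0 \<le> (cmod w)^2" "(cmod w)^2 < 1" using w by (auto simp: abs_square_less_1)
  have e: "real n * (cmod (tcoeff ?k n))^2 = real n * ((cmod w)^2) ^ (n - 1)" for n
  proof -
    have "(cmod w ^ (n - 1))^2 = ((cmod w)^2) ^ (n - 1)" by (metis power_mult mult.commute)
    then show ?thesis by (simp add: t norm_power)
  qed
  have k: "?k \<in> dir_space"
    using geometric_weighted[OF x] kernel_holo[OF less_imp_le[OF w]]
    unfolding dir_space_def mem_Collect_eq e by (auto simp: sums_iff)
  have dk: "dsem ?k = 1 / (1 - (cmod w)^2)^2"
    using geometric_weighted[OF x] unfolding dsem_def e by (simp add: sums_iff)
  have "dnorm ?k = sqrt (dsem ?k)" by (simp add: dnorm_def dsem_def)
  also have "\<dots> = 1 / (1 - (cmod w)^2)" unfolding dk using x by (intro real_sqrt_unique) (auto simp: power_divide)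
  finally have "dnorm ?k = 1 / (1 - (cmod w)^2)" .
  moreover have "peak w = (\<lambda>z. of_real (1 - (cmod w)^2) * ?k z)" by (auto simp: peak_def)
  ultimately show "peak w \<in> dir_space" "dnorm (peak w) = 1"
    using dir_space_cmult[OF k] dnorm_cmult[OF k, of "of_real (1 - (cmod w)^2)"] x
    by (auto simp del: of_real_diff of_real_power simp flip: of_real_diff)
qed

lemma peak_tendsto_0:
  assumes w: "\<And>n. cmod (w n) < 1" "(\<lambda>n. cmod (w n)) \<longlonglongrightarrow> 1" and u: "cmod u < 1"
  shows "(\<lambda>n. peak (w n) u) \<longlonglongrightarrow> 0"
proof (rule Lim_null_comparison)
  have "norm (peak (w n) u) \<le> (1 - (cmod (w n))^2) * (1 / (1 - cmod u))" for n
  proof -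
    have x: "(cmod (w n))^2 < 1" using w(1)[of n] by (simp add: abs_square_less_1)
    have "1 - cmod u \<le> 1 - cmod (w n) * cmod u"
      using w(1)[of n] by (simp add: mult_left_le_one_le)
    also have "\<dots> \<le> cmod (1 - cnj (w n) * u)"
      using norm_triangle_ineq2[of 1 "cnj (w n) * u"] by (simp add: norm_mult)
    finally have "cmod u / cmod (1 - cnj (w n) * u) \<le> 1 / (1 - cmod u)"
      using u by (intro frac_le) auto
    moreover have "cmod (of_real (1 - (cmod (w n))^2) :: complex) = 1 - (cmod (w n))^2"
      unfolding norm_of_real using x by simp
    from this have "norm (peak (w n) u) = (1 - (cmod (w n))^2) * (cmod u / cmod (1 - cnj (w n) * u))"
      unfolding peak_def norm_mult norm_divide by (simp only:)
    ultimately show ?thesis using x by (simp only:) (intro mult_left_mono, auto)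
  qed
  then show "eventually (\<lambda>n. norm (peak (w n) u) \<le> (1 - (cmod (w n))^2) * (1 / (1 - cmod u))) sequentially"
    by (rule always_eventually[OF allI])
  have "(\<lambda>n. (1 - (cmod (w n))^2) * (1 / (1 - cmod u))) \<longlonglongrightarrow> (1 - 1^2) * (1 / (1 - cmod u))"
    by (intro tendsto_intros w)
  then show "(\<lambda>n. (1 - (cmod (w n))^2) * (1 / (1 - cmod u))) \<longlonglongrightarrow> 0" by simp
qed

text \<open>The factor \<open>(denom q z)^2\<close> in q' cancels against the one from the kernel,
  which leaves only \<open>lform\<close>.\<close>

lemma peak_deriv:
  assumes q: "is_lfsm q" and w: "cmod w < 1" and z: "cmod z < 1"
  shows "((\<lambda>z. peak w (lft q z)) has_field_derivative
    of_real (1 - (cmod w)^2) * (cdet q / (lform q z w)^2)) (at z)"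
proof -
  let ?u = "lft q z"
  have u: "cmod ?u < 1" by (rule lfsm_lft_less[OF q z])
  have nz: "1 - cnj w * ?u \<noteq> 0" by (rule one_minus_nz[OF u]) (use w in simp)
  have D: "denom q z \<noteq> 0" using lfsm_denom_nz[OF q, of z] z by simp
  have 1: "((\<lambda>u. u / (1 - cnj w * u)) has_field_derivative 1 / (1 - cnj w * ?u)^2) (at ?u)"
    using nz by (auto intro!: derivative_eq_intros simp: power2_eq_square)
  have "lform q z w = denom q z * (1 - cnj w * ?u)"
    using D by (simp add: lform_def lft_eq field_simps)
  then have e: "1 / (1 - cnj w * ?u)^2 * (cdet q / (denom q z)^2) = cdet q / (lform q z w)^2"
    by (simp add: power_mult_distrib mult.commute)
  show ?thesis
    unfolding peak_def using DERIV_cmult[OF DERIV_chain2[OF 1 lft_has_deriv[OF D]]] unfolding e .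
qed

text \<open>The functions \<open>peak (w n)\<close> have norm 1 and tend to 0 at each point of the
  disk, so their images tend to 0 in norm along a subsequence; \<open>deriv_bound\<close> at the
  freely chosen points \<open>z n\<close> turns this into a statement about numbers. With
  \<open>e = 0\<close> it concerns one composition operator, with \<open>e = 1\<close> a difference
  of two.\<close>

lemma compact_diff_limit:
  assumes p: "is_lfsm p" and q: "is_lfsm q" and T: "dir_compact T" and xs: "finite_rank_ok xs"
    and TH: "\<And>f z. f \<in> dir_space \<Longrightarrow> cmod z < 1 \<Longrightarrow> T f z = (f (lft p z) - e * f (lft q z)) + finite_rank xs f z"
    and z: "\<And>n. cmod (z n) < 1"
    and w: "\<And>n. cmod (w n) < 1" "(\<lambda>n. cmod (w n)) \<longlonglongrightarrow> 1"
  obtains r where "strict_mono r"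
    "(\<lambda>n. of_real ((1 - (cmod (z (r n)))^2) * (1 - (cmod (w (r n)))^2)) *
       (cdet p / (lform p (z (r n)) (w (r n)))^2 - e * (cdet q / (lform q (z (r n)) (w (r n)))^2))) \<longlonglongrightarrow> 0"
proof -
  define H where "H f z = f (lft p z) - e * f (lft q z)" for f and z :: complex
  have H: "H f \<in> dir_space" if "f \<in> dir_space" for f
    unfolding H_def by (rule dir_space_diff[OF dir_space_comp[OF that p] dir_space_cmult[OF dir_space_comp[OF that q]]])
  have TH': "T f z = H f z + finite_rank xs f z" if "f \<in> dir_space" "cmod z < 1" for f z
    unfolding H_def by (rule TH[OF that])
  note pk = peak_dir_space[OF w(1)] peak_tendsto_0[OF w]
  have H0: "(\<lambda>n. H (peak (w n)) u) \<longlonglongrightarrow> 0" if u: "cmod u < 1" for u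
    using tendsto_diff[OF pk(3)[OF lfsm_lft_less[OF p u]] tendsto_mult_left[OF pk(3)[OF lfsm_lft_less[OF q u]], of e]]
    by (simp add: H_def)
  obtain r where r: "strict_mono r" and lim: "(\<lambda>n. dnorm (H (peak (w (r n))))) \<longlonglongrightarrow> 0"
    using compact_weakly_null[OF T TH' H xs pk(1) eq_refl[OF pk(2)] pk(3) H0] by blast
  show ?thesis
  proof (rule that[OF r], rule Lim_null_comparison[OF always_eventually[OF allI] lim])
    fix n
    let ?z = "z (r n)" and ?w = "w (r n)"
    have d: "deriv (H (peak ?w)) ?z = of_real (1 - (cmod ?w)^2) * (cdet p / (lform p ?z ?w)^2)
        - e * (of_real (1 - (cmod ?w)^2) * (cdet q / (lform q ?z ?w)^2))"
      unfolding H_def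
      by (intro DERIV_imp_deriv DERIV_diff DERIV_cmult peak_deriv p q w z)
    have "norm (of_real ((1 - (cmod ?z)^2) * (1 - (cmod ?w)^2)) *
       (cdet p / (lform p ?z ?w)^2 - e * (cdet q / (lform q ?z ?w)^2)))
      = norm (of_real (1 - (cmod ?z)^2) * deriv (H (peak ?w)) ?z)"
      unfolding d by (rule arg_cong[of _ _ norm], unfold of_real_mult, simp only: algebra_simps)
    also have "\<dots> = (1 - (cmod ?z)^2) * norm (deriv (H (peak ?w)) ?z)"
      unfolding norm_mult norm_of_real using z[of "r n"] by (simp add: abs_square_le_1)
    also have "\<dots> \<le> sqrt (dsem (H (peak ?w)))"
      by (rule deriv_bound[OF H[OF pk(1)] z])
    also have "\<dots> \<le> dnorm (H (peak ?w))" by (rule sqrt_dsem_le_dnorm[OF H[OF pk(1)]])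
    finally show "norm (of_real ((1 - (cmod ?z)^2) * (1 - (cmod ?w)^2)) *
       (cdet p / (lform p ?z ?w)^2 - e * (cdet q / (lform q ?z ?w)^2))) \<le> dnorm (H (peak ?w))" .
  qed
qed

text \<open>For unimodular \<eta>, the Cayley map of the right half-plane onto the disk with
  infinity going to \<eta>. Vertical lines become horocycles at \<eta>.\<close>

definition cay :: "complex \<Rightarrow> complex \<Rightarrow> complex" where
  "cay \<eta> x = \<eta> * (x - 1) / (x + 1)"

lemma cay_norm:
  assumes "cmod \<eta> = 1" "Re x > 0"
  shows "1 - (cmod (cay \<eta> x))^2 = 4 * Re x / (cmod (x + 1))^2" "cmod (cay \<eta> x) < 1"
proof -
  have nz: "x + 1 \<noteq> 0" using assms(2) by (auto simp: complex_eq_iff)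
  have e: "(cmod (x + 1))^2 - (cmod (x - 1))^2 = 4 * Re x"
    unfolding cmod_power2 by (simp add: power2_eq_square algebra_simps)
  have "cmod (cay \<eta> x) = cmod (x - 1) / cmod (x + 1)"
    by (simp add: cay_def norm_mult norm_divide assms)
  show 1: "1 - (cmod (cay \<eta> x))^2 = 4 * Re x / (cmod (x + 1))^2"
  proof -
    have "(cmod (x + 1))^2 \<noteq> 0" using nz by simp
    then have "1 - (cmod (cay \<eta> x))^2 = ((cmod (x + 1))^2 - (cmod (x - 1))^2) / (cmod (x + 1))^2"
      unfolding \<open>cmod (cay \<eta> x) = _\<close> power_divide by (simp only: diff_divide_distrib divide_self_if if_False)
    then show ?thesis unfolding e .
  qed
  have "0 < 4 * Re x / (cmod (x + 1))^2" using nz assms by simp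
  then have "(cmod (cay \<eta> x))^2 < 1" using 1 by linarith
  then show "cmod (cay \<eta> x) < 1" by (simp add: abs_square_less_1)
qed

text \<open>The coefficients of \<open>lform\<close> as a bilinear form in the half-plane coordinates
  \<open>x\<close>, \<open>cnj y\<close> of \<open>z = cay \<eta> x\<close> and \<open>w = cay \<omega> y\<close>.\<close>

fun hp :: "complex \<Rightarrow> complex \<Rightarrow> coeffs \<Rightarrow> coeffs" where
  "hp \<eta> \<omega> (a, b, c, d) =
    ((c * \<eta> + d) - cnj \<omega> * (a * \<eta> + b), (c * \<eta> + d) + cnj \<omega> * (a * \<eta> + b),
     (d - c * \<eta>) - cnj \<omega> * (b - a * \<eta>), (d - c * \<eta>) + cnj \<omega> * (b - a * \<eta>))"

fun hpform :: "coeffs \<Rightarrow> complex \<Rightarrow> complex \<Rightarrow> complex" where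
  "hpform (E, F, G, H) x y = E * x * cnj y + F * x + G * cnj y + H"

lemma lform_cay:
  assumes "x + 1 \<noteq> 0" "y + 1 \<noteq> 0"
  shows "lform q (cay \<eta> x) (cay \<omega> y) = hpform (hp \<eta> \<omega> q) x y / ((x + 1) * (cnj y + 1))"
proof -
  obtain a b c d where q: "q = (a, b, c, d)" by (cases q)
  have y: "cnj y + 1 \<noteq> 0" using assms(2) by (metis complex_cnj_add complex_cnj_one complex_cnj_zero_iff)
  let ?X = "x + 1" and ?Y = "cnj y + 1"
  have c1: "cay \<eta> x * ?X = \<eta> * (x - 1)" using assms(1) by (simp add: cay_def)
  have c2: "cnj (cay \<omega> y) * ?Y = cnj \<omega> * (cnj y - 1)" using y by (simp add: cay_def)
  have D: "denom q (cay \<eta> x) * ?X = c * (\<eta> * (x - 1)) + d * ?X"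
    unfolding c1 [symmetric] by (simp add: q algebra_simps)
  have N: "numer q (cay \<eta> x) * ?X = a * (\<eta> * (x - 1)) + b * ?X"
    unfolding c1 [symmetric] by (simp add: q algebra_simps)
  have "lform q (cay \<eta> x) (cay \<omega> y) * (?X * ?Y) =
      (denom q (cay \<eta> x) * ?X) * ?Y - (cnj (cay \<omega> y) * ?Y) * (numer q (cay \<eta> x) * ?X)"
    by (simp add: lform_def algebra_simps)
  also have "\<dots> = hpform (hp \<eta> \<omega> q) x y"
    unfolding D N c2 by (simp add: q algebra_simps)
  finally show ?thesis using assms(1) y by (simp add: eq_divide_eq)
qed

text \<open>The constant \<open>l\<close> is real and positive because the bilinear form has no zeros on the product
  of the two half-planes.\<close>

lemma hp_touch:
  assumes q: "is_lfsm q" and u: "cmod \<eta> = 1" "cmod \<omega> = 1" and t: "numer q \<eta> = \<omega> * denom q \<eta>"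
  obtains G H l where "hp \<eta> \<omega> q = (0, of_real l * G, G, H)" "0 < l" "G \<noteq> 0"
    "denom q \<eta> = of_real l * (case q of (a, b, c, d) \<Rightarrow> d - cnj \<omega> * b)"
proof -
  obtain a b c d where qe: "q = (a, b, c, d)" by (cases q)
  have wu: "cnj \<omega> * \<omega> = 1" using u by (metis complex_norm_square mult.commute of_real_1 one_power2)
  \<comment> \<open>Contact at \<eta> with value \<omega> is the vanishing of the coefficient of
    \<open>x * cnj y\<close>.\<close>
  have AB: "cnj \<omega> * (a * \<eta> + b) = c * \<eta> + d"
    using t wu by (simp add: qe flip: mult.assoc)
  define F where "F = (c * \<eta> + d) + cnj \<omega> * (a * \<eta> + b)"
  define G where "G = (d - c * \<eta>) - cnj \<omega> * (b - a * \<eta>)"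
  define H where "H = (d - c * \<eta>) + cnj \<omega> * (b - a * \<eta>)"
  have hpe: "hp \<eta> \<omega> q = (0, F, G, H)" using AB by (simp add: qe F_def G_def H_def)
  have F: "F = 2 * (c * \<eta> + d)" using AB by (simp add: F_def)
  have G2: "G = 2 * (d - cnj \<omega> * b)" using AB unfolding G_def by (simp add: algebra_simps) 
  have F0: "F \<noteq> 0"
  proof -
    have "c * \<eta> + d \<noteq> 0" using lfsm_denom_nz[OF q, of \<eta>] u by (simp add: qe)
    then show ?thesis unfolding F by (metis mult_eq_0_iff zero_neq_numeral)
  qed
  have G0: "G \<noteq> 0"
  proof
    assume "G = 0"
    then have D: "d = cnj \<omega> * b" by (simp add: G2)
    have "\<eta> \<noteq> 0" using u by auto
    then have "c = cnj \<omega> * a" using AB D by (auto simp: algebra_simps)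
    then have "cdet q = 0" using D by (simp add: qe)
    then show False using lfsm_det[OF q] by simp
  qed
  have nz: "F * x + G * cnj y + H \<noteq> 0" if "Re x > 0" "Re y > 0" for x y
  proof -
    have x1: "x + 1 \<noteq> 0" "y + 1 \<noteq> 0" using that by (auto simp: complex_eq_iff)
    have "lform q (cay \<eta> x) (cay \<omega> y) \<noteq> 0"
      using lform_nz[OF q] cay_norm(2)[OF u(1) that(1)] cay_norm(2)[OF u(2) that(2)] by simp
    then show ?thesis unfolding lform_cay[OF x1] hpe by simp
  qed
  \<comment> \<open>In these coordinates \<open>q\<close> is the affine map sending x to
    \<open>L * x + K\<close>.\<close>
  define L where "L = F / G"
  define K where "K = H / G"
  have *: "Re (L * x) + Re (K) \<ge> 0" if x: "Re x > 0" for x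
  proof (rule ccontr)
    assume "\<not> Re (L * x) + Re (K) \<ge> 0"
    \<comment> \<open>This conjugate would be an admissible \<open>y\<close> at which the form
      vanishes.\<close>
    then have "Re (cnj (- (L * x + K))) > 0" by simp
    from nz[OF x this] show False
      using G0 by (simp add: L_def K_def field_simps)
  qed
  have im: "Im L = 0"
  proof (rule ccontr)
    assume nz: "Im L \<noteq> 0"
    \<comment> \<open>Chosen such that the sum claimed to be nonnegative equals -1 at x = 1 + i
      t.\<close>
    define t where "t = (Re L + Re (K) + 1) / Im L"
    have "Re (L * Complex 1 t) = Re L - Im L * t" by simp
    then show False using *[of "Complex 1 t"] nz by (simp add: t_def)
  qed
  have re: "Re L \<ge> 0"
  proof (rule ccontr)
    assume neg: "\<not> Re L \<ge> 0"
    define t where "t = (\<bar>Re (K)\<bar> + 1) / (- Re L)"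
    have t: "t > 0" using neg unfolding t_def by (intro divide_pos_pos) auto
    have "Re (L * of_real t) = - (\<bar>Re (K)\<bar> + 1)" using neg by (simp add: t_def)
    then show False using *[of "of_real t"] t by simp
  qed
  have Le: "L = of_real (Re L)" using im by (simp add: complex_eq_iff)
  have "L \<noteq> 0" using F0 G0 by (simp add: L_def)
  then have pos: "Re L > 0" using re Le by (metis less_eq_real_def of_real_0)
  have FL: "F = of_real (Re L) * G" using G0 Le by (simp add: L_def field_simps)
  show ?thesis
  proof (rule that[of "Re L" G H])
    show "hp \<eta> \<omega> q = (0, of_real (Re L) * G, G, H)" unfolding hpe using FL by simp
    show "denom q \<eta> = of_real (Re L) * (case q of (a, b, c, d) \<Rightarrow> d - cnj \<omega> * b)"
    proof -
      have "2 * (c * \<eta> + d) = 2 * (of_real (Re L) * (d - cnj \<omega> * b))"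
        using FL unfolding F G2 by (simp only: mult.left_commute)
      then show ?thesis unfolding qe by (simp del: distrib_left_numeral)
    qed
  qed (use pos G0 in auto)
qed

text \<open>Dividing by the fourth and then by the second power of \<open>r n\<close> isolates the
  leading coefficients, which convergence forces to be 0. The square is there because derivatives of
  the kernels contain only squares of the form.\<close>

lemma quadratic_subseq:
  fixes e0 e1 e2 l :: complex and r :: "nat \<Rightarrow> nat"
  assumes r: "strict_mono r" and lim: "(\<lambda>n. (e0 + e1 * of_nat (r n) + e2 * (of_nat (r n))^2)^2) \<longlonglongrightarrow> l"
  shows "e2 = 0" "e1 = 0" "e0^2 = l"
proof -
  have inv: "(\<lambda>n. 1 / complex_of_nat (r n)) \<longlonglongrightarrow> 0"
    using LIMSEQ_subseq_LIMSEQ[OF lim_1_over_n r] by (simp add: o_def)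
  have ev: "eventually (\<lambda>n. r n > 0) sequentially"
    using eventually_gt_at_top[of 0] by eventually_elim (use seq_suble[OF r] in \<open>auto intro: less_le_trans\<close>)
  show e2: "e2 = 0"
  proof -
    have A: "(\<lambda>n. (e0 + e1 * of_nat (r n) + e2 * (of_nat (r n))^2)^2 * (1 / complex_of_nat (r n))^4) \<longlonglongrightarrow> l * 0^4"
      by (intro tendsto_intros lim inv)
    have B: "(\<lambda>n. (e0 * (1 / of_nat (r n))^2 + e1 * (1 / of_nat (r n)) + e2)^2) \<longlonglongrightarrow> (e0 * 0^2 + e1 * 0 + e2)^2"
      by (intro tendsto_intros inv)
    have C: "eventually (\<lambda>n. (e0 + e1 * of_nat (r n) + e2 * (of_nat (r n))^2)^2 * (1 / complex_of_nat (r n))^4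
        = (e0 * (1 / of_nat (r n))^2 + e1 * (1 / of_nat (r n)) + e2)^2) sequentially"
      using ev by eventually_elim (simp add: field_simps power2_eq_square power4_eq_xxxx)
    have "l * 0^4 = (e0 * 0^2 + e1 * 0 + e2)^2"
      by (rule LIMSEQ_unique[OF iffD1[OF tendsto_cong[OF C] A] B])
    then show ?thesis by simp
  qed
  show e1: "e1 = 0"
  proof -
    have A: "(\<lambda>n. (e0 + e1 * of_nat (r n))^2 * (1 / complex_of_nat (r n))^2) \<longlonglongrightarrow> l * 0^2"
      using lim unfolding e2 by (intro tendsto_intros inv) simp
    have B: "(\<lambda>n. (e0 * (1 / of_nat (r n)) + e1)^2) \<longlonglongrightarrow> (e0 * 0 + e1)^2"
      by (intro tendsto_intros inv)
    have C: "eventually (\<lambda>n. (e0 + e1 * of_nat (r n))^2 * (1 / complex_of_nat (r n))^2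
        = (e0 * (1 / of_nat (r n)) + e1)^2) sequentially"
      using ev by eventually_elim (simp add: field_simps power2_eq_square)
    have "l * 0^2 = (e0 * 0 + e1)^2"
      by (rule LIMSEQ_unique[OF iffD1[OF tendsto_cong[OF C] A] B])
    then show ?thesis by simp
  qed
  show "e0^2 = l" using lim unfolding e1 e2 by (simp add: LIMSEQ_const_iff)
qed

section \<open>Compactness and boundary contact\<close>

fun cscale :: "complex \<Rightarrow> coeffs \<Rightarrow> coeffs" where
  "cscale k (a, b, c, d) = (k*a, k*b, k*c, k*d)"

lemma hp_inj:
  assumes "\<eta> \<noteq> 0" "\<omega> \<noteq> 0" "hp \<eta> \<omega> q = cscale k (hp \<eta> \<omega> p)"
  shows "q = cscale k p"
proof -
  obtain a b c d where p: "p = (a, b, c, d)" by (cases p)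
  obtain a' b' c' d' where q: "q = (a', b', c', d')" by (cases q)
  define A B A' B' where "A = c * \<eta> + d" and "B = cnj \<omega> * (a * \<eta> + b)"
    and "A' = c' * \<eta> + d'" and "B' = cnj \<omega> * (a' * \<eta> + b')"
  define C D C' D' where "C = d - c * \<eta>" and "D = cnj \<omega> * (b - a * \<eta>)"
    and "C' = d' - c' * \<eta>" and "D' = cnj \<omega> * (b' - a' * \<eta>)"
  have "A' - B' = k * (A - B)" "A' + B' = k * (A + B)" "C' - D' = k * (C - D)" "C' + D' = k * (C + D)"
    using assms(3) unfolding p q hp.simps cscale.simps prod.inject
      A_def B_def A'_def B'_def C_def D_def C'_def D'_def by blast+
  then have "A' = k * A" "B' = k * B" "C' = k * C" "D' = k * D" by algebra+
  then have 1: "c' * \<eta> + d' = k * (c * \<eta> + d)" "d' - c' * \<eta> = k * (d - c * \<eta>)"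
    and "cnj \<omega> * (a' * \<eta> + b') = cnj \<omega> * (k * (a * \<eta> + b))"
      "cnj \<omega> * (b' - a' * \<eta>) = cnj \<omega> * (k * (b - a * \<eta>))"
    unfolding A_def B_def A'_def B'_def C_def D_def C'_def D'_def by (simp_all only: mult.left_commute)
  then have 2: "a' * \<eta> + b' = k * (a * \<eta> + b)" "b' - a' * \<eta> = k * (b - a * \<eta>)"
    using assms(2) by simp_all
  have "d' = k * d" "c' * \<eta> = (k * c) * \<eta>" using 1 by algebra+
  moreover have "b' = k * b" "a' * \<eta> = (k * a) * \<eta>" using 2 by algebra+
  ultimately show ?thesis using assms(1) by (simp add: p q)
qed

lemma cay_tendsto_1:
  assumes "cmod \<omega> = 1" "0 < y" "0 < l"
  shows "(\<lambda>n. cmod (cay \<omega> (Complex y (l * real n)))) \<longlonglongrightarrow> 1"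
proof -
  let ?Y = "\<lambda>n. Complex y (l * real n)"
  have "(\<lambda>n. 4 * y / (cmod (?Y n + 1))^2) \<longlonglongrightarrow> 0"
  proof -
    have "(cmod (?Y n + 1))^2 = (y + 1)^2 + (l * real n)^2" for n
      unfolding cmod_power2 by simp
    moreover have "filterlim (\<lambda>n. (y + 1)^2 + (l * real n)^2) at_top sequentially"
      using assms(3)
      by (intro filterlim_tendsto_add_at_top[OF tendsto_const] filterlim_pow_at_top
          filterlim_tendsto_pos_mult_at_top[OF tendsto_const] filterlim_real_sequentially) auto
    then have "(\<lambda>n. 4 * y / ((y + 1)^2 + (l * real n)^2)) \<longlonglongrightarrow> 0"
      by (rule real_tendsto_divide_at_top[OF tendsto_const])
    ultimately show ?thesis by simp
  qed
  then have "(\<lambda>n. sqrt (1 - 4 * y / (cmod (?Y n + 1))^2)) \<longlonglongrightarrow> sqrt (1 - 0)"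
    by (intro tendsto_intros)
  moreover have "sqrt (1 - 4 * y / (cmod (?Y n + 1))^2) = cmod (cay \<omega> (?Y n))" for n
    using cay_norm(1)[OF assms(1), of "?Y n"] assms(2) by (intro real_sqrt_unique) auto
  ultimately show ?thesis by simp
qed

lemma tendsto_0_of_mult_norm:
  fixes f :: "nat \<Rightarrow> complex"
  assumes "c \<noteq> (0::real)" "(\<lambda>n. c * norm (f n)) \<longlonglongrightarrow> 0"
  shows "f \<longlonglongrightarrow> 0"
  using tendsto_mult_left_iff[OF assms(1), of "\<lambda>n. norm (f n)" 0] assms(2)
  by (simp add: tendsto_norm_zero_iff)

section \<open>Compactness tested along horocycles at a contact point\<close>

context
  fixes p q :: coeffs and T :: op and xs e and \<eta> \<omega> :: complex
  assumes p: "is_lfsm p" and q: "is_lfsm q" and T: "dir_compact T" and xs: "finite_rank_ok xs"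
    and TH: "\<And>f z. f \<in> dir_space \<Longrightarrow> cmod z < 1 \<Longrightarrow> T f z = (f (lft p z) - e * f (lft q z)) + finite_rank xs f z"
    and u: "cmod \<eta> = 1" "cmod \<omega> = 1" and touch: "numer p \<eta> = \<omega> * denom p \<eta>"
begin

text \<open>Along \<open>x + \<i> n\<close> and \<open>y + \<i> l n\<close>, that is along horocycles at \<open>\<eta>\<close> and \<open>\<omega>\<close>, the bilinear form of \<open>p\<close> is
  constant; under radial approach \<open>H\<close> would drop out of the limit.\<close>

lemma compact_half_plane_limit:
  assumes hp: "hp \<eta> \<omega> p = (0, of_real l * G, G, H)" "0 < l" and x: "0 < x" and y: "0 < y"
  obtains r where "strict_mono r" "G * of_real (l * x + y) + H \<noteq> 0"
    "\<And>n. hpform (hp \<eta> \<omega> q) (Complex x (real n)) (Complex y (l * real n)) \<noteq> 0"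
    "(\<lambda>n. cdet p / (G * of_real (l * x + y) + H)^2 -
       e * (cdet q / (hpform (hp \<eta> \<omega> q) (Complex x (real (r n))) (Complex y (l * real (r n))))^2)) \<longlonglongrightarrow> 0"
proof -
  let ?X = "\<lambda>n. Complex x (real n)" and ?Y = "\<lambda>n. Complex y (l * real n)"
  let ?z = "\<lambda>n. cay \<eta> (?X n)" and ?w = "\<lambda>n. cay \<omega> (?Y n)"
  let ?c = "G * of_real (l * x + y) + H" and ?P = "\<lambda>n. hpform (hp \<eta> \<omega> q) (?X n) (?Y n)"
  have nz: "?X n + 1 \<noteq> 0" "?Y n + 1 \<noteq> 0" "cnj (?Y n) + 1 \<noteq> 0" for n
    using x y by (auto simp: complex_eq_iff)
  have z: "cmod (?z n) < 1" "1 - (cmod (?z n))^2 = 4 * x / (cmod (?X n + 1))^2"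
    and w: "cmod (?w n) < 1" "1 - (cmod (?w n))^2 = 4 * y / (cmod (?Y n + 1))^2" for n
    using cay_norm[OF u(1), of "?X n"] cay_norm[OF u(2), of "?Y n"] x y by auto
  have c: "hpform (hp \<eta> \<omega> p) (?X n) (?Y n) = ?c" for n
    unfolding hp(1) by (simp add: Complex_eq algebra_simps)
  have lp: "lform p (?z n) (?w n) = ?c / ((?X n + 1) * (cnj (?Y n) + 1))" for n
    unfolding lform_cay[OF nz(1,2)] c ..
  have lq: "lform q (?z n) (?w n) = ?P n / ((?X n + 1) * (cnj (?Y n) + 1))" for n
    unfolding lform_cay[OF nz(1,2)] ..
  have c0: "?c \<noteq> 0"
    using lform_nz[OF p z(1)[of 0] less_imp_le[OF w(1)[of 0]]] unfolding lp by auto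
  have P0: "?P n \<noteq> 0" for n
    using lform_nz[OF q z(1)[of n] less_imp_le[OF w(1)[of n]]] unfolding lq by auto
  obtain r where r: "strict_mono r" and lim:
    "(\<lambda>n. of_real ((1 - (cmod (?z (r n)))^2) * (1 - (cmod (?w (r n)))^2)) *
       (cdet p / (lform p (?z (r n)) (?w (r n)))^2 - e * (cdet q / (lform q (?z (r n)) (?w (r n)))^2))) \<longlonglongrightarrow> 0"
    by (rule compact_diff_limit[where z = ?z and w = ?w and e = e,
          OF p q T xs _ z(1) w(1) cay_tendsto_1[OF u(2) y hp(2)]]) (assumption | rule TH | rule that)+
  have eq: "norm (of_real ((1 - (cmod (?z n))^2) * (1 - (cmod (?w n))^2)) *
       (cdet p / (lform p (?z n) (?w n))^2 - e * (cdet q / (lform q (?z n) (?w n))^2)))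
     = 16 * x * y * norm (cdet p / ?c^2 - e * (cdet q / (?P n)^2))" for n
  proof -
    \<comment> \<open>The squared moduli of the two factors are also the denominators of 1 - |z|^2
      and 1 - |w|^2; they cancel, and the numerators 4 x and 4 y give the constant 16 x y.\<close>
    let ?M = "(?X n + 1) * (cnj (?Y n) + 1)"
    have M0: "?M \<noteq> 0" using nz[of n] by simp
    have d: "D / (A / ?M)^2 = ?M^2 * (D / A^2)" for D A
      using M0 by (simp add: power_divide)
    let ?R = "cdet p / ?c^2 - e * (cdet q / (?P n)^2)"
    let ?a = "(cmod (?X n + 1))^2" and ?b = "(cmod (?Y n + 1))^2"
    have A: "cdet p / (?c / ?M)^2 - e * (cdet q / (?P n / ?M)^2) = ?M^2 * ?R"
      unfolding d by (simp only: right_diff_distrib mult.left_commute)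
    have N: "norm (?M^2) = ?a * ?b"
    proof -
      have "cmod (cnj (?Y n) + 1) = cmod (?Y n + 1)"
        by (metis complex_cnj_add complex_cnj_one complex_mod_cnj)
      then show ?thesis by (simp add: norm_mult norm_power power_mult_distrib)
    qed
    have K: "cmod (of_real (4 * x / ?a * (4 * y / ?b))) = 16 * x * y / (?a * ?b)"
      unfolding norm_of_real using x y by simp
    have ab: "?a * ?b \<noteq> 0" using nz[of n] by simp
    have "norm (of_real (4 * x / ?a * (4 * y / ?b)) * (?M^2 * ?R)) = 16 * x * y / (?a * ?b) * ((?a * ?b) * norm ?R)"
      unfolding norm_mult[of "of_real _"] norm_mult[of "?M^2"] K N ..
    also have "\<dots> = 16 * x * y * norm ?R"
      using ab by (simp only: times_divide_eq_left mult.assoc [symmetric] nonzero_mult_div_cancel_right) simp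
    finally show ?thesis unfolding lp lq z(2) w(2) A .
  qed
  have "(\<lambda>n. cdet p / ?c^2 - e * (cdet q / (?P (r n))^2)) \<longlonglongrightarrow> 0"
  proof -
    from tendsto_norm_zero[OF lim]
    have "(\<lambda>n. 16 * x * y * norm (cdet p / ?c^2 - e * (cdet q / (?P (r n))^2))) \<longlonglongrightarrow> 0"
      unfolding eq .
    then show ?thesis by (rule tendsto_0_of_mult_norm[rotated]) (use x y in simp)
  qed
  then show ?thesis by (rule that[OF r c0 P0])
qed

text \<open>For \<open>e = 0\<close> the sequence that should tend to 0 is a nonzero constant. Hence
  composition with a map touching the circle is not compact, even modulo finite rank.\<close>

lemma compact_touch_nonzero: "e \<noteq> 0"
proof
  assume e: "e = 0"
  obtain G H l where hp: "hp \<eta> \<omega> p = (0, of_real l * G, G, H)" "0 < l" "G \<noteq> 0"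
    using hp_touch[OF p u touch] by metis
  show False
    by (rule compact_half_plane_limit[OF hp(1,2) zero_less_one zero_less_one])
       (use e lfsm_det[OF p] in \<open>simp add: LIMSEQ_const_iff\<close>)
qed

text \<open>Along the horocycles adapted to \<open>p\<close> the form of \<open>q\<close> must be
  constant too, which fixes \<open>E'\<close> and \<open>F'\<close>; varying \<open>x\<close> and
  \<open>y\<close> then gives an identity between squares of affine functions of
  \<open>l * x + y\<close>. Their zeros agree, so the two forms are proportional.\<close>

lemma compact_touch_eq:
  assumes e: "e = 1"
  obtains k where "k \<noteq> 0" "q = cscale k p"
proof -
  obtain G H l where hp: "hp \<eta> \<omega> p = (0, of_real l * G, G, H)" "0 < l" "G \<noteq> 0"
    using hp_touch[OF p u touch] by metis
  obtain E' F' G' H' where hq: "hp \<eta> \<omega> q = (E', F', G', H')" by (cases "hp \<eta> \<omega> q")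
  let ?dp = "cdet p" and ?dq = "cdet q"
  have d0: "?dp \<noteq> 0" "?dq \<noteq> 0" using lfsm_det p q by auto
  have main: "E' = 0 \<and> F' = of_real l * G' \<and>
      ?dp * (G' * of_real (l * x + y) + H')^2 = ?dq * (G * of_real (l * x + y) + H)^2"
    if x: "0 < x" and y: "0 < y" for x y
  proof -
    let ?c = "G * of_real (l * x + y) + H"
    let ?P = "\<lambda>n. hpform (hp \<eta> \<omega> q) (Complex x (real n)) (Complex y (l * real n))"
    obtain r where r: "strict_mono r" and c0: "?c \<noteq> 0" and P0: "\<And>n. ?P n \<noteq> 0"
      and lim: "(\<lambda>n. ?dp / ?c^2 - 1 * (?dq / (?P (r n))^2)) \<longlonglongrightarrow> 0"
      by (rule compact_half_plane_limit[OF hp(1,2) x y], unfold e) (assumption | rule that)+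
    from tendsto_diff[OF tendsto_const[of "?dp / ?c^2"] lim]
    have "(\<lambda>n. ?dq / (?P (r n))^2) \<longlonglongrightarrow> ?dp / ?c^2" by simp
    from tendsto_divide[OF tendsto_const[of ?dq] this]
    have sq: "(\<lambda>n. (?P (r n))^2) \<longlonglongrightarrow> ?dq / (?dp / ?c^2)"
      using c0 d0 P0 by simp
    define e0 e1 e2 where "e0 = E' * of_real (x * y) + F' * of_real x + G' * of_real y + H'"
      and "e1 = \<i> * (E' * of_real (y - l * x) + F' - of_real l * G')" and "e2 = E' * of_real l"
    have P: "?P n = e0 + e1 * of_nat n + e2 * (of_nat n)^2" for n
      unfolding hq e0_def e1_def e2_def by (simp add: Complex_eq algebra_simps power2_eq_square)
    note Q = quadratic_subseq[OF r sq[unfolded P]]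
    have E: "E' = 0" using Q(1) hp(2) by (simp add: e2_def)
    have F: "F' = of_real l * G'" using Q(2) E by (simp add: e1_def)
    have "(G' * of_real (l * x + y) + H')^2 = ?dq / (?dp / ?c^2)"
      using Q(3) by (simp add: e0_def E F algebra_simps)
    then show ?thesis using E F d0 c0 by (simp add: field_simps)
  qed
  \<comment> \<open>The choice x = y = s gives l x + y = s t; the values s = 1, 2, 3 determine a
    quadratic polynomial in s.\<close>
  define t where "t = complex_of_real (l + 1)"
  have t0: "t \<noteq> 0" unfolding t_def using hp(2) by (simp only: of_real_eq_0_iff)
  have m: "?dp * (G' * (s * t) + H')^2 = ?dq * (G * (s * t) + H)^2" if "s = 1 \<or> s = 2 \<or> s = 3" for s
    using main[of 1 1] main[of 2 2] main[of 3 3] that by (auto simp: t_def algebra_simps)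
  have m1: "?dp * (G' * t + H')^2 = ?dq * (G * t + H)^2"
    and m2: "?dp * (G' * (2 * t) + H')^2 = ?dq * (G * (2 * t) + H)^2"
    and m3: "?dp * (G' * (3 * t) + H')^2 = ?dq * (G * (3 * t) + H)^2"
    using m[of 1] m[of 2] m[of 3] by simp_all
  define D2 where "D2 = ?dp * (G' * t)^2 - ?dq * (G * t)^2"
  define D1 where "D1 = ?dp * (G' * t) * H' - ?dq * (G * t) * H"
  define D0 where "D0 = ?dp * H'^2 - ?dq * H^2"
  have "D2 + 2 * D1 + D0 = 0" "4 * D2 + 4 * D1 + D0 = 0" "9 * D2 + 6 * D1 + D0 = 0"
    using m1 m2 m3 unfolding D2_def D1_def D0_def by algebra+
  then have D: "D2 = 0" "D1 = 0" by algebra+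
  have G'0: "G' \<noteq> 0" using D(1) d0 hp(3) t0 by (auto simp: D2_def)
  \<comment> \<open>The equations \<open>D1 = 0\<close> and \<open>D2 = 0\<close>, divided by each
    other, say H' / G' = H / G; the products clear the denominators.\<close>
  have "(G * H' - G' * H) * (?dp * ?dq * G * G' * t * t * t) = 0"
  proof -
    have "(G * H' - G' * H) * (?dp * ?dq * G * G' * t * t * t)
        = ?dq * (G * t)^2 * (D1 + ?dq * (G * t) * H) - ?dq * (G * t) * H * (D2 + ?dq * (G * t)^2)"
      unfolding D1_def D2_def by algebra
    then show ?thesis unfolding D by algebra
  qed
  then have HH: "G * H' = G' * H" using d0 hp(3) G'0 t0 by simp
  define k where "k = G' / G"
  have "hp \<eta> \<omega> q = cscale k (hp \<eta> \<omega> p)"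
    unfolding hq hp(1) using main[of 1 1] HH hp(3) by (simp add: k_def field_simps)
  then have "q = cscale k p" by (rule hp_inj[rotated 2]) (use u in auto)
  moreover have "k \<noteq> 0" using G'0 hp(3) by (simp add: k_def)
  ultimately show ?thesis using that by blast
qed

end

section \<open>Compactness for images away from the circle\<close>

lemma deriv_bounds_on_smaller_disk:
  assumes F: "F holomorphic_on ball 0 1" and \<rho>: "\<rho> < \<rho>'" "\<rho>' < 1"
    and S: "\<And>u. cmod u \<le> \<rho>' \<Longrightarrow> cmod (F u) \<le> S" and u: "cmod u \<le> \<rho>"
  shows "cmod (deriv F u) \<le> S / (\<rho>' - \<rho>)" "cmod (deriv (deriv F) u) \<le> 2 * S / (\<rho>' - \<rho>)^2"
proof -
  let ?d = "\<rho>' - \<rho>"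
  have sub: "cmod v \<le> \<rho>'" if "cmod (u - v) \<le> ?d" for v
    using norm_triangle_ineq2[of v u] that u by (simp add: norm_minus_commute)
  have cb: "cball u ?d \<subseteq> ball 0 1"
  proof
    fix v assume "v \<in> cball u ?d"
    then show "v \<in> ball 0 1" using sub[of v] \<rho> by (simp add: dist_norm)
  qed
  have Fc: "F holomorphic_on cball u ?d" by (rule holomorphic_on_subset[OF F cb])
  have *: "cmod ((deriv ^^ n) F u) \<le> fact n * S / ?d ^ n" for n
  proof (rule Cauchy_inequality)
    show "F holomorphic_on ball u ?d" by (rule holomorphic_on_subset[OF Fc ball_subset_cball])
    show "continuous_on (cball u ?d) F" by (rule holomorphic_on_imp_continuous_on[OF Fc])
  qed (use \<rho> sub S in auto)
  show "cmod (deriv F u) \<le> S / (\<rho>' - \<rho>)" using *[of 1] by simp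
  show "cmod (deriv (deriv F) u) \<le> 2 * S / (\<rho>' - \<rho>)^2" using *[of 2] by (simp add: numeral_2_eq_2)
qed

lemma lfsm_inner_radius:
  assumes p: "is_lfsm p" and nt: "\<And>\<eta>. cmod \<eta> = 1 \<Longrightarrow> cmod (numer p \<eta>) \<noteq> cmod (denom p \<eta>)"
  obtains \<rho> where "0 \<le> \<rho>" "\<rho> < 1" "\<And>z. cmod z \<le> 1 \<Longrightarrow> cmod (lft p z) \<le> \<rho>"
proof -
  have lt: "cmod (lft p z) < 1" if "cmod z \<le> 1" for z
    using lfsm_le[OF p that] lfsm_denom_nz[OF p that] lfsm_lft_less[OF p, of z] nt[of z] that
    by (cases "cmod z = 1") (auto simp: lft_eq norm_divide divide_less_eq)
  have "continuous_on (cball 0 1) (\<lambda>z. cmod (lft p z))"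
    unfolding lft_eq
    by (intro continuous_on_norm continuous_on_divide continuous_numer continuous_denom continuous_on_id)
       (use lfsm_denom_nz[OF p] in auto)
  then obtain x where "x \<in> cball 0 1" "\<And>z. z \<in> cball 0 1 \<Longrightarrow> cmod (lft p z) \<le> cmod (lft p x)"
    using continuous_attains_sup[of "cball 0 1" "\<lambda>z. cmod (lft p z)"] by auto
  then show ?thesis using that[of "cmod (lft p x)"] lt[of x] by auto
qed

text \<open>The composition only sees \<open>F\<close> on the disk of radius \<rho>, and Cauchy's
  estimates on circles of radius \<rho>' - \<rho> turn a bound for \<open>F\<close> on the larger
  disk into bounds for two derivatives. \<open>F\<close> itself may lie outside the Dirichlet
  space.\<close>

lemma comp_small:
  assumes p: "is_lfsm p" and \<rho>: "\<rho> < \<rho>'" "\<rho>' < 1" and pr: "\<And>z. cmod z \<le> 1 \<Longrightarrow> cmod (lft p z) \<le> \<rho>"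
  obtains C where "0 \<le> C" "\<And>F S. F holomorphic_on ball 0 1 \<Longrightarrow> (\<And>u. cmod u \<le> \<rho>' \<Longrightarrow> cmod (F u) \<le> S) \<Longrightarrow>
    (\<lambda>z. F (lft p z)) \<in> dir_space \<and> dnorm (\<lambda>z. F (lft p z)) \<le> C * S"
proof -
  obtain L where L: "1 \<le> L" "\<And>M h. h holomorphic_on ball 0 1 \<Longrightarrow>
       (\<And>z. cmod z < 1 \<Longrightarrow> cmod (deriv h (lft p z)) \<le> M \<and> cmod (deriv (deriv h) (lft p z)) \<le> M) \<Longrightarrow>
       C2_bound (L * M) (\<lambda>z. h (lft p z))"
    using C2_bound_lft[OF p] by blast
  define a where "a = L * (1 / (\<rho>' - \<rho>) + 2 / (\<rho>' - \<rho>)^2)"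
  have a: "0 \<le> a" using L \<rho> by (simp add: a_def)
  define C where "C = sqrt (1 + C2_const * a^2)"
  show ?thesis
  proof (rule that[of C])
    show "0 \<le> C" using C2_const_nonneg by (simp add: C_def)
    fix F S assume F: "F holomorphic_on ball 0 1" and S: "\<And>u. cmod u \<le> \<rho>' \<Longrightarrow> cmod (F u) \<le> S"
    have z0: "cmod (lft p z) \<le> \<rho>" if "cmod z < 1" for z using pr[of z] that by simp
    have S0: "0 \<le> S" using order_trans[OF norm_ge_zero S[of "lft p 0"]] pr[of 0] \<rho> by auto
    let ?M = "S / (\<rho>' - \<rho>) + 2 * S / (\<rho>' - \<rho>)^2"
    have "C2_bound (L * ?M) (\<lambda>z. F (lft p z))"
    proof (rule L(2)[OF F], intro conjI)
      fix z :: complex assume z: "cmod z < 1"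
      note B = deriv_bounds_on_smaller_disk[OF F \<rho> S z0[OF z]]
      have "0 \<le> S / (\<rho>' - \<rho>)" "0 \<le> 2 * S / (\<rho>' - \<rho>)^2" using S0 \<rho> by auto
      then show "cmod (deriv F (lft p z)) \<le> ?M" "cmod (deriv (deriv F) (lft p z)) \<le> ?M"
        using B by linarith+
    qed
    moreover have "L * ?M = a * S" by (simp add: a_def algebra_simps)
    ultimately have b: "C2_bound (a * S) (\<lambda>z. F (lft p z))" by simp
    have D: "(\<lambda>z. F (lft p z)) \<in> dir_space" by (rule C2_bound_dsem(1)[OF b])
    have "(cmod (F (lft p 0)))^2 \<le> S^2" using S[of "lft p 0"] pr[of 0] \<rho> by (intro power_mono) auto
    then have "(dnorm (\<lambda>z. F (lft p z)))^2 \<le> (C * S)^2"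
      unfolding dnorm_sq[OF D] using C2_bound_dsem(2)[OF b] C2_const_nonneg
      by (simp add: C_def power_mult_distrib algebra_simps)
    then have "dnorm (\<lambda>z. F (lft p z)) \<le> C * S"
      by (rule power2_le_imp_le) (use \<open>0 \<le> C\<close> S0 in simp)
    with D show "(\<lambda>z. F (lft p z)) \<in> dir_space \<and> dnorm (\<lambda>z. F (lft p z)) \<le> C * S" by blast
  qed
qed

text \<open>Norm-bounded sets are normal families by \<open>value_bound\<close>, so Montel's theorem
  applies. The limit is only claimed to be holomorphic; it enters later through compositions and
  point evaluations.\<close>

lemma bounded_subseq:
  assumes f: "\<And>n. f n \<in> dir_space" "\<And>n. dnorm (f n) \<le> B"
  obtains r g where "strict_mono (r :: nat \<Rightarrow> nat)" "g holomorphic_on ball 0 1"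
    "\<And>u. cmod u < 1 \<Longrightarrow> (\<lambda>n. f (r n) u) \<longlonglongrightarrow> g u"
    "\<And>\<rho>. \<rho> < 1 \<Longrightarrow> uniform_limit (cball 0 \<rho>) (\<lambda>n. f (r n)) g sequentially"
proof -
  have bd: "\<exists>C. \<forall>h\<in>range f. \<forall>z\<in>K. norm (h z) \<le> C" if K: "compact K" "K \<subseteq> ball 0 1" for K
  proof (cases "K = {}")
    case False
    have "continuous_on K cmod" by (intro continuous_intros)
    then obtain x where x: "x \<in> K" "\<And>z. z \<in> K \<Longrightarrow> cmod z \<le> cmod x"
      using continuous_attains_sup[OF K(1) False] by blast
    have x1: "cmod x < 1" using x(1) K(2) by auto
    have B: "0 \<le> B" using order_trans[OF dnorm_nonneg[OF f(1)] f(2)] .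
    have "norm (f n z) \<le> (1 + 1 / (1 - (cmod x)^2)) * B" if z: "z \<in> K" for n z
    proof -
      have le: "(cmod z)^2 \<le> (cmod x)^2" using x(2)[OF z] by (intro power_mono) auto
      have lt: "(cmod x)^2 < 1" using x1 by (simp add: abs_square_less_1)
      have "norm (f n z) \<le> (1 + 1 / (1 - (cmod z)^2)) * dnorm (f n)"
        by (rule value_bound[OF f(1)]) (use x(2)[OF z] x1 in simp)
      also have "\<dots> \<le> (1 + 1 / (1 - (cmod x)^2)) * B"
        using le lt le_less_trans[OF le lt] B dnorm_nonneg[OF f(1)] f(2) by (intro mult_mono add_mono divide_left_mono mult_pos_pos) auto
      finally show ?thesis .
    qed
    then show ?thesis by blast
  qed auto
  have ho: "h holomorphic_on ball 0 1" if "h \<in> range f" for h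
    using that dir_space_holo[OF f(1)] by blast
  show ?thesis
  proof (rule Montel[of "ball 0 1" "range f" f])
    fix g r assume g: "g holomorphic_on ball 0 1" "strict_mono (r :: nat \<Rightarrow> nat)"
      "\<And>x. x \<in> ball 0 1 \<Longrightarrow> (\<lambda>n. f (r n) x) \<longlonglongrightarrow> g x"
      "\<And>K. compact K \<Longrightarrow> K \<subseteq> ball 0 1 \<Longrightarrow> uniform_limit K (f \<circ> r) g sequentially"
    show ?thesis
    proof (rule that[OF g(2,1)])
      show "(\<lambda>n. f (r n) u) \<longlonglongrightarrow> g u" if "cmod u < 1" for u
        by (rule g(3)) (use that in simp)
      show "uniform_limit (cball 0 \<rho>) (\<lambda>n. f (r n)) g sequentially" if "\<rho> < 1" for \<rho>
      proof -
        have "cball 0 \<rho> \<subseteq> ball (0::complex) 1" using that by auto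
        from g(4)[OF compact_cball this] show ?thesis unfolding o_def .
      qed
    qed
  qed (use ho bd in auto)
qed

text \<open>Locally uniform convergence becomes norm convergence after composition, because the
  image lies in a compact subdisk. The alternative \<open>e = 0\<close> covers operators that are
  purely of finite rank.\<close>

lemma compact_of_small_image:
  assumes p: "is_lfsm p" and xs: "finite_rank_ok xs"
    and TH: "\<And>f z. f \<in> dir_space \<Longrightarrow> cmod z < 1 \<Longrightarrow> T f z = e * f (lft p z) + finite_rank xs f z"
    and nt: "e = 0 \<or> (\<forall>\<eta>. cmod \<eta> = 1 \<longrightarrow> cmod (numer p \<eta>) \<noteq> cmod (denom p \<eta>))"
  shows "dir_compact T"
  unfolding dir_compact_def
proof (intro allI impI)
  fix f :: "nat \<Rightarrow> complex \<Rightarrow> complex"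
  assume "(\<forall>n. f n \<in> dir_space) \<and> (\<exists>B. \<forall>n. dnorm (f n) \<le> B)"
  then obtain B where f: "\<And>n. f n \<in> dir_space" "\<And>n. dnorm (f n) \<le> B" by blast
  obtain r g where r: "strict_mono (r :: nat \<Rightarrow> nat)" and g: "g holomorphic_on ball 0 1"
    and lim: "\<And>u. cmod u < 1 \<Longrightarrow> (\<lambda>n. f (r n) u) \<longlonglongrightarrow> g u"
    and ulim: "\<And>\<rho>. \<rho> < 1 \<Longrightarrow> uniform_limit (cball 0 \<rho>) (\<lambda>n. f (r n)) g sequentially"
    using bounded_subseq[where f = f and B = B, OF f] by blast
  let ?d = "\<lambda>n z. f (r n) z - g z"
  have main: "(\<lambda>z. e * g (lft p z)) \<in> dir_space \<and> (\<forall>n. (\<lambda>z. e * ?d n (lft p z)) \<in> dir_space) \<and>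
      (\<lambda>n. dnorm (\<lambda>z. e * ?d n (lft p z))) \<longlonglongrightarrow> 0"
  proof (cases "e = 0")
    case True
    then show ?thesis using dir_space_const[of 0] by (simp add: dnorm_zero)
  next
    case False
    obtain \<rho> where \<rho>: "0 \<le> \<rho>" "\<rho> < 1" "\<And>z. cmod z \<le> 1 \<Longrightarrow> cmod (lft p z) \<le> \<rho>"
      by (rule lfsm_inner_radius[OF p]) (use nt False in blast)+
    obtain \<rho>' where \<rho>': "\<rho> < \<rho>'" "\<rho>' < 1" using \<rho>(2) dense by blast
    obtain C where C: "0 \<le> C" "\<And>F S. F holomorphic_on ball 0 1 \<Longrightarrow> (\<And>u. cmod u \<le> \<rho>' \<Longrightarrow> cmod (F u) \<le> S) \<Longrightarrow>
        (\<lambda>z. F (lft p z)) \<in> dir_space \<and> dnorm (\<lambda>z. F (lft p z)) \<le> C * S"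
      by (rule comp_small[OF p \<rho>' \<rho>(3)]) (assumption | rule that; blast)+
    have gD: "(\<lambda>z. g (lft p z)) \<in> dir_space"
    proof -
      have "compact (g ` cball 0 \<rho>')"
        by (intro compact_continuous_image holomorphic_on_imp_continuous_on holomorphic_on_subset[OF g] compact_cball)
           (use \<rho>' in auto)
      then obtain S where "\<forall>x\<in>g ` cball 0 \<rho>'. cmod x \<le> S"
        using compact_imp_bounded bounded_iff by metis
      then show ?thesis using C(2)[OF g, of S] by auto
    qed
    have dD: "(\<lambda>z. ?d n (lft p z)) \<in> dir_space" for n
      by (rule dir_space_diff[OF dir_space_comp[OF f(1) p] gD])
    have dl: "(\<lambda>n. dnorm (\<lambda>z. ?d n (lft p z))) \<longlonglongrightarrow> 0"
    proof (rule LIMSEQ_I)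
      fix \<epsilon> :: real assume \<epsilon>: "0 < \<epsilon>"
      have "0 < \<epsilon> / (C + 1)" using \<epsilon> C(1) by simp
      from uniform_limitD[OF ulim[OF \<rho>'(2)] this]
      obtain N where N: "\<forall>n\<ge>N. \<forall>u\<in>cball 0 \<rho>'. cmod (?d n u) < \<epsilon> / (C + 1)"
        by (auto simp: eventually_sequentially dist_norm)
      have "norm (dnorm (\<lambda>z. ?d n (lft p z)) - 0) < \<epsilon>" if n: "n \<ge> N" for n
      proof -
        have "cmod (?d n u) \<le> \<epsilon> / (C + 1)" if "cmod u \<le> \<rho>'" for u
          using N n that by (intro less_imp_le) auto
        then have "dnorm (\<lambda>z. ?d n (lft p z)) \<le> C * (\<epsilon> / (C + 1))"
          using C(2)[of "?d n" "\<epsilon> / (C + 1)", OF holomorphic_on_diff[OF dir_space_holo[OF f(1)] g]] by blast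
        also have "\<dots> < \<epsilon>" using C(1) \<epsilon> by (simp add: field_simps)
        finally show ?thesis using dnorm_nonneg[OF dD] by simp
      qed
      then show "\<exists>N. \<forall>n\<ge>N. norm (dnorm (\<lambda>z. ?d n (lft p z)) - 0) < \<epsilon>" by blast
    qed
    have "(\<lambda>n. dnorm (\<lambda>z. e * ?d n (lft p z))) \<longlonglongrightarrow> cmod e * 0"
      unfolding dnorm_cmult[OF dD] by (intro tendsto_intros dl)
    then show ?thesis using dir_space_cmult[OF gD] dir_space_cmult[OF dD] by simp
  qed
  define h where "h z = e * g (lft p z) + finite_rank xs g z" for z
  have hD: "h \<in> dir_space" unfolding h_def using main by (intro dir_space_add finite_rank_dir_space xs) auto
  have "(\<lambda>n. dnorm (\<lambda>z. e * ?d n (lft p z) + finite_rank xs (?d n) z)) \<longlonglongrightarrow> 0"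
  proof (rule dnorm_add_tendsto_0)
    show "(\<lambda>n. dnorm (finite_rank xs (?d n))) \<longlonglongrightarrow> 0"
      by (rule finite_rank_tendsto_0[OF xs]) (use lim in \<open>auto intro: tendsto_eq_intros simp: LIM_zero_iff\<close>)
  qed (use main finite_rank_dir_space[OF xs] in auto)
  moreover have "dnorm (\<lambda>z. T (f (r n)) z - h z) = dnorm (\<lambda>z. e * ?d n (lft p z) + finite_rank xs (?d n) z)" for n
    by (rule dnorm_cong) (simp add: TH f(1) h_def finite_rank_diff algebra_simps)
  ultimately show "\<exists>r g. strict_mono r \<and> g \<in> dir_space \<and> (\<lambda>n. dnorm (\<lambda>z. T (f (r n)) z - g z)) \<longlonglongrightarrow> 0"
    using r hD by (intro exI[of _ r] exI[of _ h]) simp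
qed

section \<open>Fixed points and commutation\<close>

text \<open>Arranged such that the last term vanishes on the unit circle, where a trigonometric
  polynomial of degree at most 1 remains.\<close>

lemma norm_form:
  "(cmod (c*z + d))^2 - (cmod (a*z + b))^2 =
    ((cmod c)^2 + (cmod d)^2 - (cmod a)^2 - (cmod b)^2) + 2 * Re ((c * cnj d - a * cnj b) * z)
    + ((cmod c)^2 - (cmod a)^2) * ((cmod z)^2 - 1)"
  unfolding cmod_power2 by (simp add: power2_eq_square algebra_simps)

text \<open>On the circle |denom|^2 - |numer|^2 is the nonnegative function
  \<open>K + 2 * Re (M * z)\<close>. For nonzero \<open>M\<close> it has a single minimum there, so
  two zeros force M = K = 0; then the difference is \<delta> (1 - |z|^2) everywhere, and the inverse
  map preserves the disk.\<close>

lemma two_touch_points_aut: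
  assumes q: "is_lfsm q" and u: "cmod \<eta>1 = 1" "cmod \<eta>2 = 1" "\<eta>1 \<noteq> \<eta>2"
    and t: "cmod (numer q \<eta>1) = cmod (denom q \<eta>1)" "cmod (numer q \<eta>2) = cmod (denom q \<eta>2)"
  shows "is_disk_aut q"
proof -
  obtain a b c d where qe: "q = (a, b, c, d)" by (cases q)
  define K where "K = (cmod c)^2 + (cmod d)^2 - (cmod a)^2 - (cmod b)^2"
  define M where "M = c * cnj d - a * cnj b"
  define \<delta> where "\<delta> = (cmod a)^2 - (cmod c)^2"
  have N: "(cmod (c*z + d))^2 - (cmod (a*z + b))^2 = K + 2 * Re (M * z) + \<delta> * (1 - (cmod z)^2)" for z
    unfolding norm_form K_def M_def \<delta>_def by (simp add: algebra_simps)
  have ge: "0 \<le> K + 2 * Re (M * z)" if "cmod z = 1" for z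
  proof -
    have "(cmod (a*z + b))^2 \<le> (cmod (c*z + d))^2"
      using lfsm_le[OF q, of z] that by (intro power_mono) (auto simp: qe)
    then have "0 \<le> K + 2 * Re (M * z) + \<delta> * (1 - (cmod z)^2)" using N[of z] by linarith
    then show ?thesis unfolding that by (simp only: power_one diff_self mult_zero_right add_0_right)
  qed
  have eq: "K + 2 * Re (M * \<eta>1) = 0" "K + 2 * Re (M * \<eta>2) = 0"
    using N[of \<eta>1] N[of \<eta>2] t u by (simp_all add: qe)
  have M0: "M = 0"
  proof (rule ccontr)
    assume M: "M \<noteq> 0"
    \<comment> \<open>The point of the circle where \<open>Re (M * z)\<close> is smallest, so
      \<open>K\<close> is at least 2 |M|.\<close>
    define z where "z = - cnj M / of_real (cmod M)"
    have z: "cmod z = 1" using M by (simp add: z_def norm_divide)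
    have "M * cnj M = of_real ((cmod M)^2)" by (rule complex_norm_square[symmetric])
    then have "M * z = - of_real (cmod M)" using M by (simp add: z_def power2_eq_square)
    then have K: "2 * cmod M \<le> K" using ge[OF z] by simp
    have *: "M * \<eta> = - of_real (cmod M)" if "cmod \<eta> = 1" "K + 2 * Re (M * \<eta>) = 0" for \<eta>
    proof -
      have n: "cmod (M * \<eta>) = cmod M" using that by (simp add: norm_mult)
      have r: "Re (M * \<eta>) = - cmod M" using that K n abs_Re_le_cmod[of "M * \<eta>"] by linarith
      have "(Re (M * \<eta>))^2 + (Im (M * \<eta>))^2 = (cmod M)^2" using n cmod_power2[of "M * \<eta>"] by simp
      then have "Im (M * \<eta>) = 0" unfolding r by simp
      then show ?thesis using r by (simp add: complex_eq_iff)
    qed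
    have "M * \<eta>1 = M * \<eta>2" using *[OF u(1) eq(1)] *[OF u(2) eq(2)] by simp
    then show False using M u by simp
  qed
  then have K0: "K = 0" using eq by simp
  have N': "(cmod (c*z + d))^2 - (cmod (a*z + b))^2 = \<delta> * (1 - (cmod z)^2)" for z
    using N[of z] M0 K0 by simp
  have "(cmod b)^2 < (cmod d)^2"
    using lfsm_less[OF q, of 0] by (intro power_strict_mono) (auto simp: qe)
  then have \<delta>: "\<delta> > 0" using N'[of 0] by simp
  have "w \<in> lft q ` ball 0 1" if w: "w \<in> ball 0 1" for w
  proof -
    have ca: "cmod c < cmod a" using \<delta> power2_less_imp_less[of "cmod c" "cmod a"] by (simp add: \<delta>_def)
    have D: "a - c * w \<noteq> 0"
    proof
      assume "a - c * w = 0"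
      then have "cmod a = cmod c * cmod w" by (simp add: norm_mult)
      also have "\<dots> \<le> cmod c * 1" using w by (intro mult_left_mono) auto
      finally show False using ca by simp
    qed
    have det: "a * d - b * c \<noteq> 0" using lfsm_det[OF q] by (simp add: qe)
    define z where "z = (d * w - b) / (a - c * w)"
    have d1: "c * z + d = (a * d - b * c) / (a - c * w)"
      using D by (simp add: z_def field_simps)
    have n1: "a * z + b = w * (c * z + d)"
      unfolding d1 using D by (simp add: z_def field_simps)
    have d0: "c * z + d \<noteq> 0" unfolding d1 using D det by simp
    have "cmod (a * z + b) < cmod (c * z + d)"
      unfolding n1 norm_mult using w d0 by simp
    then have "(cmod (a * z + b))^2 < (cmod (c * z + d))^2" by (intro power_strict_mono) auto
    then have "0 < \<delta> * (1 - (cmod z)^2)" using N'[of z] by simp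
    then have "(cmod z)^2 < 1" using \<delta> by (simp add: zero_less_mult_iff)
    then have "z \<in> ball 0 1" by (simp add: abs_square_less_1)
    moreover have "lft q z = w" using n1 d0 by (simp add: lft_eq qe)
    ultimately show ?thesis by blast
  qed
  then show ?thesis using lfsm_ball_image[OF q] by (auto simp: is_disk_aut_def)
qed

lemma touch_iff: "is_lfsm q \<Longrightarrow> cmod \<eta> \<le> 1 \<Longrightarrow> cmod (lft q \<eta>) = 1 \<longleftrightarrow> cmod (numer q \<eta>) = cmod (denom q \<eta>)"
  using lfsm_denom_nz[of q \<eta>] by (auto simp: lft_eq norm_divide)

definition touches_once :: "coeffs \<Rightarrow> bool" where
  "touches_once q \<longleftrightarrow> (\<forall>\<eta>1 \<eta>2. cmod \<eta>1 = 1 \<longrightarrow> cmod \<eta>2 = 1 \<longrightarrow>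
     cmod (lft q \<eta>1) = 1 \<longrightarrow> cmod (lft q \<eta>2) = 1 \<longrightarrow> \<eta>1 = \<eta>2)"

lemma touches_once_nonaut: "is_lfsm q \<Longrightarrow> \<not> is_disk_aut q \<Longrightarrow> touches_once q"
  unfolding touches_once_def using two_touch_points_aut[of q] touch_iff[of q] by (metis order_refl)

text \<open>The Krein adjoint is the inverse of \<open>q\<close> conjugated by reflection in the
  circle. Reflection fixes the circle, so \<open>q\<close> undoes \<open>kadj q\<close> wherever the
  latter maps a point of the circle to the circle.\<close>

lemma lft_kadj_boundary:
  assumes q: "is_lfsm q" and u: "cmod \<eta> = 1" and t: "cmod (lft (kadj q) \<eta>) = 1"
  shows "lft q (lft (kadj q) \<eta>) = \<eta>"
proof -
  let ?w = "lft (kadj q) \<eta>"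
  have D: "denom (kadj q) \<eta> \<noteq> 0" using lfsm_denom_nz[OF lfsm_kadj[OF q], of \<eta>] u by simp
  have n: "numer (kadj q) \<eta> = ?w * denom (kadj q) \<eta>" using D by (simp add: lft_eq)
  have ww: "cnj ?w * ?w = 1" using t by (metis complex_norm_square mult.commute of_real_1 one_power2)
  have "denom (kadj q) \<eta> - cnj ?w * numer (kadj q) \<eta> = 0"
    unfolding n using ww by (simp flip: mult.assoc)
  then have e: "denom q ?w = cnj \<eta> * numer q ?w" unfolding kadj_form complex_cnj_zero_iff by simp
  have "\<eta> * cnj \<eta> = 1" using u by (metis complex_norm_square of_real_1 one_power2)
  then have "numer q ?w = \<eta> * denom q ?w" unfolding e by (simp flip: mult.assoc)
  then show ?thesis using lfsm_denom_nz[OF q, of ?w] t by (simp add: lft_eq)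
qed

lemma touches_once_kadj:
  assumes q: "is_lfsm q" "\<not> is_disk_aut q"
  shows "touches_once (kadj q)"
  unfolding touches_once_def
proof (intro allI impI)
  fix \<eta>1 \<eta>2 assume u: "cmod \<eta>1 = 1" "cmod \<eta>2 = 1" "cmod (lft (kadj q) \<eta>1) = 1" "cmod (lft (kadj q) \<eta>2) = 1"
  have e: "lft q (lft (kadj q) \<eta>1) = \<eta>1" "lft q (lft (kadj q) \<eta>2) = \<eta>2"
    using lft_kadj_boundary[OF q(1)] u by auto
  then have "lft (kadj q) \<eta>1 = lft (kadj q) \<eta>2"
    using touches_once_nonaut[OF q] u unfolding touches_once_def by metis
  then show "\<eta>1 = \<eta>2" using e by metis
qed

text \<open>Up to a factor, the coefficients of the identity map.\<close>

fun scalar :: "coeffs \<Rightarrow> bool" where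
  "scalar (a, b, c, d) \<longleftrightarrow> b = 0 \<and> c = 0 \<and> a = d"

text \<open>Proportionality of the coefficient vectors \<open>(c, d - a, b)\<close> of the fixed point equations.\<close>

fun parallel :: "coeffs \<Rightarrow> coeffs \<Rightarrow> bool" where
  "parallel (a, b, c, d) (a', b', c', d') \<longleftrightarrow>
     b * c' = b' * c \<and> b * (d' - a') = b' * (d - a) \<and> c * (d' - a') = c' * (d - a)"

text \<open>The commutator of two 2 x 2 matrices depends only on their traceless parts; up to sign
  its entries are the components of the cross product of the vectors (c, d - a, b).\<close>

lemma commute_iff_parallel: "mcomp p q = mcomp q p \<longleftrightarrow> parallel p q"
  by (cases p; cases q) (auto simp: algebra_simps)

lemma Some_fixset_iff: "Some z \<in> fixset q \<longleftrightarrow> numer q z = z * denom q z"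
  by (cases q) (auto simp: fixset_def power2_eq_square algebra_simps)

lemma Some_fixset_lft: "is_lfsm q \<Longrightarrow> cmod z \<le> 1 \<Longrightarrow> Some z \<in> fixset q \<longleftrightarrow> lft q z = z"
  using lfsm_denom_nz[of q z] by (auto simp: Some_fixset_iff lft_eq nonzero_divide_eq_eq)

text \<open>The fixed point polynomial is split by its known root \<zeta>. For c = 0 the second
  fixed point is infinity; otherwise it is the root \<open>x\<close>, and \<open>x = \<zeta>\<close>
  is the case of a single fixed point.\<close>

lemma fixset_form:
  assumes q: "\<not> scalar q" and z: "Some \<zeta> \<in> fixset q"
  shows "(case q of (a, b, c, d) \<Rightarrow> c = 0 \<and> d \<noteq> a \<and> b = (d - a) * \<zeta> \<and> fixset q = {Some \<zeta>, None} \<or>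
     (\<exists>x. c \<noteq> 0 \<and> d - a = - c * (\<zeta> + x) \<and> b = - c * \<zeta> * x \<and> fixset q = {Some \<zeta>, Some x}))"
proof -
  obtain a b c d where qe: "q = (a, b, c, d)" by (cases q)
  have root: "c * \<zeta>^2 + (d - a) * \<zeta> - b = 0" using z by (auto simp: fixset_def qe split: if_splits)
  show ?thesis
  proof (cases "c = 0")
    case True
    then have b: "b = (d - a) * \<zeta>" using root by simp
    then have da: "d \<noteq> a" using q True by (auto simp: qe)
    have S: "{Some z |z. c * z^2 + (d - a) * z - b = 0} = {Some \<zeta>}"
      using True b da by (auto simp flip: right_diff_distrib)
    have "fixset q = {Some \<zeta>, None}" unfolding qe fixset_def prod.case S using True by auto
    then show ?thesis using True b da by (simp add: qe)
  next
    case False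
    define x where "x = (a - d) / c - \<zeta>"
    have da: "d - a = - c * (\<zeta> + x)" using False by (simp add: x_def field_simps)
    have b: "b = - c * \<zeta> * x" using root unfolding da by (simp add: power2_eq_square algebra_simps)
    have "c * z^2 + (d - a) * z - b = c * ((z - \<zeta>) * (z - x))" for z
      unfolding da b by (simp add: power2_eq_square algebra_simps)
    then have S: "{Some z |z. c * z^2 + (d - a) * z - b = 0} = {Some \<zeta>, Some x}"
      using False by auto
    have "fixset q = {Some \<zeta>, Some x}" unfolding qe fixset_def prod.case S using False by simp
    then show ?thesis unfolding qe prod.case using False da b by blast
  qed
qed

lemma fixset_cases:
  assumes q: "\<not> scalar q" and z: "Some \<zeta> \<in> fixset q"
  obtains "fixset q = {Some \<zeta>}" | w where "w \<noteq> Some \<zeta>" "fixset q = {Some \<zeta>, w}"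
proof -
  obtain w where w: "fixset q = {Some \<zeta>, w}"
    using fixset_form[OF q z] by (cases q) auto
  show ?thesis
    by (cases "w = Some \<zeta>") (use that w in auto)
qed

lemma scalar_fixset: "scalar q \<Longrightarrow> fixset q = UNIV"
  by (cases q) (auto simp: fixset_def; metis option.exhaust)

lemma fixset_nonscalar: "fixset q = {x, y} \<Longrightarrow> \<not> scalar q"
proof
  assume "fixset q = {x, y}" "scalar q"
  then have "finite (UNIV :: complex option set)" using scalar_fixset by (metis finite.emptyI finite_insert)
  then show False using infinite_UNIV_char_0[where 'a = complex] finite_option_UNIV by metis
qed

text \<open>The roots of the fixed point equation determine (c, d - a, b) up to a factor, with
  infinity as a root for c = 0.\<close>

lemma fixset_eq_imp_parallel:
  assumes "\<not> scalar p" "\<not> scalar q" "Some \<zeta> \<in> fixset p" "fixset q = fixset p"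
  shows "parallel p q"
proof -
  obtain a b c d where p: "p = (a, b, c, d)" by (cases p)
  obtain a' b' c' d' where q: "q = (a', b', c', d')" by (cases q)
  have P: "c = 0 \<and> d \<noteq> a \<and> b = (d - a) * \<zeta> \<and> fixset p = {Some \<zeta>, None} \<or>
     (\<exists>x. c \<noteq> 0 \<and> d - a = - c * (\<zeta> + x) \<and> b = - c * \<zeta> * x \<and> fixset p = {Some \<zeta>, Some x})"
    using fixset_form[OF assms(1,3)] by (simp add: p)
  have "Some \<zeta> \<in> fixset q" using assms(3,4) by simp
  from fixset_form[OF assms(2) this]
  have Q: "c' = 0 \<and> d' \<noteq> a' \<and> b' = (d' - a') * \<zeta> \<and> fixset q = {Some \<zeta>, None} \<or>
     (\<exists>x. c' \<noteq> 0 \<and> d' - a' = - c' * (\<zeta> + x) \<and> b' = - c' * \<zeta> * x \<and> fixset q = {Some \<zeta>, Some x})"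
    by (simp add: q)
  from P show ?thesis
  proof (elim disjE conjE exE)
    assume *: "c = 0" "b = (d - a) * \<zeta>" "fixset p = {Some \<zeta>, None}"
    then have "None \<in> fixset q" using assms(4) by simp
    with Q have "c' = 0" "b' = (d' - a') * \<zeta>" by auto
    with * show ?thesis by (simp add: p q)
  next
    fix x assume *: "c \<noteq> 0" "d - a = - c * (\<zeta> + x)" "b = - c * \<zeta> * x" "fixset p = {Some \<zeta>, Some x}"
    then have "None \<notin> fixset q" using assms(4) by simp
    with Q obtain y where y: "d' - a' = - c' * (\<zeta> + y)" "b' = - c' * \<zeta> * y" "fixset q = {Some \<zeta>, Some y}"
      by auto
    \<comment> \<open>This includes a double root: if x = \<zeta>, the set is a singleton and y =
      \<zeta> as well.\<close>
    have "x = y" using *(4) y(3) assms(4) by (auto simp: doubleton_eq_iff)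
    then show ?thesis unfolding p q parallel.simps y(1,2) *(2,3) by (simp add: algebra_simps)
  qed
qed

lemma parallel_imp_fixset_eq:
  assumes "\<not> scalar p" "\<not> scalar q" "parallel p q"
  shows "fixset q = fixset p"
proof -
  obtain a b c d where p: "p = (a, b, c, d)" by (cases p)
  obtain a' b' c' d' where q: "q = (a', b', c', d')" by (cases q)
  have par: "b * c' = b' * c" "b * (d' - a') = b' * (d - a)" "c * (d' - a') = c' * (d - a)"
    using assms(3) by (auto simp: p q)
  \<comment> \<open>A vanishing cross product makes the vectors proportional; the factor is read off
    at a nonzero entry, which exists as \<open>p\<close> is not scalar.\<close>
  obtain t where t: "c' = t * c" "d' - a' = t * (d - a)" "b' = t * b"
  proof (cases "c = 0")
    case False
    show ?thesis by (rule that[of "c' / c"]) (use False par in \<open>auto simp: field_simps\<close>)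
  next
    case c: True
    show ?thesis
    proof (cases "b = 0")
      case False
      show ?thesis by (rule that[of "b' / b"]) (use False par in \<open>auto simp: field_simps\<close>)
    next
      case True
      then have "d - a \<noteq> 0" using assms(1) c by (auto simp: p)
      then show ?thesis by (intro that[of "(d' - a') / (d - a)"]) (use True c par in \<open>auto simp: field_simps\<close>)
    qed
  qed
  have "t \<noteq> 0" using assms(2) t by (auto simp: q)
  have "c' * z^2 + (d' - a') * z - b' = t * (c * z^2 + (d - a) * z - b)" for z
    unfolding t by (simp add: algebra_simps)
  then have iff: "c' * z^2 + (d' - a') * z - b' = 0 \<longleftrightarrow> c * z^2 + (d - a) * z - b = 0" for z
    using \<open>t \<noteq> 0\<close> by (metis mult_eq_0_iff)
  have iff0: "c' = 0 \<longleftrightarrow> c = 0" using t(1) \<open>t \<noteq> 0\<close> by simp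
  show ?thesis unfolding p q fixset_def prod.case iff iff0 ..
qed

lemma circ_refl_circ_refl: "circ_refl (circ_refl w) = w"
  by (auto simp: circ_refl_def split: option.splits)

lemma circ_refl_unit: "cmod \<zeta> = 1 \<Longrightarrow> circ_refl (Some \<zeta>) = Some \<zeta>"
proof -
  assume u: "cmod \<zeta> = 1"
  then have "\<zeta> * cnj \<zeta> = 1" by (metis complex_norm_square of_real_1 one_power2)
  moreover have "\<zeta> \<noteq> 0" using u by auto
  ultimately show ?thesis by (simp add: circ_refl_def field_simps)
qed

text \<open>Conjugating an inverse map by reflection reflects its fixed points. In terms of
  equations, multiplication by \<open>(cnj z)^2\<close> reverses the order of the coefficients; 0
  and infinity are treated apart.\<close>

lemma fixset_kadj: "fixset (kadj q) = circ_refl ` fixset q"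
proof -
  obtain a b c d where q: "q = (a, b, c, d)" by (cases q)
  have mem: "w \<in> fixset (kadj q) \<longleftrightarrow> circ_refl w \<in> fixset q" for w
  proof (cases w)
    case None
    then show ?thesis by (auto simp: circ_refl_def q fixset_def)
  next
    case (Some z)
    show ?thesis
    proof (cases "z = 0")
      case True
      then show ?thesis using Some by (auto simp: circ_refl_def q fixset_def)
    next
      case False
      have "Some z \<in> fixset (kadj q) \<longleftrightarrow> cnj (- cnj b * z^2 + (cnj d - cnj a) * z - (- cnj c)) = 0"
        by (simp only: complex_cnj_zero_iff) (auto simp: q fixset_def eq_neg_iff_add_eq_0)
      also have "cnj (- cnj b * z^2 + (cnj d - cnj a) * z - (- cnj c)) =
          (cnj z)^2 * (c * (1 / cnj z)^2 + (d - a) * (1 / cnj z) - b)"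
        using False by (simp add: field_simps power2_eq_square)
      also have "\<dots> = 0 \<longleftrightarrow> Some (1 / cnj z) \<in> fixset q"
        using False by (simp add: q fixset_def)
      finally show ?thesis using Some False by (simp add: circ_refl_def)
    qed
  qed
  show ?thesis
    using mem circ_refl_circ_refl by (auto simp: image_iff) metis
qed

lemma denom_cscale: "denom (cscale k p) z = k * denom p z"
  by (cases p) (simp add: algebra_simps)

lemma numer_cscale: "numer (cscale k p) z = k * numer p z"
  by (cases p) (simp add: algebra_simps)

lemma cdet_cscale: "cdet (cscale k p) = k^2 * cdet p"
  by (cases p) (simp add: power2_eq_square algebra_simps)

lemma lft_cscale: "k \<noteq> 0 \<Longrightarrow> lft (cscale k p) z = lft p z"
  by (simp add: lft_eq denom_cscale numer_cscale)

text \<open>The map \<open>Q\<close> takes both \<eta> and \<open>lft P \<eta>\<close> to the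
  circle; touching at most once, it forces \<open>P\<close> to fix \<eta>, and then \<open>P\<close>
  also fixes the value \<omega> of \<open>Q\<close> at \<eta>. If \<eta> and \<omega> differ,
  \<open>k\<close> turns out to be real and positive with square 1, which makes \<open>P\<close> the
  identity.\<close>

lemma common_fixed_point:
  assumes P: "is_lfsm P" "\<not> scalar P" and Q: "is_lfsm Q" "touches_once Q"
    and k: "k \<noteq> 0" "mcomp Q P = cscale k (mcomp P Q)"
    and u: "cmod \<eta> = 1" and t: "cmod (lft (mcomp P Q) \<eta>) = 1"
  obtains \<zeta> where "cmod \<zeta> = 1" "lft P \<zeta> = \<zeta>" "lft Q \<zeta> = \<zeta>"
proof -
  define \<omega> where "\<omega> = lft (mcomp P Q) \<eta>"
  have w: "cmod \<omega> = 1" using t by (simp add: \<omega>_def)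
  have PQ: "lft P (lft Q \<eta>) = \<omega>" using lft_mcomp[OF Q(1), of \<eta> P] u by (simp add: \<omega>_def)
  have QP: "lft Q (lft P \<eta>) = \<omega>"
    using lft_mcomp[OF P(1), of \<eta> Q] u lft_cscale[OF k(1), of "mcomp P Q" \<eta>] by (simp add: \<omega>_def k(2))
  have n1: "cmod (lft Q \<eta>) = 1"
    using lfsm_lft_le[OF Q(1), of \<eta>] lfsm_lft_less[OF P(1), of "lft Q \<eta>"] PQ w u by fastforce
  have n2: "cmod (lft P \<eta>) = 1"
    using lfsm_lft_le[OF P(1), of \<eta>] lfsm_lft_less[OF Q(1), of "lft P \<eta>"] QP w u by fastforce
  have Pe: "lft P \<eta> = \<eta>"
    using Q(2) u n1 n2 QP w unfolding touches_once_def by metis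
  then have Qe: "lft Q \<eta> = \<omega>" using QP by simp
  then have Pw: "lft P \<omega> = \<omega>" using PQ by simp
  show ?thesis
  proof (cases "\<eta> = \<omega>")
    case True
    then show ?thesis using that[OF u Pe] Qe by simp
  next
    case False
    obtain a b c d where Pd: "P = (a, b, c, d)" by (cases P)
    \<comment> \<open>The eigenvalues of the matrix \<open>P\<close> on (\<eta>, 1) and (\<omega>,
      1); for distinct eigenvectors of this form their sum is the trace.\<close>
    define e1 e2 where "e1 = denom P \<eta>" and "e2 = denom P \<omega>"
    have r1: "a * \<eta> + b = \<eta> * e1" and r2: "a * \<omega> + b = \<omega> * e2"
      using Some_fixset_lft[OF P(1), of \<eta>] Some_fixset_lft[OF P(1), of \<omega>] Pe Pw u w
      by (auto simp: Some_fixset_iff e1_def e2_def Pd)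
    have e: "e1 = c * \<eta> + d" "e2 = c * \<omega> + d" by (simp_all add: e1_def e2_def Pd)
    have "(\<eta> - \<omega>) * (e1 + e2 - (a + d)) = 0" using r1 r2 e by algebra
    then have tr: "e1 + e2 = a + d" using False by simp
    have e20: "e2 \<noteq> 0" using lfsm_denom_nz[OF P(1), of \<omega>] w by (simp add: e2_def)
    have uu: "cnj \<eta> * \<eta> = 1" using u by (metis complex_norm_square mult.commute of_real_1 one_power2)
    have "numer P \<eta> = \<eta> * denom P \<eta>" using r1 by (simp add: Pd e)
    \<comment> \<open>Contact at a fixed point supplies the positivity that rules out k = -1: the
      ratio of the two eigenvalues is the positive number \<open>l\<close>.\<close>
    from hp_touch[OF P(1) u u this]
    obtain l :: real where l: "0 < l" "e1 = of_real l * (d - cnj \<eta> * b)"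
      unfolding e1_def Pd by auto
    have "d - cnj \<eta> * b = e2"
    proof -
      have "cnj \<eta> * b = (cnj \<eta> * \<eta>) * (e1 - a)" using r1 by algebra
      then have "cnj \<eta> * b = e1 - a" unfolding uu by simp
      then show ?thesis using tr by algebra
    qed
    then have l2: "e1 = of_real l * e2" using l by simp
    define m where "m = denom Q \<eta>"
    have m0: "m \<noteq> 0" using lfsm_denom_nz[OF Q(1), of \<eta>] u by (simp add: m_def)
    have "denom (mcomp Q P) \<eta> = e1 * m"
      using denom_mcomp[of P \<eta> Q] lfsm_denom_nz[OF P(1), of \<eta>] u by (simp add: Pe e1_def m_def)
    moreover have "denom (mcomp P Q) \<eta> = m * e2"
      using denom_mcomp[of Q \<eta> P] m0 by (simp add: Qe e2_def m_def)
    moreover have "denom (mcomp Q P) \<eta> = k * denom (mcomp P Q) \<eta>" unfolding k(2) denom_cscale ..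
    ultimately have "e1 * m = k * (m * e2)" by metis
    then have "of_real l * e2 * m = k * e2 * m" using l2 by (simp add: mult_ac)
    then have kl: "k = of_real l" using m0 e20 by simp
    have "cdet (mcomp Q P) = k^2 * cdet (mcomp P Q)" unfolding k(2) cdet_cscale ..
    then have "k^2 = 1" using lfsm_det[OF P(1)] lfsm_det[OF Q(1)] by (simp add: cdet_mcomp)
    then have "l^2 = 1" unfolding kl by (metis of_real_eq_1_iff of_real_power)
    then have "l = 1" using l(1) by (simp add: power2_eq_1_iff)
    then have "e1 = e2" using l2 by simp
    then have c0: "c = 0" using e False by simp
    then have "a = d" using tr e by simp
    moreover have "b = 0" using r1 e c0 \<open>a = d\<close> by (simp add: mult.commute)
    ultimately show ?thesis using P(2) c0 by (simp add: Pd)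
  qed
qed

section \<open>The commutator\<close>

lemma dkernel_inj:
  assumes "cmod w < 1" "w \<noteq> 0" "cmod x < 1" "cmod y < 1" "dkernel w x = dkernel w y"
  shows "x = y"
proof -
  have "exp (ln (1 - cnj w * x)) = exp (ln (1 - cnj w * y))" using assms(5) by (simp add: dkernel_def)
  then have "1 - cnj w * x = 1 - cnj w * y"
    using one_minus_nz[OF assms(3) less_imp_le[OF assms(1)]] one_minus_nz[OF assms(4) less_imp_le[OF assms(1)]]
    by simp
  then show ?thesis using assms(2) by simp
qed

lemma lft_id_scalar:
  assumes p: "is_lfsm p" and id: "\<And>z. cmod z < 1 \<Longrightarrow> lft p z = z"
  shows "scalar p"
proof -
  have z: "Some z \<in> fixset p" if "cmod z < 1" for z
    using Some_fixset_lft[OF p, of z] id[of z] that by simp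
  show ?thesis
  proof (rule ccontr)
    assume ns: "\<not> scalar p"
    \<comment> \<open>Three fixed points, while a non-scalar matrix has at most two.\<close>
    have "Some (0::complex) \<in> fixset p" "Some (1/2::complex) \<in> fixset p" "Some (-1/2::complex) \<in> fixset p"
      by (auto intro!: z)
    with fixset_cases[OF ns z[of 0]] show False
      by (smt (verit) insertE norm_zero option.inject singletonD zero_less_one divide_eq_0_iff
          one_neq_zero zero_neq_numeral divide_cancel_right one_neq_neg_one neg_equal_0_iff_equal)
  qed
qed

lemma scalar_lft: "is_lfsm p \<Longrightarrow> scalar p \<Longrightarrow> lft p z = z"
  by (cases p) (auto simp: lft_def is_lfsm_def)

lemma scalar_kadj: "scalar (kadj q) \<longleftrightarrow> scalar q"
  by (cases q) auto

text \<open>This list and the next two hold what \<open>lft_adjoint\<close> adds to the compositions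
  in the two products and in their difference. They are kept explicit because the nonvanishing of
  the commutator depends on them.\<close>

definition ker_pq :: "coeffs \<Rightarrow> coeffs \<Rightarrow> (complex \<times> (complex \<Rightarrow> complex)) list" where
  "ker_pq p q = [(lft p 0, dkernel (lft q 0)), (lft p (lft (kadj q) 0), \<lambda>z. -1)]"

definition ker_qp :: "coeffs \<Rightarrow> coeffs \<Rightarrow> (complex \<times> (complex \<Rightarrow> complex)) list" where
  "ker_qp p q = [(0, \<lambda>z. dkernel (lft q 0) (lft p z)), (lft (kadj q) 0, \<lambda>z. -1)]"

definition ker_comm :: "coeffs \<Rightarrow> coeffs \<Rightarrow> (complex \<times> (complex \<Rightarrow> complex)) list" where
  "ker_comm p q = [(lft p 0, dkernel (lft q 0)), (lft p (lft (kadj q) 0), \<lambda>z. -1),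
    (0, \<lambda>z. -1 * dkernel (lft q 0) (lft p z)), (lft (kadj q) 0, \<lambda>z. 1)]"

context
  fixes p q :: coeffs
  assumes p: "is_lfsm p" and q: "is_lfsm q"
begin

abbreviation "adj_q \<equiv> dir_adjoint (comp_op (lft q))"
abbreviation "comp_p \<equiv> comp_op (lft p)"
abbreviation "sig \<equiv> kadj q"

lemmas sig = lfsm_kadj[OF q]

lemma points: "cmod (lft p 0) < 1" "cmod (lft q 0) < 1" "cmod (lft sig 0) < 1" "cmod (lft p (lft sig 0)) < 1"
  using lfsm_lft_less[OF p] lfsm_lft_less[OF q] lfsm_lft_less[OF sig] by auto

lemma ker_ok: "finite_rank_ok (ker_pq p q)" "finite_rank_ok (ker_qp p q)" "finite_rank_ok (ker_comm p q)"
proof -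
  note D = dir_space_dkernel[OF points(2)]
  note D2 = dir_space_comp[OF D p]
  show "finite_rank_ok (ker_pq p q)" "finite_rank_ok (ker_qp p q)" "finite_rank_ok (ker_comm p q)"
    unfolding finite_rank_ok_def ker_pq_def ker_qp_def ker_comm_def
    using points D D2 dir_space_cmult[OF D2, of "-1"] by (auto simp: dir_space_const)
qed

lemma adj_q:
  assumes "f \<in> dir_space"
  shows "adj_q f \<in> dir_space" "cmod z < 1 \<Longrightarrow> adj_q f z = lft_adjoint q f z"
  using dir_adjoint_comp[OF q assms] by auto

lemma comp_p: "f \<in> dir_space \<Longrightarrow> comp_p f \<in> dir_space"
  unfolding comp_op_def o_def by (rule dir_space_comp[OF _ p])

lemma adj_comp_eq:
  assumes f: "f \<in> dir_space" and z: "cmod z < 1"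
  shows "(adj_q \<circ> comp_p) f z = f (lft (mcomp p sig) z) + finite_rank (ker_pq p q) f z"
  using adj_q(2)[OF comp_p[OF f] z] z lft_mcomp[OF sig, of z p]
  by (simp add: lft_adjoint_def comp_op_def ker_pq_def finite_rank_def)

lemma comp_adj_eq:
  assumes f: "f \<in> dir_space" and z: "cmod z < 1"
  shows "(comp_p \<circ> adj_q) f z = f (lft (mcomp sig p) z) + finite_rank (ker_qp p q) f z"
  using adj_q(2)[OF f lfsm_lft_less[OF p z]] z lft_mcomp[OF p, of z sig]
  by (simp add: lft_adjoint_def comp_op_def ker_qp_def finite_rank_def)

lemma comm_eq:
  assumes f: "f \<in> dir_space" and z: "cmod z < 1"
  shows "commutator adj_q comp_p f z =
    (f (lft (mcomp p sig) z) - 1 * f (lft (mcomp sig p) z)) + finite_rank (ker_comm p q) f z"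
  using adj_comp_eq[OF f z] comp_adj_eq[OF f z]
  by (simp add: commutator_def ker_pq_def ker_qp_def ker_comm_def finite_rank_def)

lemma comm_dir_space: "f \<in> dir_space \<Longrightarrow> commutator adj_q comp_p f \<in> dir_space"
  unfolding commutator_def by (intro dir_space_diff adj_q(1) comp_p)

lemma compact_adj_comp:
  assumes "\<And>\<eta>. cmod \<eta> = 1 \<Longrightarrow> cmod (lft (mcomp p sig) \<eta>) \<noteq> 1"
  shows "dir_compact (adj_q \<circ> comp_p)"
proof (rule compact_of_small_image[where e = 1 and p = "mcomp p sig", OF lfsm_mcomp[OF p sig] ker_ok(1)])
  show "(adj_q \<circ> comp_p) f z = 1 * f (lft (mcomp p sig) z) + finite_rank (ker_pq p q) f z"
    if "f \<in> dir_space" "cmod z < 1" for f z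
    using adj_comp_eq[OF that] by simp
  show "1 = (0::complex) \<or> (\<forall>\<eta>. cmod \<eta> = 1 \<longrightarrow> cmod (numer (mcomp p sig) \<eta>) \<noteq> cmod (denom (mcomp p sig) \<eta>))"
    using assms touch_iff[OF lfsm_mcomp[OF p sig]] by simp
qed

lemma touch_point:
  assumes P: "is_lfsm P" and u: "cmod \<eta> = 1"
  shows "numer P \<eta> = lft P \<eta> * denom P \<eta>"
  using lfsm_denom_nz[OF P, of \<eta>] u by (simp add: lft_eq)

lemma not_compact_adj_comp:
  assumes u: "cmod \<eta> = 1" "cmod (lft (mcomp p sig) \<eta>) = 1"
  shows "\<not> dir_compact (adj_q \<circ> comp_p)"
proof
  assume c: "dir_compact (adj_q \<circ> comp_p)"
  note P = lfsm_mcomp[OF p sig]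
  \<comment> \<open>Instantiated at \<open>e = 0\<close>, the conclusion \<open>e \<noteq> 0\<close>
    is the contradiction.\<close>
  have "(0::complex) \<noteq> 0"
    by (rule compact_touch_nonzero[where T = "adj_q \<circ> comp_p" and e = 0, OF P P c ker_ok(1) _ u touch_point[OF P u(1)]])
       (use adj_comp_eq in simp)
  then show False by simp
qed

lemma not_compact_comp_adj:
  assumes u: "cmod \<eta> = 1" "cmod (lft (mcomp sig p) \<eta>) = 1"
  shows "\<not> dir_compact (comp_p \<circ> adj_q)"
proof
  assume c: "dir_compact (comp_p \<circ> adj_q)"
  note P = lfsm_mcomp[OF sig p]
  have "(0::complex) \<noteq> 0"
    by (rule compact_touch_nonzero[where T = "comp_p \<circ> adj_q" and e = 0, OF P P c ker_ok(2) _ u touch_point[OF P u(1)]])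
       (use comp_adj_eq in simp)
  then show False by simp
qed

lemma compact_comm_imp_commute:
  assumes c: "dir_compact (commutator adj_q comp_p)"
    and u: "cmod \<eta> = 1" "cmod (lft (mcomp p sig) \<eta>) = 1"
  obtains k where "k \<noteq> 0" "mcomp sig p = cscale k (mcomp p sig)"
proof -
  note P = lfsm_mcomp[OF p sig] and Q = lfsm_mcomp[OF sig p]
  show ?thesis
    by (rule compact_touch_eq[where T = "commutator adj_q comp_p" and e = 1,
          OF P Q c ker_ok(3) _ u touch_point[OF P u(1)] refl])
       (use comm_eq that in auto)
qed

lemma commute_imp_compact_comm:
  assumes "mcomp p sig = mcomp sig p"
  shows "dir_compact (commutator adj_q comp_p)"
proof (rule compact_of_small_image[where e = 0 and p = p, OF p ker_ok(3)])
  show "commutator adj_q comp_p f z = 0 * f (lft p z) + finite_rank (ker_comm p q) f z"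
    if "f \<in> dir_space" "cmod z < 1" for f z
    using comm_eq[OF that] assms by simp
qed simp

text \<open>If \<open>q\<close> is the identity, so is its Krein adjoint, and the kernel at 0 is the
  constant 1; the adjoint operator is then the identity inside the disk. Thus a nonzero commutator
  excludes identity maps.\<close>

lemma comm_zero_of_scalar:
  assumes "scalar p \<or> scalar q" and f: "f \<in> dir_space"
  shows "dnorm (commutator adj_q comp_p f) = 0"
proof -
  have "commutator adj_q comp_p f z = 0" if z: "z \<in> ball 0 1" for z
  proof (cases "scalar p")
    case True
    then have "lft p z = z" for z by (rule scalar_lft[OF p])
    then show ?thesis by (simp add: commutator_def comp_op_def o_def)
  next
    case False
    then have s: "lft q z = z" "lft sig z = z" for z
      using assms scalar_lft[OF q] scalar_lft[OF sig] by (auto simp: scalar_kadj)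
    have "adj_q g x = g x" if "g \<in> dir_space" "cmod x < 1" for g x
      using adj_q(2)[OF that] s by (simp add: lft_adjoint_def dkernel_def)
    then show ?thesis
      using z f comp_p[OF f] lfsm_lft_less[OF p, of z]
      by (simp add: commutator_def comp_op_def)
  qed
  from dnorm_cong[of "commutator adj_q comp_p f" "\<lambda>z. 0", OF this] show ?thesis by (simp add: dnorm_zero)
qed

text \<open>With commuting matrices the compositions cancel, and four evaluations times functions
  are left, which are tested on 1, z and z^2. Their vanishing would make a map the identity, make a
  nonconstant kernel constant, or produce too many fixed points.\<close>

lemma comm_nonzero:
  assumes comm: "mcomp p sig = mcomp sig p" and ns: "\<not> scalar p" "\<not> scalar q"
    and u: "cmod \<zeta> = 1" "Some \<zeta> \<in> fixset p" "Some \<zeta> \<in> fixset sig"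
  shows "dir_nonzero (commutator adj_q comp_p)"
proof (rule ccontr)
  assume no: "\<not> dir_nonzero (commutator adj_q comp_p)"
  let ?K = "dkernel (lft q 0)" and ?s = "lft sig 0"
  have R: "f (lft p 0) * ?K z - f (lft p ?s) - f 0 * ?K (lft p z) + f ?s = 0"
    if f: "f \<in> dir_space" and z: "cmod z < 1" for f z
  proof -
    have "dnorm (commutator adj_q comp_p f) = 0" using no f by (simp add: dir_nonzero_def)
    then have "commutator adj_q comp_p f z = 0" using value_bound[OF comm_dir_space[OF f] z] by simp
    then show ?thesis using comm_eq[OF f z] comm by (simp add: ker_comm_def finite_rank_def algebra_simps)
  qed
  have id: "(\<lambda>z. z) \<in> dir_space" using dir_space_power[of 1] by simp
  show False
  \<comment> \<open>The kernel at \<open>lft q 0\<close> is constant if \<open>lft q 0 = 0\<close>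
    and injective on the disk otherwise.\<close>
  proof (cases "lft q 0 = 0")
    case False
    show False
    proof (cases "lft p 0 = 0")
      case True
      have "lft p z = z" if z: "cmod z < 1" for z
        using R[OF dir_space_const[of 1] z] dkernel_inj[OF points(2) False z lfsm_lft_less[OF p z]] by simp
      then show False using lft_id_scalar[OF p] ns by blast
    next
      case nz: False
      have A: "lft p 0 * ?K z = lft p ?s - ?s" if "cmod z < 1" for z
        using R[OF id that] by (simp add: algebra_simps)
      have "lft p 0 * ?K 0 = lft p 0 * ?K (1/2)"
        by (rule trans[OF A A[symmetric]]) auto
      then have "?K 0 = ?K (1/2)" using nz by (metis mult_left_cancel)
      from dkernel_inj[OF points(2) False _ _ this] show False by simp
    qed
  next
    case True
    have K: "?K z = 1" for z by (simp add: True dkernel_def)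
    have e1: "lft p 0 - lft p ?s + ?s = 0" using R[OF id, of 0] by (simp add: K)
    have e2: "(lft p 0)^2 - (lft p ?s)^2 + ?s^2 = 0" using R[OF dir_space_power[of 2], of 0] by (simp add: K)
    \<comment> \<open>With A = p(0), S = \<open>?s\<close> and B = p(S), the tests on z and z^2 give
      A + S = B and A^2 + S^2 = B^2, hence 2 A S = 0.\<close>
    have "lft p 0 * ?s = 0" using e1 e2 by algebra
    \<comment> \<open>If \<open>q\<close> and \<open>kadj q\<close> both fix 0, the matrix is
      diagonal, and a fixed point on the circle makes it scalar.\<close>
    moreover have "?s \<noteq> 0"
    proof
      assume s0: "?s = 0"
      obtain a b c d where qe: "q = (a, b, c, d)" by (cases q)
      have d: "d \<noteq> 0" using lfsm_denom_nz[OF q, of 0] by (simp add: qe)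
      have "b = 0" using True d by (simp add: qe lft_def)
      moreover have "c = 0" using s0 d by (simp add: qe lft_def)
      moreover have "cnj a = cnj d"
        using u calculation by (auto simp: Some_fixset_iff qe)
      ultimately show False using ns by (simp add: qe)
    qed
    ultimately have p0: "lft p 0 = 0" by simp
    then have ps: "lft p ?s = ?s" using e1 by simp
    \<comment> \<open>Two fixed points inside the disk and one on the circle are more than a
      non-scalar map has.\<close>
    have "Some 0 \<in> fixset p" "Some ?s \<in> fixset p"
      using Some_fixset_lft[OF p, of 0] Some_fixset_lft[OF p, of ?s] p0 ps points by auto
    then show False
      using fixset_cases[OF ns(1) u(2)] u points(3) \<open>?s \<noteq> 0\<close>
      by (metis insertE norm_zero option.inject order_less_irrefl singletonD zero_neq_one)
  qed
qed

lemma nontriv_imp_fixset: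
  assumes na: "\<not> is_disk_aut p \<or> \<not> is_disk_aut q" and nt: "nontriv_compact_comm adj_q comp_p"
  obtains \<zeta> where "cmod \<zeta> = 1" "Some \<zeta> \<in> fixset p" "fixset sig = fixset p" "\<not> scalar p"
proof -
  have c: "dir_compact (commutator adj_q comp_p)" "dir_nonzero (commutator adj_q comp_p)"
    "\<not> dir_compact (adj_q \<circ> comp_p)"
    using nt by (auto simp: nontriv_compact_comm_def)
  have ns: "\<not> scalar p" "\<not> scalar q" "\<not> scalar sig"
    using c(2) comm_zero_of_scalar by (auto simp: dir_nonzero_def scalar_kadj)
  obtain \<eta> where \<eta>: "cmod \<eta> = 1" "cmod (lft (mcomp p sig) \<eta>) = 1"
    using c(3) compact_adj_comp by blast
  obtain k where k: "k \<noteq> 0" "mcomp sig p = cscale k (mcomp p sig)"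
    by (rule compact_comm_imp_commute[OF c(1) \<eta>])
  have k': "1 / k \<noteq> 0" "mcomp p sig = cscale (1 / k) (mcomp sig p)"
    using k(1) unfolding k(2) by (simp, cases "mcomp p sig", simp)
  have \<eta>': "cmod (lft (mcomp sig p) \<eta>) = 1" using \<eta>(2) unfolding k(2) lft_cscale[OF k(1)] .
  obtain \<zeta> where z: "cmod \<zeta> = 1" "lft p \<zeta> = \<zeta>" "lft sig \<zeta> = \<zeta>"
  \<comment> \<open>A map that touches the circle at most once is taken as \<open>Q\<close> in
    \<open>common_fixed_point\<close>; exchanging the two maps replaces \<open>k\<close> by
    \<open>1 / k\<close>.\<close>
  proof (cases "is_disk_aut q")
    case False
    have "touches_once sig" by (rule touches_once_kadj[OF q False])
    from common_fixed_point[OF p ns(1) sig this k \<eta>] that show ?thesis by blast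
  next
    case True
    then have "touches_once p" using na touches_once_nonaut[OF p] by blast
    from common_fixed_point[OF sig ns(3) p this k' \<eta>(1) \<eta>'] that show ?thesis by blast
  qed
  have D: "denom p \<zeta> \<noteq> 0" "denom sig \<zeta> \<noteq> 0"
    using lfsm_denom_nz[OF p, of \<zeta>] lfsm_denom_nz[OF sig, of \<zeta>] z by auto
  \<comment> \<open>At a common fixed point both products have the same nonzero denominator, so
    \<open>k = 1\<close> and the matrices themselves commute.\<close>
  have "denom (mcomp sig p) \<zeta> = k * denom (mcomp p sig) \<zeta>" unfolding k(2) denom_cscale ..
  then have "denom p \<zeta> * denom sig \<zeta> = k * (denom sig \<zeta> * denom p \<zeta>)"
    using denom_mcomp[OF D(1), of sig] denom_mcomp[OF D(2), of p] z by simp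
  then have "k = 1" using D by simp
  then have "mcomp p sig = mcomp sig p" unfolding k(2) by (cases "mcomp p sig") simp
  then have "parallel p sig" by (simp add: commute_iff_parallel)
  from parallel_imp_fixset_eq[OF ns(1,3) this] have "fixset sig = fixset p" .
  moreover have "Some \<zeta> \<in> fixset p" using Some_fixset_lft[OF p, of \<zeta>] z by simp
  ultimately show ?thesis using that z ns by blast
qed

lemma fixset_imp_nontriv:
  assumes u: "cmod \<zeta> = 1" "Some \<zeta> \<in> fixset p" "fixset sig = fixset p" "\<not> scalar p" "\<not> scalar q"
  shows "nontriv_compact_comm adj_q comp_p"
proof -
  have ns: "\<not> scalar sig" using u(5) by (simp add: scalar_kadj)
  have comm: "mcomp p sig = mcomp sig p"
    unfolding commute_iff_parallel by (rule fixset_eq_imp_parallel[OF u(4) ns u(2,3)])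
  have fp: "lft p \<zeta> = \<zeta>" "lft sig \<zeta> = \<zeta>"
    using u Some_fixset_lft[OF p, of \<zeta>] Some_fixset_lft[OF sig, of \<zeta>] by auto
  have t: "cmod (lft (mcomp p sig) \<zeta>) = 1" using lft_mcomp[OF sig, of \<zeta> p] u fp by simp
  show ?thesis
    unfolding nontriv_compact_comm_def
    using commute_imp_compact_comm[OF comm] comm_nonzero[OF comm u(4,5) u(1,2)] u
      not_compact_adj_comp[OF u(1) t] not_compact_comp_adj[OF u(1) t[unfolded comm]] by auto
qed

end

theorem theorem4p4:
  fixes p q :: coeffs
  assumes "is_lfsm p" and "is_lfsm q"
    and "\<not> is_disk_aut p \<or> \<not> is_disk_aut q"
  shows "nontriv_compact_comm (dir_adjoint (comp_op (lft q))) (comp_op (lft p)) \<longleftrightarrow>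
    ((\<exists>\<zeta>. parabolic_at p \<zeta> \<and> parabolic_at q \<zeta>) \<or>
     (\<exists>\<zeta> a. hyperbolic_at p \<zeta> \<and> hyperbolic_at q \<zeta> \<and> a \<noteq> Some \<zeta> \<and>
        fixset p = {Some \<zeta>, a} \<and> fixset q = {Some \<zeta>, circ_refl a}))"
    (is "?N \<longleftrightarrow> ?R")
proof
  assume ?N
  then obtain \<zeta> where z: "cmod \<zeta> = 1" "Some \<zeta> \<in> fixset p" "fixset (kadj q) = fixset p" "\<not> scalar p"
    using nontriv_imp_fixset[OF assms(1,2,3)]
    by blast
  \<comment> \<open>The reflection rule is applied to \<open>kadj q\<close>, whose Krein adjoint is
    \<open>q\<close>.\<close>
  have fq: "fixset q = circ_refl ` fixset p" using fixset_kadj[of "kadj q"] z(3) by simp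
  show ?R
  proof (rule fixset_cases[OF z(4,2)])
    assume *: "fixset p = {Some \<zeta>}"
    then have "fixset q = {Some \<zeta>}" using fq circ_refl_unit[OF z(1)] by simp
    then show ?R using * z(1) unfolding parabolic_at_def by blast
  next
    fix w assume w: "w \<noteq> Some \<zeta>" and *: "fixset p = {Some \<zeta>, w}"
    then have q: "fixset q = {Some \<zeta>, circ_refl w}" using fq circ_refl_unit[OF z(1)] by simp
    have "circ_refl w \<noteq> Some \<zeta>" using w circ_refl_circ_refl circ_refl_unit[OF z(1)] by metis
    then show ?R using w * q z(1) unfolding hyperbolic_at_def by blast
  qed
next
  assume R: ?R
  obtain \<zeta> where z: "cmod \<zeta> = 1" "Some \<zeta> \<in> fixset p" "fixset (kadj q) = fixset p" "\<not> scalar p" "\<not> scalar q"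
    using R
  proof (elim disjE exE conjE)
    fix \<zeta> assume "parabolic_at p \<zeta>" "parabolic_at q \<zeta>"
    then have *: "cmod \<zeta> = 1" "fixset p = {Some \<zeta>}" "fixset q = {Some \<zeta>}"
      by (auto simp: parabolic_at_def)
    then show thesis
      using that[of \<zeta>] fixset_kadj[of q] circ_refl_unit[OF *(1)]
        fixset_nonscalar[of p "Some \<zeta>" "Some \<zeta>"] fixset_nonscalar[of q "Some \<zeta>" "Some \<zeta>"] by simp
  next
    fix \<zeta> a assume "hyperbolic_at p \<zeta>" "fixset p = {Some \<zeta>, a}" "fixset q = {Some \<zeta>, circ_refl a}"
    then have *: "cmod \<zeta> = 1" "fixset p = {Some \<zeta>, a}" "fixset q = {Some \<zeta>, circ_refl a}"
      by (auto simp: hyperbolic_at_def)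
    show thesis
      using that[of \<zeta>] * fixset_kadj[of q] circ_refl_unit[OF *(1)] circ_refl_circ_refl[of a]
        fixset_nonscalar[OF *(2)] fixset_nonscalar[OF *(3)] by simp
  qed
  show ?N
    using fixset_imp_nontriv[OF assms(1,2), of \<zeta>] z
    by blast
qed

end
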